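(* For all bouquets $\Phi,\Psi$: if $\Phi\models\Psi$ then $\Phi\vdash_{\mathsf N}\Psi$.
   Context: Fix a countable set $\mathcal{V}$ of variables and a first-order signature: a countable set $\mathcal{P}$ of predicate symbols with arities $\mathrm{ar}:\mathcal{P}\to\mathbb{N}$. Flowers and gardens by mutual induction: atoms $p(\vec x)$ ($\vec x\in\mathcal V^{\mathrm{ar}(p)}$) are flowers; if $\mathbf{x}\subset\mathcal{V}$ is finite (a sprinkler) and $\Phi$ a finite multiset of flowers (a bouquet), $\mathbf{x}\cdot\Phi$ is a garden; if $\gamma$ is a garden (pistil) and $\Delta$ a finite multiset of gardens (petals), $\gamma\rhd\Delta$ is a flower, also written $\gamma\rhd\delta_1;\dots;\delta_n$. $\emptyset\cdot\Phi$ is written $\Phi$; $\emptyset$ is the empty bouquet; comma is multiset union; $\mathbf x,\mathbf y$ denotes $\mathbf x\cup\mathbf y$. Free variables: $\mathrm{fv}(p(\vec x))$ = variables of $\vec x$; $\mathrm{fv}(\Phi)=\bigcup\mathrm{fv}(\phi)$; $\mathrm{fv}(\mathbf{x}\cdot\Phi)=\mathrm{fv}(\Phi)\setminus\mathbf{x}$; $\mathrm{fv}(\mathbf{x}\cdot\Phi\rhd\Delta)=\mathrm{fv}(\mathbf{x}\cdot\Phi)\cup\bigcup_{\mathbf{y}\cdot\Psi\in\Delta}\mathrm{fv}((\mathbf{x}\cup\mathbf{y})\cdot\Psi)$. Bound variables: $\mathrm{bv}(p(\vec x))=\emptyset$, $\mathrm{bv}(\Phi)=\bigcup\mathrm{bv}(\phi)$,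 $\mathrm{bv}(\mathbf x\cdot\Phi)=\mathbf x\cup\mathrm{bv}(\Phi)$, $\mathrm{bv}(\gamma\rhd\Delta)=\mathrm{bv}(\gamma)\cup\bigcup_{\delta\in\Delta}\mathrm{bv}(\delta)$. Standing convention: every bouquet considered has pairwise distinct binders and $\mathrm{bv}(\Phi)\cap\mathrm{fv}(\Phi)=\emptyset$. Substitutions: $f[R\mapsto g]$ equals $g$ on $R$ and $f$ elsewhere. A substitution is $\sigma:\mathcal V\to\mathcal V$ with finite support; $\sigma:\mathbf y$ means support $\mathbf y$; $\sigma_{-\mathbf x}:=\sigma[\mathbf x\mapsto\mathrm{id}]$. Action: $\sigma(p(x_1,\dots,x_n))=p(\sigma(x_1),\dots,\sigma(x_n))$, elementwise on bouquets, $\sigma(\mathbf x\cdot\Phi)=\mathbf x\cdot\sigma_{-\mathbf x}(\Phi)$, $\sigma(\mathbf x\cdot\Phi\rhd\delta_1;\dots;\delta_n)=\sigma(\mathbf x\cdot\Phi)\rhd\sigma_{-\mathbf x}(\delta_1);\dots;\sigma_{-\mathbf x}(\delta_n)$. $\sigma:\mathbf y$ is capture-avoiding in $\Phi$ if $\sigma(\mathbf y)\cap\mathrm{bv}(\Phi)=\emptyset$. Contexts: $\Xi::=\Psi,\xi$, $\xi::=\Box\mid(\mathbf x\cdot\Xi\rhd\Delta)\mid(\gamma\rhd\mathbf x\cdot\Xi;\Delta)$; $\Xi\{\Psi\}$ fills the hole with bouquet $\Psi$, $\Xi\{\}$ with $\emptyset$. A flower $\phi$ can be pollinated in $\Xi$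 if there are a bouquet $\Psi\ni\phi$ and contexts $\Xi',\Xi_0$ with $\Xi=\Xi'\{\Psi,\Xi_0\}$ or $\Xi=\Xi'\{\mathbf x\cdot\Psi\rhd\mathbf y\cdot\Xi_0;\Delta\}$; a bouquet can be pollinated if each flower can. Natural rules $\mathsf N$ (conclusion $\to$ premiss): (poll↓) $\Xi\{\Phi\}\to\Xi\{\}$, (poll↑) $\Xi\{\}\to\Xi\{\Phi\}$ when $\Phi$ can be pollinated in $\Xi$; (epis) $\Phi\to(\emptyset\cdot\emptyset\rhd\emptyset\cdot\Phi)$; (epet) $(\gamma\rhd\emptyset\cdot\emptyset;\Delta)\to\emptyset$; (srep) $(\mathbf x\cdot(\Phi,(\emptyset\cdot\emptyset\rhd\gamma_1;\dots;\gamma_n))\rhd\Delta)\to(\mathbf x\cdot\Phi\rhd\emptyset\cdot\{(\gamma_1\rhd\Delta),\dots,(\gamma_n\rhd\Delta)\})$; (ipis) $(\mathbf x,\mathbf y\cdot\Phi\rhd\Delta)\to(\mathbf x\cdot\sigma(\Phi)\rhd\sigma(\Delta)),(\mathbf x,\mathbf y\cdot\Phi\rhd\Delta)$ with $\sigma:\mathbf y$ capture-avoiding in $(\emptyset\cdot\Phi\rhd\Delta)$; (ipet) $(\gamma\rhd\mathbf x,\mathbf y\cdot\Phi;\Delta)\to(\gamma\rhd\mathbf x\cdot\sigma(\Phi);\mathbf x,\mathbf y\cdot\Phi;\Delta)$ with $\sigma:\mathbf y$ capture-avoiding in $\Phi$. Natural steps are closed under all contexts. $\Phi\to^*_{\mathsf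 N}\Psi$: finite sequence of natural steps. $\Psi\vdash_{\mathsf N}\Phi$ means $\Xi\{\Phi\}\to^*_{\mathsf N}\Xi\{\}$ for every context $\Xi$ in which $\Psi$ can be pollinated. Semantics: a Kripke structure $(W,\le,(M_w)_{w\in W})$ has a preorder $\le$ on worlds and, for each $w$, a nonempty domain $M_w$ and relations $[\![p]\!]_w\subseteq M_w^{\mathrm{ar}(p)}$, monotone along $\le$ ($M_w\subseteq M_{w'}$, $[\![p]\!]_w\subseteq[\![p]\!]_{w'}$). A $w$-evaluation is $e:\mathcal V\to M_w$. Forcing: $w\Vdash_e p(x_1,\dots,x_n)$ iff $(e(x_1),\dots,e(x_n))\in[\![p]\!]_w$; $w\Vdash_e\Phi$ iff $w\Vdash_e\phi$ for all $\phi\in\Phi$; $w\Vdash_e(\mathbf x\cdot\Phi\rhd\mathbf x_1\cdot\Phi_1;\dots;\mathbf x_n\cdot\Phi_n)$ iff for every $w'\ge w$ and $w'$-evaluation $e'$ with $w'\Vdash_{e[\mathbf x\mapsto e']}\Phi$, there are $i$ and a $w'$-evaluation $e''$ with $w'\Vdash_{e[\mathbf x\mapsto e'][\mathbf x_i\mapsto e'']}\Phi_i$. $\Phi\models\Psi$ means that in every Kripke structure, at every world $w$ and $w$-evaluation $e$, $w\Vdash_e\Phi$ implies $w\Vdash_e\Psi$. *)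

theory Defs
  imports "HOL-Library.Multiset" "HOL-Library.FSet" "HOL-Library.Countable"
begin

section \<open>Flowers and gardens\<close>

datatype ('p, 'v) flower =
    Atom 'p "'v list"
  | Flower "('p, 'v) garden" "('p, 'v) garden multiset"  (infix "\<rhd>" 60)
and ('p, 'v) garden =
    Garden (sprinkler: "'v fset") (body: "('p, 'v) flower multiset")  (infix "\<cdot>" 70)

type_synonym ('p, 'v) bouquet = "('p, 'v) flower multiset"

lemma size_flower_less [termination_simp]: "\<phi> \<in># \<Phi> \<Longrightarrow> size \<phi> < Suc (n + size_multiset size \<Phi>)"
  for \<phi> :: "('p, 'v) flower"
  by (induction \<Phi>) auto

lemma size_garden_less [termination_simp]: "\<delta> \<in># \<Delta> \<Longrightarrow> size \<delta> < Suc (size_multiset size \<Delta> + n)"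
  for \<delta> :: "('p, 'v) garden"
  by (induction \<Delta>) auto

fun wf_flower :: "('p \<Rightarrow> nat) \<Rightarrow> ('p, 'v) flower \<Rightarrow> bool"
  and wf_garden :: "('p \<Rightarrow> nat) \<Rightarrow> ('p, 'v) garden \<Rightarrow> bool" where
  "wf_flower ar (Atom p xs) \<longleftrightarrow> length xs = ar p"
| "wf_flower ar (\<gamma> \<rhd> \<Delta>) \<longleftrightarrow> wf_garden ar \<gamma> \<and> (\<forall>\<delta>\<in>set_mset \<Delta>. wf_garden ar \<delta>)"
| "wf_garden ar (x \<cdot> \<Phi>) \<longleftrightarrow> (\<forall>\<phi>\<in>set_mset \<Phi>. wf_flower ar \<phi>)"

text \<open>
  In the second equation, subtracting the pistil's sprinkler \<open>x\<close> from the free variables of a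
  petal \<open>y \<cdot> \<Psi>\<close> gives the free variables of \<open>(x |\<union>| y) \<cdot> \<Psi>\<close>: the
  pistil's sprinkler also binds in the petals.
\<close>

fun fv_flower :: "('p, 'v) flower \<Rightarrow> 'v set"
  and fv_garden :: "('p, 'v) garden \<Rightarrow> 'v set" where
  "fv_flower (Atom p xs) = set xs"
| "fv_flower (\<gamma> \<rhd> \<Delta>) =
     fv_garden \<gamma> \<union> (\<Union>\<delta>\<in>set_mset \<Delta>. fv_garden \<delta> - fset (sprinkler \<gamma>))"
| "fv_garden (x \<cdot> \<Phi>) = (\<Union>\<phi>\<in>set_mset \<Phi>. fv_flower \<phi>) - fset x"

fun bv_flower :: "('p, 'v) flower \<Rightarrow> 'v set"
  and bv_garden :: "('p, 'v) garden \<Rightarrow> 'v set" where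
  "bv_flower (Atom p xs) = {}"
| "bv_flower (\<gamma> \<rhd> \<Delta>) = bv_garden \<gamma> \<union> (\<Union>\<delta>\<in>set_mset \<Delta>. bv_garden \<delta>)"
| "bv_garden (x \<cdot> \<Phi>) = fset x \<union> (\<Union>\<phi>\<in>set_mset \<Phi>. bv_flower \<phi>)"

definition fv :: "('p, 'v) bouquet \<Rightarrow> 'v set" where
  "fv \<Phi> = (\<Union>\<phi>\<in>set_mset \<Phi>. fv_flower \<phi>)"

definition bv :: "('p, 'v) bouquet \<Rightarrow> 'v set" where
  "bv \<Phi> = (\<Union>\<phi>\<in>set_mset \<Phi>. bv_flower \<phi>)"

text \<open>The variables of all sprinklers, counted with the number of sprinklers they occur in.\<close>

fun binders_flower :: "('p, 'v) flower \<Rightarrow> 'v multiset"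
  and binders_garden :: "('p, 'v) garden \<Rightarrow> 'v multiset" where
  "binders_flower (Atom p xs) = {#}"
| "binders_flower (\<gamma> \<rhd> \<Delta>) =
     binders_garden \<gamma> + sum_mset (image_mset binders_garden \<Delta>)"
| "binders_garden (x \<cdot> \<Phi>) =
     mset_set (fset x) + sum_mset (image_mset binders_flower \<Phi>)"

definition distinct_binders :: "('p, 'v) bouquet \<Rightarrow> bool" where
  "distinct_binders \<Phi> \<longleftrightarrow> (\<forall>v. count (sum_mset (image_mset binders_flower \<Phi>)) v \<le> 1)"

definition is_bouquet :: "('p \<Rightarrow> nat) \<Rightarrow> ('p, 'v) bouquet \<Rightarrow> bool" where
  "is_bouquet ar \<Phi> \<longleftrightarrow>
     (\<forall>\<phi>\<in>set_mset \<Phi>. wf_flower ar \<phi>) \<and> distinct_binders \<Phi> \<and> bv \<Phi> \<inter> fv \<Phi> = {}"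


section \<open>Substitutions\<close>

text \<open>\<open>override_on f g R\<close> is $f[R \mapsto g]$, so \<open>override_on \<sigma> id x\<close> is $\sigma_{-x}$.\<close>

fun subst_flower :: "('v \<Rightarrow> 'v) \<Rightarrow> ('p, 'v) flower \<Rightarrow> ('p, 'v) flower"
  and subst_garden :: "('v \<Rightarrow> 'v) \<Rightarrow> ('p, 'v) garden \<Rightarrow> ('p, 'v) garden" where
  "subst_flower \<sigma> (Atom p xs) = Atom p (map \<sigma> xs)"
| "subst_flower \<sigma> (\<gamma> \<rhd> \<Delta>) =
     subst_garden \<sigma> \<gamma> \<rhd> image_mset (subst_garden (override_on \<sigma> id (fset (sprinkler \<gamma>)))) \<Delta>"
| "subst_garden \<sigma> (x \<cdot> \<Phi>) = x \<cdot> image_mset (subst_flower (override_on \<sigma> id (fset x))) \<Phi>"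

definition has_support :: "('v \<Rightarrow> 'v) \<Rightarrow> 'v fset \<Rightarrow> bool" where
  "has_support \<sigma> y \<longleftrightarrow> {v. \<sigma> v \<noteq> v} = fset y"

definition capture_avoiding :: "('v \<Rightarrow> 'v) \<Rightarrow> 'v fset \<Rightarrow> ('p, 'v) bouquet \<Rightarrow> bool" where
  "capture_avoiding \<sigma> y \<Phi> \<longleftrightarrow> \<sigma> ` fset y \<inter> bv \<Phi> = {}"


section \<open>Contexts\<close>

text \<open>\<open>Ctx \<Psi> \<xi>\<close> is $\Psi, \xi$.\<close>

datatype ('p, 'v) ctx =
    Ctx "('p, 'v) bouquet" "('p, 'v) fctx"
and ('p, 'v) fctx =
    Hole
  | InPistil "'v fset" "('p, 'v) ctx" "('p, 'v) garden multiset"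
  | InPetal "('p, 'v) garden" "'v fset" "('p, 'v) ctx" "('p, 'v) garden multiset"

primrec fill :: "('p, 'v) ctx \<Rightarrow> ('p, 'v) bouquet \<Rightarrow> ('p, 'v) bouquet"
  and fill_f :: "('p, 'v) fctx \<Rightarrow> ('p, 'v) bouquet \<Rightarrow> ('p, 'v) bouquet" where
  "fill (Ctx \<Psi> \<xi>) \<Phi> = \<Psi> + fill_f \<xi> \<Phi>"
| "fill_f Hole \<Phi> = \<Phi>"
| "fill_f (InPistil x \<Xi> \<Delta>) \<Phi> = {# (x \<cdot> fill \<Xi> \<Phi>) \<rhd> \<Delta> #}"
| "fill_f (InPetal \<gamma> x \<Xi> \<Delta>) \<Phi> = {# \<gamma> \<rhd> add_mset (x \<cdot> fill \<Xi> \<Phi>) \<Delta> #}"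

primrec add_ctx :: "('p, 'v) bouquet \<Rightarrow> ('p, 'v) ctx \<Rightarrow> ('p, 'v) ctx" where
  "add_ctx \<Phi> (Ctx \<Psi> \<xi>) = Ctx (\<Phi> + \<Psi>) \<xi>"

text \<open>Filling the hole of a context with a context.\<close>

primrec fill_ctx :: "('p, 'v) ctx \<Rightarrow> ('p, 'v) ctx \<Rightarrow> ('p, 'v) ctx"
  and fill_ctx_f :: "('p, 'v) fctx \<Rightarrow> ('p, 'v) ctx \<Rightarrow> ('p, 'v) ctx" where
  "fill_ctx (Ctx \<Psi> \<xi>) \<Theta> = add_ctx \<Psi> (fill_ctx_f \<xi> \<Theta>)"
| "fill_ctx_f Hole \<Theta> = \<Theta>"
| "fill_ctx_f (InPistil x \<Xi> \<Delta>) \<Theta> = Ctx {#} (InPistil x (fill_ctx \<Xi> \<Theta>) \<Delta>)"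
| "fill_ctx_f (InPetal \<gamma> x \<Xi> \<Delta>) \<Theta> = Ctx {#} (InPetal \<gamma> x (fill_ctx \<Xi> \<Theta>) \<Delta>)"

text \<open>The context operations agree with filling.\<close>

lemma fill_add_ctx: "fill (add_ctx \<Phi> \<Xi>) \<Psi> = \<Phi> + fill \<Xi> \<Psi>"
  by (cases \<Xi>) (simp add: add.assoc)

lemma fill_fill_ctx: "fill (fill_ctx \<Xi> \<Theta>) \<Phi> = fill \<Xi> (fill \<Theta> \<Phi>)"
  and "fill (fill_ctx_f \<xi> \<Theta>) \<Phi> = fill_f \<xi> (fill \<Theta> \<Phi>)"
  by (induction \<Xi> and \<xi>) (simp_all add: fill_add_ctx)


section \<open>Renaming of bound variables\<close>

text \<open>
  That every bouquet has pairwise distinct binders, disjoint from its free variables, is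
  Barendregt's variable convention, and it presupposes that bouquets are considered up to renaming
  of bound variables: copying a flower, as pollination and instantiation do, duplicates its binders,
  and without the convention pollination captures free variables and is unsound. This equivalence
  is generated by renaming, anywhere in a bouquet, a sub-bouquet or a petal along a bijection that
  fixes its free variables; \<open>map_flower id \<rho>\<close> renames free and bound variables alike.
\<close>

inductive alpha_step :: "('p, 'v) bouquet \<Rightarrow> ('p, 'v) bouquet \<Rightarrow> bool" where
  alpha_bouquet: "bij \<rho> \<Longrightarrow> (\<And>v. v \<in> fv \<Phi> \<Longrightarrow> \<rho> v = v) \<Longrightarrow>
     alpha_step (fill \<Xi> \<Phi>) (fill \<Xi> (image_mset (map_flower id \<rho>) \<Phi>))"
| alpha_petal: "bij \<rho> \<Longrightarrow> (\<And>v. v \<in> fv_garden \<delta> \<Longrightarrow> \<rho> v = v) \<Longrightarrow>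
     alpha_step (fill \<Xi> {# \<gamma> \<rhd> add_mset \<delta> \<Delta> #})
                (fill \<Xi> {# \<gamma> \<rhd> add_mset (map_garden id \<rho> \<delta>) \<Delta> #})"

definition alpha_eq :: "('p, 'v) bouquet \<Rightarrow> ('p, 'v) bouquet \<Rightarrow> bool"  (infix "\<approx>\<^sub>\<alpha>" 50) where
  "alpha_eq = alpha_step\<^sup>*\<^sup>*"


section \<open>The natural rules\<close>

definition can_pollinate_flower :: "('p, 'v) flower \<Rightarrow> ('p, 'v) ctx \<Rightarrow> bool" where
  "can_pollinate_flower \<phi> \<Xi> \<longleftrightarrow>
     (\<exists>\<Psi> \<Xi>' \<Xi>\<^sub>0. (\<exists>\<psi>\<in>set_mset \<Psi>. {#\<phi>#} \<approx>\<^sub>\<alpha> {#\<psi>#}) \<and>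
        (\<Xi> = fill_ctx \<Xi>' (add_ctx \<Psi> \<Xi>\<^sub>0) \<or>
         (\<exists>x y \<Delta>. \<Xi> = fill_ctx \<Xi>' (Ctx {#} (InPetal (x \<cdot> \<Psi>) y \<Xi>\<^sub>0 \<Delta>)))))"

definition can_pollinate :: "('p, 'v) bouquet \<Rightarrow> ('p, 'v) ctx \<Rightarrow> bool" where
  "can_pollinate \<Phi> \<Xi> \<longleftrightarrow> (\<forall>\<phi>\<in>set_mset \<Phi>. can_pollinate_flower \<phi> \<Xi>)"

inductive natural_rule :: "('p, 'v) bouquet \<Rightarrow> ('p, 'v) bouquet \<Rightarrow> bool" where
  poll_down: "can_pollinate \<Phi> \<Xi> \<Longrightarrow> natural_rule (fill \<Xi> \<Phi>) (fill \<Xi> {#})"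
| poll_up: "can_pollinate \<Phi> \<Xi> \<Longrightarrow> natural_rule (fill \<Xi> {#}) (fill \<Xi> \<Phi>)"
| epis: "natural_rule \<Phi> {# ({||} \<cdot> {#}) \<rhd> {# {||} \<cdot> \<Phi> #} #}"
| epet: "natural_rule {# \<gamma> \<rhd> add_mset ({||} \<cdot> {#}) \<Delta> #} {#}"
| srep: "natural_rule
     {# (x \<cdot> add_mset (({||} \<cdot> {#}) \<rhd> \<Gamma>) \<Phi>) \<rhd> \<Delta> #}
     {# (x \<cdot> \<Phi>) \<rhd> {# {||} \<cdot> image_mset (\<lambda>\<gamma>. \<gamma> \<rhd> \<Delta>) \<Gamma> #} #}"
| ipis: "has_support \<sigma> y \<Longrightarrow> capture_avoiding \<sigma> y {# ({||} \<cdot> \<Phi>) \<rhd> \<Delta> #} \<Longrightarrow>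
   natural_rule
     {# ((x |\<union>| y) \<cdot> \<Phi>) \<rhd> \<Delta> #}
     {# (x \<cdot> image_mset (subst_flower \<sigma>) \<Phi>) \<rhd> image_mset (subst_garden \<sigma>) \<Delta>,
        ((x |\<union>| y) \<cdot> \<Phi>) \<rhd> \<Delta> #}"
| ipet: "has_support \<sigma> y \<Longrightarrow> capture_avoiding \<sigma> y \<Phi> \<Longrightarrow>
   natural_rule
     {# \<gamma> \<rhd> add_mset ((x |\<union>| y) \<cdot> \<Phi>) \<Delta> #}
     {# \<gamma> \<rhd> add_mset (x \<cdot> image_mset (subst_flower \<sigma>) \<Phi>)
             (add_mset ((x |\<union>| y) \<cdot> \<Phi>) \<Delta>) #}"

text \<open>
  Steps act on bouquets up to renaming; a rule is applied to a representative that satisfies the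
  variable convention as a whole, context included.
\<close>

definition natural_step :: "('p \<Rightarrow> nat) \<Rightarrow> ('p, 'v) bouquet \<Rightarrow> ('p, 'v) bouquet \<Rightarrow> bool" where
  "natural_step ar \<Phi> \<Psi> \<longleftrightarrow>
     (\<exists>\<Xi> L R. \<Phi> \<approx>\<^sub>\<alpha> fill \<Xi> L \<and> is_bouquet ar (fill \<Xi> L) \<and> natural_rule L R \<and> fill \<Xi> R \<approx>\<^sub>\<alpha> \<Psi>)"

text \<open>
  Only contexts for which \<open>fill \<Xi> {#}\<close> satisfies the variable convention count. Otherwise a binder
  above the hole could capture a free variable of the pollinating \<open>\<Psi>\<close>. The convention is not
  required of \<open>fill \<Xi> \<Phi>\<close>: \<open>\<Phi>\<close> may share binders with \<open>\<Psi>\<close>, and steps rename them.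
\<close>

definition natural_deriv :: "('p \<Rightarrow> nat) \<Rightarrow> ('p, 'v) bouquet \<Rightarrow> ('p, 'v) bouquet \<Rightarrow> bool" where
  "natural_deriv ar \<Psi> \<Phi> \<longleftrightarrow>
     (\<forall>\<Xi>. is_bouquet ar (fill \<Xi> {#}) \<and> can_pollinate \<Psi> \<Xi> \<longrightarrow>
        (natural_step ar)\<^sup>*\<^sup>* (fill \<Xi> \<Phi>) (fill \<Xi> {#}))"


section \<open>Kripke semantics\<close>

record ('w, 'd, 'p) kripke =
  worlds :: "'w set"
  accessible :: "('w \<times> 'w) set"
  domain :: "'w \<Rightarrow> 'd set"
  interp :: "'w \<Rightarrow> 'p \<Rightarrow> 'd list set"

definition kripke_structure :: "('p \<Rightarrow> nat) \<Rightarrow> ('w, 'd, 'p) kripke \<Rightarrow> bool" where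
  "kripke_structure ar K \<longleftrightarrow>
     preorder_on (worlds K) (accessible K) \<and>
     (\<forall>w\<in>worlds K. domain K w \<noteq> {} \<and>
        (\<forall>p. interp K w p \<subseteq> {ds. length ds = ar p \<and> set ds \<subseteq> domain K w})) \<and>
     (\<forall>(w, w')\<in>accessible K. domain K w \<subseteq> domain K w' \<and> (\<forall>p. interp K w p \<subseteq> interp K w' p))"

definition evaluation :: "('w, 'd, 'p) kripke \<Rightarrow> 'w \<Rightarrow> ('v \<Rightarrow> 'd) \<Rightarrow> bool" where
  "evaluation K w e \<longleftrightarrow> range e \<subseteq> domain K w"

text \<open>\<open>forces_body\<close> ignores the sprinkler of a garden, which is dealt with by \<open>forces_flower\<close>.\<close>

fun forces_flower :: "('w, 'd, 'p) kripke \<Rightarrow> 'w \<Rightarrow> ('v \<Rightarrow> 'd) \<Rightarrow> ('p, 'v) flower \<Rightarrow> bool"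
  and forces_body :: "('w, 'd, 'p) kripke \<Rightarrow> 'w \<Rightarrow> ('v \<Rightarrow> 'd) \<Rightarrow> ('p, 'v) garden \<Rightarrow> bool" where
  "forces_flower K w e (Atom p xs) \<longleftrightarrow> map e xs \<in> interp K w p"
| "forces_flower K w e (\<gamma> \<rhd> \<Delta>) \<longleftrightarrow>
     (\<forall>w' e'. (w, w') \<in> accessible K \<and> evaluation K w' e' \<and>
        forces_body K w' (override_on e e' (fset (sprinkler \<gamma>))) \<gamma> \<longrightarrow>
        (\<exists>\<delta>\<in>set_mset \<Delta>. \<exists>e''. evaluation K w' e'' \<and>
           forces_body K w'
             (override_on (override_on e e' (fset (sprinkler \<gamma>))) e'' (fset (sprinkler \<delta>))) \<delta>))"
| "forces_body K w e (x \<cdot> \<Phi>) \<longleftrightarrow> (\<forall>\<phi>\<in>set_mset \<Phi>. forces_flower K w e \<phi>)"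

definition forces :: "('w, 'd, 'p) kripke \<Rightarrow> 'w \<Rightarrow> ('v \<Rightarrow> 'd) \<Rightarrow> ('p, 'v) bouquet \<Rightarrow> bool" where
  "forces K w e \<Phi> \<longleftrightarrow> (\<forall>\<phi>\<in>set_mset \<Phi>. forces_flower K w e \<phi>)"

text \<open>
  A formula cannot quantify over types, so the types \<open>'w\<close> and \<open>'d\<close> from which worlds and
  individuals are drawn are parameters. Since worlds and domains are subsets of these types,
  \<open>entails TYPE('w) TYPE('d)\<close> covers every structure that embeds into them.
  At \<open>nat set\<close> and \<open>nat\<close> it is implied by entailment over all structures, and equivalent to
  it by the downward Loewenheim-Skolem theorem, the language being countable.
\<close>

definition entails :: "'w itself \<Rightarrow> 'd itself \<Rightarrow>
    ('p \<Rightarrow> nat) \<Rightarrow> ('p, 'v) bouquet \<Rightarrow> ('p, 'v) bouquet \<Rightarrow> bool" where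
  "entails _ _ ar \<Phi> \<Psi> \<longleftrightarrow>
     (\<forall>(K :: ('w, 'd, 'p) kripke) w e.
        kripke_structure ar K \<and> w \<in> worlds K \<and> evaluation K w e \<and> forces K w e \<Phi> \<longrightarrow>
        forces K w e \<Psi>)"

end

theory Submission
  imports Defs
begin

text \<open>
  A bouquet is provable from flowers \<open>H\<close> if it can be erased from every context in which parameter
  instances of \<open>H\<close> are available. Provability has the rules of an intuitionistic sequent calculus.
  To prove \<open>x \<cdot> \<Phi> \<rhd> \<Delta>\<close>, rule epis puts an empty flower into the pistil, and srep turns it into the
  petal \<open>\<emptyset> \<rhd> \<Delta>\<close>, which is erased with \<open>\<Phi>\<close> available. To use an available \<open>x \<cdot> \<Phi> \<rhd> \<Delta>\<close> for a goal
  \<open>\<Psi>\<close>, epis turns \<open>\<Psi>\<close> into \<open>\<emptyset> \<rhd> \<Psi>\<close>, an instance of the flower is pollinated into the pistil, its own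
  pistil is erased, and srep splits the goal into one case for each petal in \<open>\<Delta>\<close>.
  If \<open>\<Psi>\<close> is not derivable from \<open>\<Phi>\<close>, a Henkin construction extends \<open>\<Phi>\<close> to a saturated theory that does
  not derive \<open>\<Psi>\<close>. The saturated theories form a Kripke structure in which flowers of a theory are
  forced and forced flowers are derivable, so \<open>\<Phi>\<close> does not entail \<open>\<Psi>\<close>.
\<close>

text \<open>A natural step applies only to a bouquet that satisfies the variable convention as a
  whole, context included; this obstacle shapes the proof. Binders of a context off the path to the
  hole can always be renamed, while those on the path may bind in the filling and keep their names.
  So only path binders are constrained (\<open>good\<close>), and the others are made fresh whenever
  a rule is applied. The variables are split into a finite set \<open>B\<close> and the parameters
  outside it: hypotheses and goals have their bound variables in \<open>B\<close> and their free
  ones outside, and sprinklers are instantiated by parameters. Then substitution never captures, and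
  the support and capture conditions of ipis and ipet hold automatically. An eigenvariable of a
  proof is a parameter, but in a context the same variable is a sprinkler name that must be new
  there. Provability therefore quantifies over all parameter maps, so that a premise can be used
  with its eigenvariables replaced by such names.\<close>

instance multiset :: (countable) countable
proof (rule countable_classI)
  fix M N :: "'a multiset"
  assume "to_nat (SOME xs. mset xs = M) = to_nat (SOME xs. mset xs = N)"
  moreover have "mset (SOME xs. mset xs = L) = L" for L :: "'a multiset"
    by (rule someI_ex) (rule ex_mset)
  ultimately show "M = N"
    by (metis to_nat_split)
qed

text \<open>Countability is used twice: to enumerate the tasks of the Henkin construction, and to
  code worlds and individuals of the canonical model in \<open>nat set\<close> and
  \<open>nat\<close>, the types at which entailment is assumed.\<close>

instance flower :: (countable, countable) countable
  by countable_datatype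


section \<open>Variables\<close>

definition binders :: "('p, 'v) bouquet \<Rightarrow> 'v multiset" where
  "binders \<Phi> = sum_mset (image_mset binders_flower \<Phi>)"

abbreviation wf :: "('p \<Rightarrow> nat) \<Rightarrow> ('p, 'v) bouquet \<Rightarrow> bool" where
  "wf ar \<Phi> \<equiv> \<forall>\<phi>\<in>set_mset \<Phi>. wf_flower ar \<phi>"

definition distinct_mset :: "'a multiset \<Rightarrow> bool" where
  "distinct_mset M \<longleftrightarrow> (\<forall>v. count M v \<le> 1)"

lemma distinct_mset_empty [simp]: "distinct_mset {#}"
  by (simp add: distinct_mset_def)

lemma distinct_mset_mset_set [simp]: "distinct_mset (mset_set A)"
  by (simp add: distinct_mset_def count_mset_set')

lemma distinct_mset_add [simp]:
  "distinct_mset (M + N) \<longleftrightarrow> distinct_mset M \<and> distinct_mset N \<and> set_mset M \<inter> set_mset N = {}"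
proof -
  have *: "m + n \<le> 1 \<longleftrightarrow> m \<le> 1 \<and> n \<le> 1 \<and> (m = 0 \<or> n = 0)" for m n :: nat
    by auto
  have "set_mset M \<inter> set_mset N = {} \<longleftrightarrow> (\<forall>v. count M v = 0 \<or> count N v = 0)"
    by (auto simp: count_eq_zero_iff)
  then show ?thesis
    unfolding distinct_mset_def count_union * by (simp only: all_conj_distrib)
qed

lemma distinct_mset_single [simp]: "distinct_mset {#x#}"
  by (simp add: distinct_mset_def)

lemma distinct_mset_add_mset [simp]: "distinct_mset (add_mset x M) \<longleftrightarrow> x \<notin># M \<and> distinct_mset M"
  using distinct_mset_add[of "{#x#}" M] by auto

lemma distinct_mset_image: "inj \<rho> \<Longrightarrow> distinct_mset M \<Longrightarrow> distinct_mset (image_mset \<rho> M)"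
  by (induction M) (auto simp: inj_eq)

lemma distinct_binders_iff: "distinct_binders \<Phi> \<longleftrightarrow> distinct_mset (binders \<Phi>)"
  by (simp add: distinct_binders_def distinct_mset_def binders_def)

lemma fv_empty [simp]: "fv {#} = {}" and bv_empty [simp]: "bv {#} = {}"
  and binders_empty [simp]: "binders {#} = {#}"
  by (simp_all add: fv_def bv_def binders_def)

lemma fv_add_mset [simp]: "fv (add_mset \<phi> \<Phi>) = fv_flower \<phi> \<union> fv \<Phi>"
  and bv_add_mset [simp]: "bv (add_mset \<phi> \<Phi>) = bv_flower \<phi> \<union> bv \<Phi>"
  and binders_add_mset [simp]: "binders (add_mset \<phi> \<Phi>) = binders_flower \<phi> + binders \<Phi>"
  by (simp_all add: fv_def bv_def binders_def)

lemma fv_plus [simp]: "fv (\<Phi> + \<Psi>) = fv \<Phi> \<union> fv \<Psi>"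
  and bv_plus [simp]: "bv (\<Phi> + \<Psi>) = bv \<Phi> \<union> bv \<Psi>"
  and binders_plus [simp]: "binders (\<Phi> + \<Psi>) = binders \<Phi> + binders \<Psi>"
  by (auto simp: fv_def bv_def binders_def)

lemma fv_garden_eq [simp]: "fv_garden (x \<cdot> \<Phi>) = fv \<Phi> - fset x"
  and bv_garden_eq [simp]: "bv_garden (x \<cdot> \<Phi>) = fset x \<union> bv \<Phi>"
  and binders_garden_eq [simp]: "binders_garden (x \<cdot> \<Phi>) = mset_set (fset x) + binders \<Phi>"
  by (simp_all add: fv_def bv_def binders_def)

declare fv_garden.simps [simp del] bv_garden.simps [simp del] binders_garden.simps [simp del]

lemma fv_mono: "\<phi> \<in># \<Phi> \<Longrightarrow> fv_flower \<phi> \<subseteq> fv \<Phi>"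
  and bv_mono: "\<phi> \<in># \<Phi> \<Longrightarrow> bv_flower \<phi> \<subseteq> bv \<Phi>"
  by (auto simp: fv_def bv_def)

lemma set_binders_flower [simp]: "set_mset (binders_flower \<phi>) = bv_flower \<phi>"
  and set_binders_garden [simp]: "set_mset (binders_garden \<gamma>) = bv_garden \<gamma>"
  for \<phi> :: "('p, 'v) flower" and \<gamma> :: "('p, 'v) garden"
  by (induction \<phi> and \<gamma>) (auto simp: binders_def bv_def)

lemma set_binders [simp]: "set_mset (binders \<Phi>) = bv \<Phi>"
  by (auto simp: binders_def bv_def)

lemma finite_bv_flower [simp]: "finite (bv_flower \<phi>)" and finite_bv [simp]: "finite (bv \<Phi>)"
  and finite_bv_garden [simp]: "finite (bv_garden \<gamma>)"
  by (metis finite_set_mset set_binders_flower, metis finite_set_mset set_binders,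
      metis finite_set_mset set_binders_garden)

lemma finite_fv_flower [simp]: "finite (fv_flower \<phi>)" and finite_fv_garden [simp]: "finite (fv_garden \<gamma>)"
  for \<phi> :: "('p, 'v) flower" and \<gamma> :: "('p, 'v) garden"
  by (induction \<phi> and \<gamma>) (auto simp: fv_def)

lemma finite_fv [simp]: "finite (fv \<Phi>)"
  by (simp add: fv_def)

lemma distinct_binders_submset:
  "\<phi> \<in># \<Phi> \<Longrightarrow> distinct_mset (binders \<Phi>) \<Longrightarrow> distinct_mset (binders_flower \<phi>)"
  by (metis binders_add_mset distinct_mset_add insert_DiffM)

lemma distinct_binders_petal:
  "\<delta> \<in># \<Delta> \<Longrightarrow> distinct_mset (sum_mset (image_mset binders_garden \<Delta>)) \<Longrightarrow> distinct_mset (binders_garden \<delta>)"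
  by (metis distinct_mset_add image_mset_add_mset insert_DiffM sum_mset.add_mset)

lemma set_sum_binders_garden [simp]:
  "set_mset (sum_mset (image_mset binders_garden \<Delta>)) = (\<Union>\<delta>\<in>set_mset \<Delta>. bv_garden \<delta>)"
  by auto

lemma image_mset_sum_mset: "image_mset f (sum_mset M) = sum_mset (image_mset (image_mset f) M)"
  by (induction M) auto


section \<open>Renaming along bijections\<close>

abbreviation map_bouquet :: "('v \<Rightarrow> 'v) \<Rightarrow> ('p, 'v) bouquet \<Rightarrow> ('p, 'v) bouquet" where
  "map_bouquet \<rho> \<equiv> image_mset (map_flower id \<rho>)"

lemma fv_map_flower: "inj \<rho> \<Longrightarrow> fv_flower (map_flower f \<rho> \<phi>) = \<rho> ` fv_flower \<phi>"
  and fv_map_garden: "inj \<rho> \<Longrightarrow> fv_garden (map_garden f \<rho> \<gamma>) = \<rho> ` fv_garden \<gamma>"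
  for \<phi> :: "('p, 'v) flower" and \<gamma> :: "('p, 'v) garden"
proof (induction \<phi> and \<gamma>)
  case (Flower \<gamma> \<Delta>)
  then show ?case
    by (cases \<gamma>) (auto simp: inj_def)
next
  case (Garden x \<Phi>)
  then show ?case by (auto simp: fv_def inj_def)
qed simp

lemma bv_map_flower: "bv_flower (map_flower f \<rho> \<phi>) = \<rho> ` bv_flower \<phi>"
  and bv_map_garden: "bv_garden (map_garden f \<rho> \<gamma>) = \<rho> ` bv_garden \<gamma>"
  for \<phi> :: "('p, 'v) flower" and \<gamma> :: "('p, 'v) garden"
  by (induction \<phi> and \<gamma>) (auto simp: bv_def)

lemma binders_map_flower:
    "inj \<rho> \<Longrightarrow> binders_flower (map_flower f \<rho> \<phi>) = image_mset \<rho> (binders_flower \<phi>)"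
  and binders_map_garden:
    "inj \<rho> \<Longrightarrow> binders_garden (map_garden f \<rho> \<gamma>) = image_mset \<rho> (binders_garden \<gamma>)"
  for \<phi> :: "('p, 'v) flower" and \<gamma> :: "('p, 'v) garden"
proof (induction \<phi> and \<gamma>)
  case (Flower \<gamma> \<Delta>)
  have "image_mset binders_garden (image_mset (map_garden f \<rho>) \<Delta>)
      = image_mset (image_mset \<rho>) (image_mset binders_garden \<Delta>)"
    using Flower by (auto simp: multiset.map_comp o_def intro: image_mset_cong)
  with Flower show ?case by (simp add: image_mset_sum_mset)
next
  case (Garden x \<Phi>)
  have "image_mset binders_flower (image_mset (map_flower f \<rho>) \<Phi>)
      = image_mset (image_mset \<rho>) (image_mset binders_flower \<Phi>)"
    using Garden by (auto simp: multiset.map_comp o_def intro: image_mset_cong)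
  with Garden show ?case
    by (simp add: binders_def image_mset_sum_mset image_mset_mset_set inj_on_subset[OF Garden(2)])
qed simp

lemma wf_map_flower [simp]: "wf_flower ar (map_flower id \<rho> \<phi>) = wf_flower ar \<phi>"
  and wf_map_garden [simp]: "wf_garden ar (map_garden id \<rho> \<gamma>) = wf_garden ar \<gamma>"
  for \<phi> :: "('p, 'v) flower" and \<gamma> :: "('p, 'v) garden"
  by (induction \<phi> and \<gamma>) auto

lemma fv_map_bouquet: "inj \<rho> \<Longrightarrow> fv (map_bouquet \<rho> \<Phi>) = \<rho> ` fv \<Phi>"
  and bv_map_bouquet: "bv (map_bouquet \<rho> \<Phi>) = \<rho> ` bv \<Phi>"
  and binders_map_bouquet: "inj \<rho> \<Longrightarrow> binders (map_bouquet \<rho> \<Phi>) = image_mset \<rho> (binders \<Phi>)"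
  by (induction \<Phi>) (simp_all add: fv_map_flower bv_map_flower binders_map_flower image_Un)


section \<open>Substitutions\<close>

abbreviation subst :: "('v \<Rightarrow> 'v) \<Rightarrow> ('p, 'v) bouquet \<Rightarrow> ('p, 'v) bouquet" where
  "subst \<sigma> \<equiv> image_mset (subst_flower \<sigma>)"

abbreviation without :: "('v \<Rightarrow> 'v) \<Rightarrow> 'v set \<Rightarrow> 'v \<Rightarrow> 'v" where
  "without \<sigma> \<equiv> override_on \<sigma> id"

lemma sprinkler_subst [simp]: "sprinkler (subst_garden \<sigma> \<gamma>) = sprinkler \<gamma>"
  by (cases \<gamma>) simp

lemma bv_subst_flower [simp]: "bv_flower (subst_flower \<sigma> \<phi>) = bv_flower \<phi>"
  and bv_subst_garden [simp]: "bv_garden (subst_garden \<sigma> \<gamma>) = bv_garden \<gamma>"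
  for \<phi> :: "('p, 'v) flower" and \<gamma> :: "('p, 'v) garden"
  by (induction \<sigma> \<phi> and \<sigma> \<gamma> rule: subst_flower_subst_garden.induct) (auto simp: bv_def)

lemma binders_subst_flower [simp]: "binders_flower (subst_flower \<sigma> \<phi>) = binders_flower \<phi>"
  and binders_subst_garden [simp]: "binders_garden (subst_garden \<sigma> \<gamma>) = binders_garden \<gamma>"
  for \<phi> :: "('p, 'v) flower" and \<gamma> :: "('p, 'v) garden"
proof (induction \<sigma> \<phi> and \<sigma> \<gamma> rule: subst_flower_subst_garden.induct)
  case (2 \<sigma> \<gamma> \<Delta>)
  have "image_mset (binders_garden \<circ> subst_garden (without \<sigma> (fset (sprinkler \<gamma>)))) \<Delta>
      = image_mset binders_garden \<Delta>"
    using 2(2) by (intro image_mset_cong) simp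
  with 2(1) show ?case by (simp add: multiset.map_comp)
next
  case (3 \<sigma> x \<Phi>)
  have "image_mset (binders_flower \<circ> subst_flower (without \<sigma> (fset x))) \<Phi> = image_mset binders_flower \<Phi>"
    using 3 by (intro image_mset_cong) simp
  then show ?case by (simp add: multiset.map_comp binders_def)
qed simp

lemma wf_subst_flower [simp]: "wf_flower ar (subst_flower \<sigma> \<phi>) = wf_flower ar \<phi>"
  and wf_subst_garden [simp]: "wf_garden ar (subst_garden \<sigma> \<gamma>) = wf_garden ar \<gamma>"
  for \<phi> :: "('p, 'v) flower" and \<gamma> :: "('p, 'v) garden"
  by (induction \<sigma> \<phi> and \<sigma> \<gamma> rule: subst_flower_subst_garden.induct) auto

lemma bv_subst [simp]: "bv (subst \<sigma> \<Phi>) = bv \<Phi>"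
  and binders_subst [simp]: "binders (subst \<sigma> \<Phi>) = binders \<Phi>"
  by (induction \<Phi>) auto

text \<open>Only an inclusion: a variable outside \<open>X\<close> that \<open>\<sigma>\<close>
  sends into \<open>X\<close> is captured and disappears on the left. The bounds on free variables
  after substitution are inclusions for the same reason.\<close>

lemma image_without_minus: "without \<sigma> X ` V - X \<subseteq> \<sigma> ` (V - X)"
  by (auto simp: override_on_def split: if_splits)

lemma fv_subst_flower: "fv_flower (subst_flower \<sigma> \<phi>) \<subseteq> \<sigma> ` fv_flower \<phi>"
  and fv_subst_garden: "fv_garden (subst_garden \<sigma> \<gamma>) \<subseteq> \<sigma> ` fv_garden \<gamma>"
  for \<phi> :: "('p, 'v) flower" and \<gamma> :: "('p, 'v) garden"
proof (induction \<sigma> \<phi> and \<sigma> \<gamma> rule: subst_flower_subst_garden.induct)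
  case (2 \<sigma> \<gamma> \<Delta>)
  let ?X = "fset (sprinkler \<gamma>)"
  have "fv_garden (subst_garden (without \<sigma> ?X) \<delta>) - ?X \<subseteq> \<sigma> ` (fv_garden \<delta> - ?X)"
    if "\<delta> \<in># \<Delta>" for \<delta>
    using Diff_mono[OF 2(2)[OF that] subset_refl] image_without_minus by (rule subset_trans)
  then have "(\<Union>\<delta>\<in>set_mset \<Delta>. fv_garden (subst_garden (without \<sigma> ?X) \<delta>) - ?X)
      \<subseteq> (\<Union>\<delta>\<in>set_mset \<Delta>. \<sigma> ` (fv_garden \<delta> - ?X))"
    by (rule UN_mono[OF subset_refl])
  with 2(1) have "fv_garden (subst_garden \<sigma> \<gamma>) \<union>
        (\<Union>\<delta>\<in>set_mset \<Delta>. fv_garden (subst_garden (without \<sigma> ?X) \<delta>) - ?X)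
      \<subseteq> \<sigma> ` fv_garden \<gamma> \<union> (\<Union>\<delta>\<in>set_mset \<Delta>. \<sigma> ` (fv_garden \<delta> - ?X))"
    by (rule Un_mono)
  then show ?case
    by (simp only: subst_flower.simps fv_flower.simps sprinkler_subst image_Un image_UN
        set_image_mset image_image)
next
  case (3 \<sigma> x \<Phi>)
  have "(\<Union>\<phi>\<in>set_mset \<Phi>. fv_flower (subst_flower (without \<sigma> (fset x)) \<phi>))
      \<subseteq> (\<Union>\<phi>\<in>set_mset \<Phi>. without \<sigma> (fset x) ` fv_flower \<phi>)"
    using 3 by (rule UN_mono[OF subset_refl])
  then have "fv (subst (without \<sigma> (fset x)) \<Phi>) \<subseteq> without \<sigma> (fset x) ` fv \<Phi>"
    by (simp only: fv_def image_UN set_image_mset image_image)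
  then have "fv (subst (without \<sigma> (fset x)) \<Phi>) - fset x \<subseteq> without \<sigma> (fset x) ` fv \<Phi> - fset x"
    by (rule Diff_mono) simp
  also have "\<dots> \<subseteq> \<sigma> ` (fv \<Phi> - fset x)"
    by (rule image_without_minus)
  finally show ?case by simp
qed simp

lemma fv_subst: "fv (subst \<sigma> \<Phi>) \<subseteq> \<sigma> ` fv \<Phi>"
proof -
  have "(\<Union>\<phi>\<in>set_mset \<Phi>. fv_flower (subst_flower \<sigma> \<phi>)) \<subseteq> (\<Union>\<phi>\<in>set_mset \<Phi>. \<sigma> ` fv_flower \<phi>)"
    using fv_subst_flower by (rule UN_mono[OF subset_refl])
  then show ?thesis
    by (simp only: fv_def image_UN set_image_mset image_image)
qed

lemma fv_petal: "\<delta> \<in># \<Delta> \<Longrightarrow> v \<in> fv_garden \<delta> \<Longrightarrow> v \<notin> fset (sprinkler \<gamma>) \<Longrightarrow> v \<in> fv_flower (\<gamma> \<rhd> \<Delta>)"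
  by auto

lemma subst_flower_cong: "(\<And>v. v \<in> fv_flower \<phi> \<Longrightarrow> \<sigma> v = \<tau> v) \<Longrightarrow> subst_flower \<sigma> \<phi> = subst_flower \<tau> \<phi>"
  and subst_garden_cong: "(\<And>v. v \<in> fv_garden \<gamma> \<Longrightarrow> \<sigma> v = \<tau> v) \<Longrightarrow> subst_garden \<sigma> \<gamma> = subst_garden \<tau> \<gamma>"
  for \<phi> :: "('p, 'v) flower" and \<gamma> :: "('p, 'v) garden"
proof (induction \<sigma> \<phi> and \<sigma> \<gamma> arbitrary: \<tau> and \<tau> rule: subst_flower_subst_garden.induct)
  case (2 \<sigma> \<gamma> \<Delta>)
  let ?X = "fset (sprinkler \<gamma>)"
  have "image_mset (subst_garden (without \<sigma> ?X)) \<Delta> = image_mset (subst_garden (without \<tau> ?X)) \<Delta>"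
  proof (rule image_mset_cong)
    fix \<delta> assume \<delta>: "\<delta> \<in># \<Delta>"
    show "subst_garden (without \<sigma> ?X) \<delta> = subst_garden (without \<tau> ?X) \<delta>"
    proof (rule 2(2)[OF \<delta>])
      show "without \<sigma> ?X v = without \<tau> ?X v" if "v \<in> fv_garden \<delta>" for v
        using 2(3) fv_petal[OF \<delta> that] by (cases "v \<in> ?X") simp_all
    qed
  qed
  moreover have "subst_garden \<sigma> \<gamma> = subst_garden \<tau> \<gamma>"
    using 2(3) by (intro 2(1)) simp
  ultimately show ?case by (simp only: subst_flower.simps)
next
  case (3 \<sigma> x \<Phi>)
  have "subst (without \<sigma> (fset x)) \<Phi> = subst (without \<tau> (fset x)) \<Phi>"
  proof (rule image_mset_cong)
    fix \<phi> assume \<phi>: "\<phi> \<in># \<Phi>"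
    show "subst_flower (without \<sigma> (fset x)) \<phi> = subst_flower (without \<tau> (fset x)) \<phi>"
    proof (rule 3(1)[OF \<phi>])
      show "without \<sigma> (fset x) v = without \<tau> (fset x) v" if "v \<in> fv_flower \<phi>" for v
        using 3(2)[of v] fv_mono[OF \<phi>] that by (cases "v \<in> fset x") auto
    qed
  qed
  then show ?case by simp
qed simp

lemma subst_flower_ident: "subst_flower id \<phi> = \<phi>"
  and subst_garden_ident: "subst_garden id \<gamma> = \<gamma>"
  for \<phi> :: "('p, 'v) flower" and \<gamma> :: "('p, 'v) garden"
proof (induction \<phi> and \<gamma>)
  case (Flower \<gamma> \<Delta>)
  have "without id (fset (sprinkler \<gamma>)) = id"
    by (simp add: override_on_def fun_eq_iff)
  moreover have "image_mset (subst_garden id) \<Delta> = \<Delta>"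
    using Flower(2) by (rule multiset.map_ident_strong)
  ultimately show ?case using Flower(1) by (simp only: subst_flower.simps)
next
  case (Garden x \<Phi>)
  have "without id (fset x) = id"
    by (simp add: override_on_def fun_eq_iff)
  moreover have "subst id \<Phi> = \<Phi>"
    using Garden by (rule multiset.map_ident_strong)
  ultimately show ?case by (simp only: subst_garden.simps)
qed simp

lemma subst_flower_id: "(\<And>v. v \<in> fv_flower \<phi> \<Longrightarrow> \<sigma> v = v) \<Longrightarrow> subst_flower \<sigma> \<phi> = \<phi>"
  using subst_flower_cong[of \<phi> \<sigma> id] by (simp add: subst_flower_ident)

lemma subst_id: "(\<And>v. v \<in> fv \<Phi> \<Longrightarrow> \<sigma> v = v) \<Longrightarrow> subst \<sigma> \<Phi> = \<Phi>"
  using fv_mono by (intro multiset.map_ident_strong subst_flower_id) blast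

lemma subst_cong: "(\<And>v. v \<in> fv \<Phi> \<Longrightarrow> \<sigma> v = \<tau> v) \<Longrightarrow> subst \<sigma> \<Phi> = subst \<tau> \<Phi>"
  using fv_mono by (intro image_mset_cong subst_flower_cong) blast

text \<open>No capture happens when the binders lie in \<open>B\<close>: each variable is fixed or leaves \<open>B\<close>.\<close>

lemma subst_subst_flower:
    "bv_flower \<phi> \<subseteq> B \<Longrightarrow> (\<And>v. \<tau> v = v \<or> \<tau> v \<notin> B) \<Longrightarrow>
     subst_flower \<sigma> (subst_flower \<tau> \<phi>) = subst_flower (\<sigma> \<circ> \<tau>) \<phi>"
  and subst_subst_garden:
    "bv_garden \<gamma> \<subseteq> B \<Longrightarrow> (\<And>v. \<tau> v = v \<or> \<tau> v \<notin> B) \<Longrightarrow>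
     subst_garden \<sigma> (subst_garden \<tau> \<gamma>) = subst_garden (\<sigma> \<circ> \<tau>) \<gamma>"
  for \<phi> :: "('p, 'v) flower" and \<gamma> :: "('p, 'v) garden"
proof (induction \<tau> \<phi> and \<tau> \<gamma> arbitrary: \<sigma> and \<sigma> rule: subst_flower_subst_garden.induct)
  case (2 \<tau> \<gamma> \<Delta>)
  let ?X = "fset (sprinkler \<gamma>)"
  have X: "?X \<subseteq> B"
    using 2(3) by (cases \<gamma>) simp
  \<comment> \<open>Outside \<open>?X\<close>, the variable \<open>\<tau> v\<close> is either
    \<open>v\<close> itself or not in \<open>B\<close>, so it is not in \<open>?X\<close> either and
    the outer map still acts on it.\<close>
  have eq: "without \<sigma> ?X \<circ> without \<tau> ?X = without (\<sigma> \<circ> \<tau>) ?X"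
  proof
    fix v show "(without \<sigma> ?X \<circ> without \<tau> ?X) v = without (\<sigma> \<circ> \<tau>) ?X v"
      using 2(4)[of v] X by (cases "v \<in> ?X"; cases "\<tau> v \<in> ?X") auto
  qed
  have "image_mset (subst_garden (without \<sigma> ?X)) (image_mset (subst_garden (without \<tau> ?X)) \<Delta>)
      = image_mset (subst_garden (without (\<sigma> \<circ> \<tau>) ?X)) \<Delta>"
    unfolding multiset.map_comp
  proof (rule image_mset_cong)
    fix \<delta> assume \<delta>: "\<delta> \<in># \<Delta>"
    have "subst_garden (without \<sigma> ?X) (subst_garden (without \<tau> ?X) \<delta>)
        = subst_garden (without \<sigma> ?X \<circ> without \<tau> ?X) \<delta>"
    proof (rule 2(2)[OF \<delta>])
      show "bv_garden \<delta> \<subseteq> B" using 2(3) \<delta> by auto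
      show "without \<tau> ?X v = v \<or> without \<tau> ?X v \<notin> B" for v
        using 2(4)[of v] by (cases "v \<in> ?X") simp_all
    qed
    then show "(subst_garden (without \<sigma> ?X) \<circ> subst_garden (without \<tau> ?X)) \<delta>
        = subst_garden (without (\<sigma> \<circ> \<tau>) ?X) \<delta>" by (simp only: eq comp_def[of "subst_garden _"])
  qed
  moreover have "subst_garden \<sigma> (subst_garden \<tau> \<gamma>) = subst_garden (\<sigma> \<circ> \<tau>) \<gamma>"
    using 2(3,4) by (intro 2(1)) simp_all
  ultimately show ?case by (simp only: subst_flower.simps sprinkler_subst)
next
  case (3 \<tau> x \<Phi>)
  let ?X = "fset x"
  have X: "?X \<subseteq> B"
    using 3(2) by simp
  have eq: "without \<sigma> ?X \<circ> without \<tau> ?X = without (\<sigma> \<circ> \<tau>) ?X"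
  proof
    fix v show "(without \<sigma> ?X \<circ> without \<tau> ?X) v = without (\<sigma> \<circ> \<tau>) ?X v"
      using 3(3)[of v] X by (cases "v \<in> ?X"; cases "\<tau> v \<in> ?X") auto
  qed
  have "subst (without \<sigma> ?X) (subst (without \<tau> ?X) \<Phi>) = subst (without (\<sigma> \<circ> \<tau>) ?X) \<Phi>"
    unfolding multiset.map_comp
  proof (rule image_mset_cong)
    fix \<phi> assume \<phi>: "\<phi> \<in># \<Phi>"
    have "subst_flower (without \<sigma> ?X) (subst_flower (without \<tau> ?X) \<phi>)
        = subst_flower (without \<sigma> ?X \<circ> without \<tau> ?X) \<phi>"
    proof (rule 3(1)[OF \<phi>])
      show "bv_flower \<phi> \<subseteq> B" using 3(2) bv_mono[OF \<phi>] by auto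
      show "without \<tau> ?X v = v \<or> without \<tau> ?X v \<notin> B" for v
        using 3(3)[of v] by (cases "v \<in> ?X") simp_all
    qed
    then show "(subst_flower (without \<sigma> ?X) \<circ> subst_flower (without \<tau> ?X)) \<phi>
        = subst_flower (without (\<sigma> \<circ> \<tau>) ?X) \<phi>" by (simp only: eq comp_def[of "subst_flower _"])
  qed
  then show ?case by (simp only: subst_garden.simps)
qed simp

lemma subst_subst:
  assumes "bv \<Phi> \<subseteq> B" "\<And>v. \<tau> v = v \<or> \<tau> v \<notin> B"
  shows "subst \<sigma> (subst \<tau> \<Phi>) = subst (\<sigma> \<circ> \<tau>) \<Phi>"
  unfolding multiset.map_comp
proof (rule image_mset_cong)
  fix \<phi> assume "\<phi> \<in># \<Phi>"
  then have "bv_flower \<phi> \<subseteq> B" using bv_mono assms(1) by blast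
  then show "(subst_flower \<sigma> \<circ> subst_flower \<tau>) \<phi> = subst_flower (\<sigma> \<circ> \<tau>) \<phi>"
    using subst_subst_flower[OF _ assms(2)] by (simp only: comp_def[of "subst_flower _"])
qed

text \<open>A map that fixes the binders leaves every sprinkler alone, and resetting it to the
  identity on a sprinkler changes nothing. This is the bridge between \<alpha>-renaming, which moves
  all variables, and substitution, which moves the free ones.\<close>

lemma map_eq_subst_flower: "(\<And>v. v \<in> bv_flower \<phi> \<Longrightarrow> \<rho> v = v) \<Longrightarrow> map_flower id \<rho> \<phi> = subst_flower \<rho> \<phi>"
  and map_eq_subst_garden: "(\<And>v. v \<in> bv_garden \<gamma> \<Longrightarrow> \<rho> v = v) \<Longrightarrow> map_garden id \<rho> \<gamma> = subst_garden \<rho> \<gamma>"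
  for \<phi> :: "('p, 'v) flower" and \<gamma> :: "('p, 'v) garden"
proof (induction \<phi> and \<gamma>)
  case (Flower \<gamma> \<Delta>)
  have "v \<in> fset (sprinkler \<gamma>) \<Longrightarrow> \<rho> v = v" for v
    using Flower(3) by (cases \<gamma>) simp
  then have "without \<rho> (fset (sprinkler \<gamma>)) = \<rho>"
    by (simp add: override_on_def fun_eq_iff)
  moreover have "image_mset (map_garden id \<rho>) \<Delta> = image_mset (subst_garden \<rho>) \<Delta>"
    using Flower(3) by (intro image_mset_cong Flower(2)) auto
  moreover have "map_garden id \<rho> \<gamma> = subst_garden \<rho> \<gamma>"
    using Flower(3) by (intro Flower(1)) simp
  ultimately show ?case by (simp only: flower.map subst_flower.simps)
next
  case (Garden x \<Phi>)
  have x: "\<rho> v = v" if "v \<in> fset x" for v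
    using Garden(2) that by simp
  then have "without \<rho> (fset x) = \<rho>"
    by (simp add: override_on_def fun_eq_iff)
  moreover have "\<rho> |`| x = x"
    using x by (simp add: fset.map_ident_strong)
  moreover have "map_bouquet \<rho> \<Phi> = subst \<rho> \<Phi>"
    using Garden(2) bv_mono by (intro image_mset_cong Garden(1)) auto
  ultimately show ?case by (simp only: garden.map subst_garden.simps)
qed simp

lemma map_eq_subst: "(\<And>v. v \<in> bv \<Phi> \<Longrightarrow> \<rho> v = v) \<Longrightarrow> map_bouquet \<rho> \<Phi> = subst \<rho> \<Phi>"
  using bv_mono by (intro image_mset_cong map_eq_subst_flower) blast


section \<open>Contexts\<close>

text \<open>The sprinklers whose scope contains the hole. A hole in a petal is also in the scope of
  the pistil's sprinkler, hence its presence in the last equation. Only these can bind variables of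
  the filling, as \<open>fv_fill\<close> shows.\<close>

primrec path_binders :: "('p, 'v) ctx \<Rightarrow> 'v multiset"
  and path_binders_f :: "('p, 'v) fctx \<Rightarrow> 'v multiset" where
  "path_binders (Ctx \<Psi> \<xi>) = path_binders_f \<xi>"
| "path_binders_f Hole = {#}"
| "path_binders_f (InPistil x \<Xi> \<Delta>) = mset_set (fset x) + path_binders \<Xi>"
| "path_binders_f (InPetal \<gamma> x \<Xi> \<Delta>) =
     mset_set (fset (sprinkler \<gamma>)) + mset_set (fset x) + path_binders \<Xi>"

lemma wf_fill: "wf ar (fill \<Xi> \<Phi>) \<longleftrightarrow> wf ar (fill \<Xi> {#}) \<and> wf ar \<Phi>"
  and "wf ar (fill_f \<xi> \<Phi>) \<longleftrightarrow> wf ar (fill_f \<xi> {#}) \<and> wf ar \<Phi>"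
  by (induction \<Xi> and \<xi>) auto

lemma binders_fill: "binders (fill \<Xi> \<Phi>) = binders (fill \<Xi> {#}) + binders \<Phi>"
  and binders_fill_f: "binders (fill_f \<xi> \<Phi>) = binders (fill_f \<xi> {#}) + binders \<Phi>"
  by (induction \<Xi> and \<xi>) (auto simp: ac_simps)

lemma fv_fill: "fv (fill \<Xi> \<Phi>) = fv (fill \<Xi> {#}) \<union> (fv \<Phi> - set_mset (path_binders \<Xi>))"
  and "fv (fill_f \<xi> \<Phi>) = fv (fill_f \<xi> {#}) \<union> (fv \<Phi> - set_mset (path_binders_f \<xi>))"
proof (induction \<Xi> and \<xi>)
  case (InPetal \<gamma> x \<Xi> \<Delta>)
  then show ?case by (cases \<gamma>) auto
qed auto

lemma bv_fill: "bv (fill \<Xi> \<Phi>) = bv (fill \<Xi> {#}) \<union> bv \<Phi>"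
  by (metis binders_fill set_binders set_mset_union)

lemma path_binders_add_ctx [simp]: "path_binders (add_ctx \<Phi> \<Xi>) = path_binders \<Xi>"
  by (cases \<Xi>) simp

lemma path_binders_fill_ctx [simp]:
    "path_binders (fill_ctx \<Xi> \<Theta>) = path_binders \<Xi> + path_binders \<Theta>"
  and "path_binders (fill_ctx_f \<xi> \<Theta>) = path_binders_f \<xi> + path_binders \<Theta>"
  by (induction \<Xi> and \<xi>) (auto simp: ac_simps)

text \<open>\<open>S\<close> collects the binders off the path, so that distinctness of all binders
  of a context passes to its path binders.\<close>

lemma binders_fill_path: "\<exists>S. binders (fill \<Xi> {#}) = path_binders \<Xi> + S"
  and "\<exists>S. binders (fill_f \<xi> {#}) = path_binders_f \<xi> + S"
  for \<Xi> :: "('p, 'v) ctx" and \<xi> :: "('p, 'v) fctx"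
proof (induction \<Xi> and \<xi>)
  case (Ctx \<Psi> \<xi>)
  then obtain S where "binders (fill_f \<xi> {#}) = path_binders_f \<xi> + S" ..
  then show ?case by (intro exI[of _ "binders \<Psi> + S"]) (simp add: ac_simps)
next
  case (InPistil x \<Xi> \<Delta>)
  then obtain S where "binders (fill \<Xi> {#}) = path_binders \<Xi> + S" ..
  then show ?case
    by (intro exI[of _ "S + sum_mset (image_mset binders_garden \<Delta>)"]) (simp add: ac_simps)
next
  case (InPetal \<gamma> x \<Xi> \<Delta>)
  then obtain S where "binders (fill \<Xi> {#}) = path_binders \<Xi> + S" ..
  then show ?case
    by (cases \<gamma>) (intro exI[of _ "binders (body \<gamma>) + S + sum_mset (image_mset binders_garden \<Delta>)"],
        simp add: ac_simps)
qed simp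

lemma add_ctx_add_ctx: "add_ctx \<Phi> (add_ctx \<Psi> \<Xi>) = add_ctx (\<Phi> + \<Psi>) \<Xi>"
  by (cases \<Xi>) (simp add: ac_simps)

lemma add_ctx_empty [simp]: "add_ctx {#} \<Xi> = \<Xi>"
  by (cases \<Xi>) simp

lemma fill_ctx_add_ctx: "fill_ctx (add_ctx \<Phi> \<Xi>) \<Theta> = add_ctx \<Phi> (fill_ctx \<Xi> \<Theta>)"
  by (cases \<Xi>) (simp add: add_ctx_add_ctx)

lemma fill_ctx_assoc: "fill_ctx (fill_ctx \<Xi> \<Theta>) \<Upsilon> = fill_ctx \<Xi> (fill_ctx \<Theta> \<Upsilon>)"
  and "fill_ctx (fill_ctx_f \<xi> \<Theta>) \<Upsilon> = fill_ctx_f \<xi> (fill_ctx \<Theta> \<Upsilon>)"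
  by (induction \<Xi> and \<xi>) (auto simp: fill_ctx_add_ctx)


section \<open>Renaming of bound variables\<close>

lemma alpha_refl [simp]: "\<Phi> \<approx>\<^sub>\<alpha> \<Phi>"
  by (simp add: alpha_eq_def)

lemma alpha_trans [trans]: "\<Phi> \<approx>\<^sub>\<alpha> \<Psi> \<Longrightarrow> \<Psi> \<approx>\<^sub>\<alpha> \<Theta> \<Longrightarrow> \<Phi> \<approx>\<^sub>\<alpha> \<Theta>"
  by (simp add: alpha_eq_def)

lemma alpha_step_fill: "alpha_step \<Phi> \<Psi> \<Longrightarrow> alpha_step (fill \<Xi> \<Phi>) (fill \<Xi> \<Psi>)"
  by (induction rule: alpha_step.induct)
    (metis alpha_step.alpha_bouquet fill_fill_ctx(1), metis alpha_step.alpha_petal fill_fill_ctx(1))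

lemma alpha_fill: "\<Phi> \<approx>\<^sub>\<alpha> \<Psi> \<Longrightarrow> fill \<Xi> \<Phi> \<approx>\<^sub>\<alpha> fill \<Xi> \<Psi>"
  unfolding alpha_eq_def
  by (induction rule: rtranclp_induct) (auto intro: rtranclp.rtrancl_into_rtrancl alpha_step_fill)

lemma alpha_rename:
  assumes "bij \<rho>" "\<And>v. v \<in> fv \<Phi> \<Longrightarrow> \<rho> v = v"
  shows "\<Phi> \<approx>\<^sub>\<alpha> map_bouquet \<rho> \<Phi>"
proof -
  have "alpha_step (fill (Ctx {#} Hole) \<Phi>) (fill (Ctx {#} Hole) (map_bouquet \<rho> \<Phi>))"
    using assms by (rule alpha_bouquet)
  then show ?thesis by (simp add: alpha_eq_def)
qed

lemma alpha_rename_petal: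
  assumes "bij \<rho>" "\<And>v. v \<in> fv_garden \<delta> \<Longrightarrow> \<rho> v = v"
  shows "{#\<gamma> \<rhd> add_mset \<delta> \<Delta>#} \<approx>\<^sub>\<alpha> {#\<gamma> \<rhd> add_mset (map_garden id \<rho> \<delta>) \<Delta>#}"
proof -
  have "alpha_step (fill (Ctx {#} Hole) {#\<gamma> \<rhd> add_mset \<delta> \<Delta>#})
      (fill (Ctx {#} Hole) {#\<gamma> \<rhd> add_mset (map_garden id \<rho> \<delta>) \<Delta>#})"
    using assms by (rule alpha_petal)
  then show ?thesis by (simp add: alpha_eq_def)
qed

lemma alpha_plus:
  assumes "\<Phi> \<approx>\<^sub>\<alpha> \<Phi>'" "\<Psi> \<approx>\<^sub>\<alpha> \<Psi>'"
  shows "\<Phi> + \<Psi> \<approx>\<^sub>\<alpha> \<Phi>' + \<Psi>'"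
  using alpha_fill[OF assms(1), of "Ctx \<Psi> Hole"] alpha_fill[OF assms(2), of "Ctx \<Phi>' Hole"]
  by (auto simp: ac_simps intro: alpha_trans)

lemma alpha_pistil: "\<Phi> \<approx>\<^sub>\<alpha> \<Phi>' \<Longrightarrow> {#(x \<cdot> \<Phi>) \<rhd> \<Delta>#} \<approx>\<^sub>\<alpha> {#(x \<cdot> \<Phi>') \<rhd> \<Delta>#}"
  using alpha_fill[of \<Phi> \<Phi>' "Ctx {#} (InPistil x (Ctx {#} Hole) \<Delta>)"] by simp

lemma alpha_petal_body:
  "\<Phi> \<approx>\<^sub>\<alpha> \<Phi>' \<Longrightarrow> {#\<gamma> \<rhd> add_mset (x \<cdot> \<Phi>) \<Delta>#} \<approx>\<^sub>\<alpha> {#\<gamma> \<rhd> add_mset (x \<cdot> \<Phi>') \<Delta>#}"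
  using alpha_fill[of \<Phi> \<Phi>' "Ctx {#} (InPetal \<gamma> x (Ctx {#} Hole) \<Delta>)"] by simp

lemma map_flower_inv: "bij \<rho> \<Longrightarrow> map_flower id (inv \<rho>) (map_flower id \<rho> \<phi>) = \<phi>"
  and map_garden_inv: "bij \<rho> \<Longrightarrow> map_garden id (inv \<rho>) (map_garden id \<rho> \<gamma>) = \<gamma>"
  by (simp_all add: flower.map_comp garden.map_comp bij_is_inj flower.map_id garden.map_id)

lemma fv_map_fixed:
  assumes "bij \<rho>"
  shows "(\<And>v. v \<in> fv \<Phi> \<Longrightarrow> \<rho> v = v) \<Longrightarrow> fv (map_bouquet \<rho> \<Phi>) = fv \<Phi>"
    and "(\<And>v. v \<in> fv_garden \<delta> \<Longrightarrow> \<rho> v = v) \<Longrightarrow> fv_garden (map_garden id \<rho> \<delta>) = fv_garden \<delta>"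
proof -
  have "\<rho> ` X = X" if "\<And>v. v \<in> X \<Longrightarrow> \<rho> v = v" for X
    using that by force
  then show "(\<And>v. v \<in> fv \<Phi> \<Longrightarrow> \<rho> v = v) \<Longrightarrow> fv (map_bouquet \<rho> \<Phi>) = fv \<Phi>"
    and "(\<And>v. v \<in> fv_garden \<delta> \<Longrightarrow> \<rho> v = v) \<Longrightarrow> fv_garden (map_garden id \<rho> \<delta>) = fv_garden \<delta>"
    using assms by (simp_all only: fv_map_bouquet fv_map_garden bij_is_inj)
qed

text \<open>The inverse bijection undoes the renaming. It is admissible because the result has the
  same free variables as the original, and these are fixed by \<open>\<rho>\<close>.\<close>

lemma alpha_step_sym: "alpha_step \<Phi> \<Psi> \<Longrightarrow> alpha_step \<Psi> \<Phi>"
proof (induction rule: alpha_step.induct)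
  case (alpha_bouquet \<rho> \<Phi> \<Xi>)
  have "alpha_step (fill \<Xi> (map_bouquet \<rho> \<Phi>)) (fill \<Xi> (map_bouquet (inv \<rho>) (map_bouquet \<rho> \<Phi>)))"
  proof (rule alpha_step.alpha_bouquet[OF bij_imp_bij_inv[OF alpha_bouquet(1)]])
    fix v assume "v \<in> fv (map_bouquet \<rho> \<Phi>)"
    then have "\<rho> v = v" using alpha_bouquet by (simp only: fv_map_fixed)
    then show "inv \<rho> v = v" by (rule inv_f_eq[OF bij_is_inj[OF alpha_bouquet(1)]])
  qed
  then show ?case
    by (simp only: multiset.map_comp comp_def map_flower_inv[OF alpha_bouquet(1)] multiset.map_ident)
next
  case (alpha_petal \<rho> \<delta> \<Xi> \<gamma> \<Delta>)
  have "alpha_step (fill \<Xi> {#\<gamma> \<rhd> add_mset (map_garden id \<rho> \<delta>) \<Delta>#})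
     (fill \<Xi> {#\<gamma> \<rhd> add_mset (map_garden id (inv \<rho>) (map_garden id \<rho> \<delta>)) \<Delta>#})"
  proof (rule alpha_step.alpha_petal[OF bij_imp_bij_inv[OF alpha_petal(1)]])
    fix v assume "v \<in> fv_garden (map_garden id \<rho> \<delta>)"
    then have "\<rho> v = v" using alpha_petal by (simp only: fv_map_fixed)
    then show "inv \<rho> v = v" by (rule inv_f_eq[OF bij_is_inj[OF alpha_petal(1)]])
  qed
  then show ?case
    by (simp only: map_garden_inv[OF alpha_petal(1)])
qed

lemma alpha_sym: "\<Phi> \<approx>\<^sub>\<alpha> \<Psi> \<Longrightarrow> \<Psi> \<approx>\<^sub>\<alpha> \<Phi>"
  unfolding alpha_eq_def
  by (induction rule: rtranclp_induct) (auto intro: converse_rtranclp_into_rtranclp alpha_step_sym)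

lemma alpha_fv: "\<Phi> \<approx>\<^sub>\<alpha> \<Psi> \<Longrightarrow> fv \<Phi> = fv \<Psi>"
  unfolding alpha_eq_def
proof (induction rule: rtranclp_induct)
  case (step \<Psi> \<Theta>)
  from step(2) have "fv \<Psi> = fv \<Theta>"
  proof cases
    case (alpha_bouquet \<rho> \<Phi> \<Xi>)
    then have "fv (map_bouquet \<rho> \<Phi>) = fv \<Phi>"
      by (simp only: fv_map_fixed)
    then have "fv (fill \<Xi> \<Phi>) = fv (fill \<Xi> (map_bouquet \<rho> \<Phi>))"
      by (simp only: fv_fill(1)[of \<Xi> \<Phi>] fv_fill(1)[of \<Xi> "map_bouquet \<rho> \<Phi>"])
    then show ?thesis using alpha_bouquet by simp
  next
    case (alpha_petal \<rho> \<delta> \<Xi> \<gamma> \<Delta>)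
    then have "fv_garden (map_garden id \<rho> \<delta>) = fv_garden \<delta>"
      by (simp only: fv_map_fixed)
    then have "fv {#\<gamma> \<rhd> add_mset (map_garden id \<rho> \<delta>) \<Delta>#} = fv {#\<gamma> \<rhd> add_mset \<delta> \<Delta>#}"
      by simp
    then show ?thesis using alpha_petal fv_fill(1)[of \<Xi> "{#\<gamma> \<rhd> add_mset (map_garden id \<rho> \<delta>) \<Delta>#}"]
        fv_fill(1)[of \<Xi> "{#\<gamma> \<rhd> add_mset \<delta> \<Delta>#}"] by simp
  qed
  with step show ?case by simp
qed simp

lemma alpha_wf: "\<Phi> \<approx>\<^sub>\<alpha> \<Psi> \<Longrightarrow> wf ar \<Phi> \<longleftrightarrow> wf ar \<Psi>"
  unfolding alpha_eq_def
proof (induction rule: rtranclp_induct)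
  case (step \<Psi> \<Theta>)
  from step(2) have "wf ar \<Psi> \<longleftrightarrow> wf ar \<Theta>"
  proof cases
    case (alpha_bouquet \<rho> \<Phi> \<Xi>)
    have "wf ar (map_bouquet \<rho> \<Phi>) \<longleftrightarrow> wf ar \<Phi>"
      by simp
    then show ?thesis
      using alpha_bouquet wf_fill(1)[where ar = ar and \<Xi> = \<Xi> and \<Phi> = \<Phi>] wf_fill(1)[where ar = ar and \<Xi> = \<Xi> and \<Phi> = "map_bouquet \<rho> \<Phi>"] by simp
  next
    case (alpha_petal \<rho> \<delta> \<Xi> \<gamma> \<Delta>)
    have "wf ar {#\<gamma> \<rhd> add_mset (map_garden id \<rho> \<delta>) \<Delta>#} \<longleftrightarrow> wf ar {#\<gamma> \<rhd> add_mset \<delta> \<Delta>#}"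
      by simp
    then show ?thesis using alpha_petal wf_fill(1)[where ar = ar and \<Xi> = \<Xi> and \<Phi> = "{#\<gamma> \<rhd> add_mset (map_garden id \<rho> \<delta>) \<Delta>#}"]
        wf_fill(1)[where ar = ar and \<Xi> = \<Xi> and \<Phi> = "{#\<gamma> \<rhd> add_mset \<delta> \<Delta>#}"] by simp
  qed
  with step show ?case by simp
qed simp

section \<open>Renaming bound variables apart\<close>

lemma fresh_swap:
  fixes X A :: "'v set"
  assumes "infinite (UNIV :: 'v set)" "finite X" "finite A"
  obtains \<rho> where "bij \<rho>" "\<And>v. v \<in> X \<Longrightarrow> \<rho> v \<notin> A" "\<And>v. v \<in> A \<Longrightarrow> v \<notin> X \<Longrightarrow> \<rho> v = v"
proof -
  have "infinite (- (A \<union> X))"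
    using assms by (simp add: Compl_eq_Diff_UNIV)
  then obtain C where C: "finite C" "card C = card X" "C \<subseteq> - (A \<union> X)"
    by (meson infinite_arbitrarily_large)
  with assms(2) obtain f where f: "bij_betw f X C"
    by (metis finite_same_card_bij)
  define g where "g = inv_into X f"
  have g: "bij_betw g C X"
    using f by (simp add: g_def bij_betw_inv_into)
  \<comment> \<open>The exchange of \<open>X\<close> with a set \<open>C\<close> of the same size
    outside \<open>A\<close> and \<open>X\<close>. It is its own inverse and hence a bijection of
    all variables, as renaming demands; extending \<open>f\<close> by the identity would collide on
    \<open>C\<close>.\<close>
  define \<rho> where "\<rho> v = (if v \<in> X then f v else if v \<in> C then g v else v)" for v
  have fX: "f v \<in> C" "f v \<notin> X" if "v \<in> X" for v
    using bij_betwE[OF f] C that by auto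
  have gC: "g v \<in> X" "g v \<notin> C" if "v \<in> C" for v
    using bij_betwE[OF g] C that by auto
  have "\<rho> (\<rho> v) = v" for v
    using fX gC f by (auto simp: \<rho>_def g_def bij_betw_inv_into_left bij_betw_inv_into_right)
  then have "bij \<rho>"
    by (metis bijI')
  moreover have "\<rho> v \<notin> A" if "v \<in> X" for v
    using fX(1)[OF that] C(3) that by (auto simp: \<rho>_def)
  moreover have "\<rho> v = v" if "v \<in> A" "v \<notin> X" for v
    using that C(3) by (auto simp: \<rho>_def)
  ultimately show thesis by (rule that)
qed

text \<open>The last clause keeps track of the single flowers, which \<alpha>-equivalence of the
  bouquets as a whole does not exhibit. It preserves availability when a context is
  freshened.\<close>

definition freshenable :: "('p, 'v) bouquet \<Rightarrow> bool" where
  "freshenable \<Phi> \<longleftrightarrow> (\<forall>A. finite A \<longrightarrow> (\<exists>\<Phi>'. \<Phi> \<approx>\<^sub>\<alpha> \<Phi>' \<and> distinct_mset (binders \<Phi>') \<and>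
     bv \<Phi>' \<inter> A = {} \<and> (\<forall>\<phi>\<in>#\<Phi>. \<exists>\<phi>'\<in>#\<Phi>'. {#\<phi>#} \<approx>\<^sub>\<alpha> {#\<phi>'#})))"

text \<open>\<alpha>-equivalence is defined for bouquets only, so that of petals is expressed inside
  an arbitrary flower. The variable remainder \<open>\<Delta>\<^sub>0\<close> lets petals be renamed
  one after the other, finished ones passing into the remainder.\<close>

definition freshenable_petals :: "('p, 'v) garden multiset \<Rightarrow> bool" where
  "freshenable_petals \<Delta> \<longleftrightarrow> (\<forall>A. finite A \<longrightarrow> (\<exists>\<Delta>'.
     (\<forall>\<gamma> \<Delta>\<^sub>0. {#\<gamma> \<rhd> \<Delta> + \<Delta>\<^sub>0#} \<approx>\<^sub>\<alpha> {#\<gamma> \<rhd> \<Delta>' + \<Delta>\<^sub>0#}) \<and>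
     distinct_mset (sum_mset (image_mset binders_garden \<Delta>')) \<and>
     (\<Union>\<delta>\<in>set_mset \<Delta>'. bv_garden \<delta>) \<inter> A = {}))"

lemma freshenableE:
  assumes "freshenable \<Phi>" "finite A"
  obtains \<Phi>' where "\<Phi> \<approx>\<^sub>\<alpha> \<Phi>'" "distinct_mset (binders \<Phi>')" "bv \<Phi>' \<inter> A = {}"
    "\<forall>\<phi>\<in>#\<Phi>. \<exists>\<phi>'\<in>#\<Phi>'. {#\<phi>#} \<approx>\<^sub>\<alpha> {#\<phi>'#}"
  using assms(1)[unfolded freshenable_def, rule_format, OF assms(2)] by (elim exE conjE) (rule that)

lemma freshenable_petalsE:
  assumes "freshenable_petals \<Delta>" "finite A"
  obtains \<Delta>' where "\<forall>\<gamma> \<Delta>\<^sub>0. {#\<gamma> \<rhd> \<Delta> + \<Delta>\<^sub>0#} \<approx>\<^sub>\<alpha> {#\<gamma> \<rhd> \<Delta>' + \<Delta>\<^sub>0#}"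
     "distinct_mset (sum_mset (image_mset binders_garden \<Delta>'))"
     "(\<Union>\<delta>\<in>set_mset \<Delta>'. bv_garden \<delta>) \<inter> A = {}"
  using assms(1)[unfolded freshenable_petals_def, rule_format, OF assms(2)]
  by (elim exE conjE) (rule that)

lemma freshenable_bouquet: "(\<And>\<phi>. \<phi> \<in># \<Phi> \<Longrightarrow> freshenable {#\<phi>#}) \<Longrightarrow> freshenable \<Phi>"
proof (induction \<Phi>)
  case empty
  then show ?case by (auto simp: freshenable_def intro: alpha_refl)
next
  case (add \<phi> \<Phi>)
  show ?case unfolding freshenable_def
  proof (intro allI impI)
    fix A :: "'b set" assume A: "finite A"
    have "freshenable {#\<phi>#}" using add by simp
    from this[unfolded freshenable_def, rule_format, OF A]
    obtain \<Phi>1 where 1: "{#\<phi>#} \<approx>\<^sub>\<alpha> \<Phi>1" "distinct_mset (binders \<Phi>1)"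
      "bv \<Phi>1 \<inter> A = {}" "\<exists>\<phi>'\<in>#\<Phi>1. {#\<phi>#} \<approx>\<^sub>\<alpha> {#\<phi>'#}"
      by auto
    have "freshenable \<Phi>" using add by simp
    \<comment> \<open>The rest must also avoid the binders just chosen for
      \<open>\<phi>\<close>.\<close>
    moreover have "finite (A \<union> bv \<Phi>1)" using A by simp
    ultimately obtain \<Phi>2 where 2: "\<Phi> \<approx>\<^sub>\<alpha> \<Phi>2" "distinct_mset (binders \<Phi>2)"
      "bv \<Phi>2 \<inter> (A \<union> bv \<Phi>1) = {}" "\<forall>\<phi>\<in>#\<Phi>. \<exists>\<phi>'\<in>#\<Phi>2. {#\<phi>#} \<approx>\<^sub>\<alpha> {#\<phi>'#}"
      unfolding freshenable_def by meson
    show "\<exists>\<Phi>'. add_mset \<phi> \<Phi> \<approx>\<^sub>\<alpha> \<Phi>' \<and> distinct_mset (binders \<Phi>') \<and> bv \<Phi>' \<inter> A = {} \<and>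
      (\<forall>\<phi>\<in>#add_mset \<phi> \<Phi>. \<exists>\<phi>'\<in>#\<Phi>'. {#\<phi>#} \<approx>\<^sub>\<alpha> {#\<phi>'#})"
      using 1 2 alpha_plus[OF 1(1) 2(1)] by (intro exI[of _ "\<Phi>1 + \<Phi>2"]) auto
  qed
qed

text \<open>The body is freshened away from the sprinkler \<open>y\<close>, and then
  \<open>\<rho>\<close> moves \<open>y\<close> to new names. The petal may be renamed by itself
  because \<open>\<rho>\<close> fixes its free variables, none of which is in
  \<open>y\<close>.\<close>

lemma freshenable_petals_add:
  assumes inf: "infinite (UNIV :: 'v set)"
    and "freshenable \<Psi>" "freshenable_petals \<Delta>"
  shows "freshenable_petals (add_mset (y \<cdot> \<Psi>) \<Delta> :: ('p, 'v) garden multiset)"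
  unfolding freshenable_petals_def
proof (intro allI impI)
  fix A :: "'v set" assume A: "finite A"
  have "finite (A \<union> fset y)" using A by simp
  from freshenableE[OF assms(2) this]
  obtain \<Psi>' where \<Psi>': "\<Psi> \<approx>\<^sub>\<alpha> \<Psi>'" "distinct_mset (binders \<Psi>')" "bv \<Psi>' \<inter> (A \<union> fset y) = {}"
    .
  have finA: "finite (A \<union> bv \<Psi>' \<union> fv \<Psi>')" using A by simp
  obtain \<rho> where \<rho>: "bij \<rho>" "\<And>v. v \<in> fset y \<Longrightarrow> \<rho> v \<notin> A \<union> bv \<Psi>' \<union> fv \<Psi>'"
    "\<And>v. v \<in> A \<union> bv \<Psi>' \<union> fv \<Psi>' \<Longrightarrow> v \<notin> fset y \<Longrightarrow> \<rho> v = v"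
    using fresh_swap[OF inf finite_fset finA, of y] by metis
  define \<delta> where "\<delta> = map_garden id \<rho> (y \<cdot> \<Psi>')"
  have \<delta>bv: "bv_garden \<delta> \<inter> A = {}"
  proof -
    have "\<rho> v \<notin> A" if "v \<in> fset y \<union> bv \<Psi>'" for v
      using \<rho>(2,3)[of v] \<Psi>'(3) that by (cases "v \<in> fset y") auto
    then show ?thesis unfolding \<delta>_def bv_map_garden bv_garden_eq by auto
  qed
  have \<delta>d: "distinct_mset (binders_garden \<delta>)"
    using \<rho>(1) \<Psi>' unfolding \<delta>_def
    by (auto simp only: binders_map_garden[OF bij_is_inj] intro!: distinct_mset_image[OF bij_is_inj]) auto
  have "finite (A \<union> bv_garden \<delta>)" using A by simp
  from freshenable_petalsE[OF assms(3) this]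
  obtain \<Delta>' where \<Delta>': "\<forall>\<gamma> \<Delta>\<^sub>0. {#\<gamma> \<rhd> \<Delta> + \<Delta>\<^sub>0#} \<approx>\<^sub>\<alpha> {#\<gamma> \<rhd> \<Delta>' + \<Delta>\<^sub>0#}"
     "distinct_mset (sum_mset (image_mset binders_garden \<Delta>'))"
     "(\<Union>\<delta>\<in>set_mset \<Delta>'. bv_garden \<delta>) \<inter> (A \<union> bv_garden \<delta>) = {}"
    .
  have "{#\<gamma> \<rhd> add_mset (y \<cdot> \<Psi>) \<Delta> + \<Delta>\<^sub>0#} \<approx>\<^sub>\<alpha> {#\<gamma> \<rhd> add_mset \<delta> \<Delta>' + \<Delta>\<^sub>0#}" for \<gamma> \<Delta>\<^sub>0
  proof -
    have "{#\<gamma> \<rhd> add_mset (y \<cdot> \<Psi>) (\<Delta> + \<Delta>\<^sub>0)#} \<approx>\<^sub>\<alpha> {#\<gamma> \<rhd> add_mset (y \<cdot> \<Psi>') (\<Delta> + \<Delta>\<^sub>0)#}"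
      by (rule alpha_petal_body[OF \<Psi>'(1)])
    also have "\<dots> \<approx>\<^sub>\<alpha> {#\<gamma> \<rhd> add_mset \<delta> (\<Delta> + \<Delta>\<^sub>0)#}"
      unfolding \<delta>_def using \<rho> by (intro alpha_rename_petal) auto
    also have "\<dots> \<approx>\<^sub>\<alpha> {#\<gamma> \<rhd> add_mset \<delta> \<Delta>' + \<Delta>\<^sub>0#}"
      using \<Delta>'(1)[rule_format, of \<gamma> "add_mset \<delta> \<Delta>\<^sub>0"] by simp
    finally show ?thesis by simp
  qed
  then show "\<exists>\<Delta>'. (\<forall>\<gamma> \<Delta>\<^sub>0. {#\<gamma> \<rhd> add_mset (y \<cdot> \<Psi>) \<Delta> + \<Delta>\<^sub>0#} \<approx>\<^sub>\<alpha> {#\<gamma> \<rhd> \<Delta>' + \<Delta>\<^sub>0#}) \<and>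
     distinct_mset (sum_mset (image_mset binders_garden \<Delta>')) \<and>
     (\<Union>\<delta>\<in>set_mset \<Delta>'. bv_garden \<delta>) \<inter> A = {}"
    using \<delta>bv \<delta>d \<Delta>'(2,3) by (intro exI[of _ "add_mset \<delta> \<Delta>'"]) auto
qed

lemma freshenable_petals:
  "infinite (UNIV :: 'v set) \<Longrightarrow> (\<And>\<delta>. \<delta> \<in># \<Delta> \<Longrightarrow> freshenable (body \<delta>)) \<Longrightarrow>
   freshenable_petals (\<Delta> :: ('p, 'v) garden multiset)"
proof (induction \<Delta>)
  case empty
  then show ?case by (auto simp: freshenable_petals_def intro!: exI[of _ "{#}"])
next
  case (add \<delta> \<Delta>)
  then have "freshenable (body \<delta>)" "freshenable_petals \<Delta>" by simp_all
  with freshenable_petals_add[OF add(2), of "body \<delta>" \<Delta> "sprinkler \<delta>"] show ?case by simp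
qed

text \<open>The sprinkler \<open>x\<close> also binds in the petals, so it cannot be renamed in the
  pistil alone. Body and petals are freshened with \<open>x\<close> kept, and \<open>\<rho>\<close>
  then renames the whole flower, in which no variable of \<open>x\<close> is free.\<close>

lemma freshenable_flower:
  assumes inf: "infinite (UNIV :: 'v set)"
    and "freshenable \<Phi>" "freshenable_petals \<Delta>"
  shows "freshenable ({#(x \<cdot> \<Phi>) \<rhd> \<Delta>#} :: ('p, 'v) bouquet)"
  unfolding freshenable_def
proof (intro allI impI)
  fix A :: "'v set" assume A: "finite A"
  have "finite (A \<union> fset x)" using A by simp
  from freshenableE[OF assms(2) this]
  obtain \<Phi>' where \<Phi>': "\<Phi> \<approx>\<^sub>\<alpha> \<Phi>'" "distinct_mset (binders \<Phi>')" "bv \<Phi>' \<inter> (A \<union> fset x) = {}"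
    .
  have "finite (A \<union> fset x \<union> bv \<Phi>')" using A by simp
  from freshenable_petalsE[OF assms(3) this]
  obtain \<Delta>' where \<Delta>': "\<forall>\<gamma> \<Delta>\<^sub>0. {#\<gamma> \<rhd> \<Delta> + \<Delta>\<^sub>0#} \<approx>\<^sub>\<alpha> {#\<gamma> \<rhd> \<Delta>' + \<Delta>\<^sub>0#}"
     "distinct_mset (sum_mset (image_mset binders_garden \<Delta>'))"
     "(\<Union>\<delta>\<in>set_mset \<Delta>'. bv_garden \<delta>) \<inter> (A \<union> fset x \<union> bv \<Phi>') = {}"
    .
  define \<phi> where "\<phi> = (x \<cdot> \<Phi>') \<rhd> \<Delta>'"
  have finA: "finite (A \<union> bv_flower \<phi> \<union> fv_flower \<phi>)" using A by simp
  obtain \<rho> where \<rho>: "bij \<rho>" "\<And>v. v \<in> fset x \<Longrightarrow> \<rho> v \<notin> A \<union> bv_flower \<phi> \<union> fv_flower \<phi>"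
    "\<And>v. v \<in> A \<union> bv_flower \<phi> \<union> fv_flower \<phi> \<Longrightarrow> v \<notin> fset x \<Longrightarrow> \<rho> v = v"
    using fresh_swap[OF inf finite_fset finA, of x] by metis
  define \<phi>' where "\<phi>' = map_flower id \<rho> \<phi>"
  have "{#(x \<cdot> \<Phi>) \<rhd> \<Delta>#} \<approx>\<^sub>\<alpha> {#(x \<cdot> \<Phi>') \<rhd> \<Delta>#}"
    by (rule alpha_pistil[OF \<Phi>'(1)])
  also have "\<dots> \<approx>\<^sub>\<alpha> {#\<phi>#}"
    using \<Delta>'(1)[rule_format, of "x \<cdot> \<Phi>'" "{#}"] by (simp add: \<phi>_def)
  also have "\<dots> \<approx>\<^sub>\<alpha> map_bouquet \<rho> {#\<phi>#}"
  proof (rule alpha_rename[OF \<rho>(1)])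
    fix v assume "v \<in> fv {#\<phi>#}"
    moreover from this have "v \<notin> fset x" by (auto simp: \<phi>_def)
    ultimately show "\<rho> v = v" by (intro \<rho>(3)) auto
  qed
  finally have 1: "{#(x \<cdot> \<Phi>) \<rhd> \<Delta>#} \<approx>\<^sub>\<alpha> {#\<phi>'#}"
    by (simp add: \<phi>'_def)
  have 2: "distinct_mset (binders {#\<phi>'#})"
  proof -
    have "set_mset (mset_set (fset x)) \<inter> set_mset (binders \<Phi>') = {}"
      using \<Phi>'(3) by (simp, blast)
    moreover have "set_mset (mset_set (fset x) + binders \<Phi>')
        \<inter> set_mset (sum_mset (image_mset binders_garden \<Delta>')) = {}"
      using \<Delta>'(3) by (simp only: set_mset_union set_sum_binders_garden set_binders
          finite_set_mset_mset_set[OF finite_fset]) blast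
    ultimately have "distinct_mset (binders_flower \<phi>)"
      using \<Phi>'(2) \<Delta>'(2) unfolding \<phi>_def binders_flower.simps binders_garden_eq distinct_mset_add by simp
    with \<rho>(1) show ?thesis
      by (simp add: \<phi>'_def binders_map_flower bij_is_inj distinct_mset_image)
  qed
  have "\<rho> v \<notin> A" if "v \<in> bv_flower \<phi>" for v
  proof (cases "v \<in> fset x")
    case True
    with \<rho>(2) show ?thesis by blast
  next
    case False
    with \<rho>(3)[of v] that have "\<rho> v = v" by blast
    moreover have "bv_flower \<phi> \<inter> A \<subseteq> fset x"
      using \<Phi>'(3) \<Delta>'(3) unfolding \<phi>_def bv_flower.simps bv_garden_eq by blast
    ultimately show ?thesis using that False by auto
  qed
  then have 3: "bv {#\<phi>'#} \<inter> A = {}"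
    by (auto simp: \<phi>'_def bv_map_flower)
  from 1 2 3 show "\<exists>\<Phi>'. {#(x \<cdot> \<Phi>) \<rhd> \<Delta>#} \<approx>\<^sub>\<alpha> \<Phi>' \<and> distinct_mset (binders \<Phi>') \<and> bv \<Phi>' \<inter> A = {} \<and>
      (\<forall>\<phi>\<in>#{#(x \<cdot> \<Phi>) \<rhd> \<Delta>#}. \<exists>\<phi>'\<in>#\<Phi>'. {#\<phi>#} \<approx>\<^sub>\<alpha> {#\<phi>'#})"
    by (intro exI[of _ "{#\<phi>'#}"]) simp
qed

lemma freshenable_single: "infinite (UNIV :: 'v set) \<Longrightarrow> freshenable {#\<phi> :: ('p, 'v) flower#}"
  and freshenable_body: "infinite (UNIV :: 'v set) \<Longrightarrow> freshenable (body (\<gamma> :: ('p, 'v) garden))"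
proof (induction \<phi> and \<gamma>)
  case (Atom p xs)
  show ?case unfolding freshenable_def
    by (intro allI impI exI[of _ "{#Atom p xs#}"]) simp
next
  case (Flower \<gamma> \<Delta>)
  have "freshenable (body \<gamma>)" by (rule Flower(1)[OF Flower(3)])
  moreover have "freshenable_petals \<Delta>"
    by (rule freshenable_petals[OF Flower(3) Flower(2)[OF _ Flower(3)]])
  ultimately show ?case
    using freshenable_flower[OF Flower(3), of "body \<gamma>" \<Delta> "sprinkler \<gamma>"] by simp
next
  case (Garden x \<Phi>)
  then show ?case by (auto intro: freshenable_bouquet)
qed

lemma freshen:
  fixes \<Phi> :: "('p, 'v) bouquet"
  assumes "infinite (UNIV :: 'v set)" "finite A"
  obtains \<Phi>' where "\<Phi> \<approx>\<^sub>\<alpha> \<Phi>'" "distinct_mset (binders \<Phi>')" "bv \<Phi>' \<inter> A = {}"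
    "\<forall>\<phi>\<in>#\<Phi>. \<exists>\<phi>'\<in>#\<Phi>'. {#\<phi>#} \<approx>\<^sub>\<alpha> {#\<phi>'#}"
  by (rule freshenableE[OF freshenable_bouquet[OF freshenable_single[OF assms(1)]] assms(2)])

lemma freshen_petals:
  fixes \<Delta> :: "('p, 'v) garden multiset"
  assumes "infinite (UNIV :: 'v set)" "finite A"
  obtains \<Delta>' where "\<forall>\<gamma> \<Delta>\<^sub>0. {#\<gamma> \<rhd> \<Delta> + \<Delta>\<^sub>0#} \<approx>\<^sub>\<alpha> {#\<gamma> \<rhd> \<Delta>' + \<Delta>\<^sub>0#}"
     "distinct_mset (sum_mset (image_mset binders_garden \<Delta>'))"
     "(\<Union>\<delta>\<in>set_mset \<Delta>'. bv_garden \<delta>) \<inter> A = {}"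
  by (rule freshenable_petalsE[OF freshenable_petals[OF assms(1) freshenable_body[OF assms(1)]] assms(2)])


section \<open>Flowers available at the hole\<close>

text \<open>A structural form of \<open>can_pollinate_flower\<close>, whose existential over
  decompositions of the context does not lend itself to induction;
  \<open>can_pollinate_flower_iff\<close> gives the equivalence.\<close>

primrec available :: "('p, 'v) flower \<Rightarrow> ('p, 'v) ctx \<Rightarrow> bool"
  and available_f :: "('p, 'v) flower \<Rightarrow> ('p, 'v) fctx \<Rightarrow> bool" where
  "available \<phi> (Ctx \<Psi> \<xi>) \<longleftrightarrow> (\<exists>\<psi>\<in>#\<Psi>. {#\<phi>#} \<approx>\<^sub>\<alpha> {#\<psi>#}) \<or> available_f \<phi> \<xi>"
| "available_f \<phi> Hole \<longleftrightarrow> False"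
| "available_f \<phi> (InPistil x \<Xi> \<Delta>) \<longleftrightarrow> available \<phi> \<Xi>"
| "available_f \<phi> (InPetal \<gamma> x \<Xi> \<Delta>) \<longleftrightarrow> (\<exists>\<psi>\<in>#body \<gamma>. {#\<phi>#} \<approx>\<^sub>\<alpha> {#\<psi>#}) \<or> available \<phi> \<Xi>"

lemma available_add_ctx [simp]:
  "available \<phi> (add_ctx \<Psi> \<Xi>) \<longleftrightarrow> (\<exists>\<psi>\<in>#\<Psi>. {#\<phi>#} \<approx>\<^sub>\<alpha> {#\<psi>#}) \<or> available \<phi> \<Xi>"
  by (cases \<Xi>) auto

lemma available_fill_ctx [simp]:
    "available \<phi> (fill_ctx \<Xi> \<Theta>) \<longleftrightarrow> available \<phi> \<Xi> \<or> available \<phi> \<Theta>"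
  and "available \<phi> (fill_ctx_f \<xi> \<Theta>) \<longleftrightarrow> available_f \<phi> \<xi> \<or> available \<phi> \<Theta>"
  by (induction \<Xi> and \<xi>) auto

lemma can_pollinate_fill_ctx:
  assumes "can_pollinate_flower \<phi> \<Theta>"
  shows "can_pollinate_flower \<phi> (fill_ctx \<Xi> \<Theta>)"
  using assms unfolding can_pollinate_flower_def by (metis fill_ctx_assoc(1))

lemma available_imp_can_pollinate:
    "available \<phi> \<Xi> \<Longrightarrow> can_pollinate_flower \<phi> \<Xi>"
  and "available_f \<phi> \<xi> \<Longrightarrow> can_pollinate_flower \<phi> (Ctx {#} \<xi>)"
proof (induction \<Xi> and \<xi>)
  case (Ctx \<Psi> \<xi>)
  show ?case
  proof (cases "available_f \<phi> \<xi>")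
    case True
    then show ?thesis
      using Ctx(1) can_pollinate_fill_ctx[of \<phi> "Ctx {#} \<xi>" "Ctx \<Psi> Hole"] by simp
  next
    case False
    then have "\<exists>\<psi>\<in>#\<Psi>. {#\<phi>#} \<approx>\<^sub>\<alpha> {#\<psi>#}" using Ctx by simp
    moreover have "Ctx \<Psi> \<xi> = fill_ctx (Ctx {#} Hole) (add_ctx \<Psi> (Ctx {#} \<xi>))" by simp
    ultimately show ?thesis unfolding can_pollinate_flower_def by blast
  qed
next
  case (InPistil x \<Xi> \<Delta>)
  then show ?case
    using can_pollinate_fill_ctx[of \<phi> \<Xi> "Ctx {#} (InPistil x (Ctx {#} Hole) \<Delta>)"] by simp
next
  case (InPetal \<gamma> x \<Xi> \<Delta>)
  show ?case
  proof (cases "available \<phi> \<Xi>")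
    case True
    then show ?thesis
      using InPetal can_pollinate_fill_ctx[of \<phi> \<Xi> "Ctx {#} (InPetal \<gamma> x (Ctx {#} Hole) \<Delta>)"] by simp
  next
    case False
    then have "\<exists>\<psi>\<in>#body \<gamma>. {#\<phi>#} \<approx>\<^sub>\<alpha> {#\<psi>#}" using InPetal by simp
    moreover have "Ctx {#} (InPetal \<gamma> x \<Xi> \<Delta>) =
        fill_ctx (Ctx {#} Hole) (Ctx {#} (InPetal (sprinkler \<gamma> \<cdot> body \<gamma>) x \<Xi> \<Delta>))" by simp
    ultimately show ?thesis unfolding can_pollinate_flower_def by blast
  qed
qed simp

lemma can_pollinate_flower_iff: "can_pollinate_flower \<phi> \<Xi> \<longleftrightarrow> available \<phi> \<Xi>"
  by (auto simp: available_imp_can_pollinate) (auto simp: can_pollinate_flower_def)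

text \<open>The parts of a context off the path to the hole can be renamed apart, the path binders being
  kept since they may bind variables of the bouquet that fills the hole.\<close>

definition freshens :: "'v set \<Rightarrow> ('p, 'v) ctx \<Rightarrow> ('p, 'v) ctx \<Rightarrow> bool" where
  "freshens A \<Xi> \<Xi>' \<longleftrightarrow> (\<forall>\<Phi>. fill \<Xi> \<Phi> \<approx>\<^sub>\<alpha> fill \<Xi>' \<Phi>) \<and> (\<forall>\<phi>. available \<phi> \<Xi> \<longrightarrow> available \<phi> \<Xi>') \<and>
     (\<exists>S. binders (fill \<Xi>' {#}) = path_binders \<Xi> + S \<and> distinct_mset S \<and> set_mset S \<inter> A = {})"

definition freshens_f :: "'v set \<Rightarrow> ('p, 'v) fctx \<Rightarrow> ('p, 'v) fctx \<Rightarrow> bool" where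
  "freshens_f A \<xi> \<xi>' \<longleftrightarrow> (\<forall>\<Phi>. fill_f \<xi> \<Phi> \<approx>\<^sub>\<alpha> fill_f \<xi>' \<Phi>) \<and> (\<forall>\<phi>. available_f \<phi> \<xi> \<longrightarrow> available_f \<phi> \<xi>') \<and>
     (\<exists>S. binders (fill_f \<xi>' {#}) = path_binders_f \<xi> + S \<and> distinct_mset S \<and> set_mset S \<inter> A = {})"

lemma available_trans:
  assumes "\<exists>\<psi>\<in>#\<Psi>. {#\<phi>#} \<approx>\<^sub>\<alpha> {#\<psi>#}" "\<forall>\<psi>\<in>#\<Psi>. \<exists>\<psi>'\<in>#\<Psi>'. {#\<psi>#} \<approx>\<^sub>\<alpha> {#\<psi>'#}"
  shows "\<exists>\<psi>\<in>#\<Psi>'. {#\<phi>#} \<approx>\<^sub>\<alpha> {#\<psi>#}"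
proof -
  from assms(1) obtain \<psi> where "\<psi> \<in># \<Psi>" "{#\<phi>#} \<approx>\<^sub>\<alpha> {#\<psi>#}" ..
  moreover from this(1) assms(2) obtain \<psi>' where "\<psi>' \<in># \<Psi>'" "{#\<psi>#} \<approx>\<^sub>\<alpha> {#\<psi>'#}" by blast
  ultimately show ?thesis using alpha_trans by blast
qed

lemma freshen_ctx:
    "infinite (UNIV :: 'v set) \<Longrightarrow> finite A \<Longrightarrow> \<exists>\<Xi>'. freshens A \<Xi> \<Xi>'"
  and "infinite (UNIV :: 'v set) \<Longrightarrow> finite A \<Longrightarrow> \<exists>\<xi>'. freshens_f A \<xi> \<xi>'"
  for \<Xi> :: "('p, 'v) ctx" and \<xi> :: "('p, 'v) fctx"
proof (induction \<Xi> and \<xi> arbitrary: A and A)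
  case (Ctx \<Psi> \<xi>)
  from Ctx.IH[OF Ctx.prems] obtain \<xi>' where "freshens_f A \<xi> \<xi>'" ..
  then obtain S where \<xi>': "\<forall>\<Phi>. fill_f \<xi> \<Phi> \<approx>\<^sub>\<alpha> fill_f \<xi>' \<Phi>" "\<forall>\<phi>. available_f \<phi> \<xi> \<longrightarrow> available_f \<phi> \<xi>'"
    "binders (fill_f \<xi>' {#}) = path_binders_f \<xi> + S" "distinct_mset S" "set_mset S \<inter> A = {}"
    unfolding freshens_f_def by (elim conjE exE)
  have "finite (A \<union> set_mset S)" using Ctx.prems by simp
  from freshen[OF Ctx.prems(1) this] obtain \<Psi>' where \<Psi>': "\<Psi> \<approx>\<^sub>\<alpha> \<Psi>'" "distinct_mset (binders \<Psi>')"
    "bv \<Psi>' \<inter> (A \<union> set_mset S) = {}" "\<forall>\<phi>\<in>#\<Psi>. \<exists>\<phi>'\<in>#\<Psi>'. {#\<phi>#} \<approx>\<^sub>\<alpha> {#\<phi>'#}" .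
  have "freshens A (Ctx \<Psi> \<xi>) (Ctx \<Psi>' \<xi>')"
    unfolding freshens_def
  proof (intro conjI allI impI exI[of _ "S + binders \<Psi>'"])
    show "fill (Ctx \<Psi> \<xi>) \<Phi> \<approx>\<^sub>\<alpha> fill (Ctx \<Psi>' \<xi>') \<Phi>" for \<Phi>
      using \<Psi>'(1) \<xi>'(1) by (simp add: alpha_plus)
    show "available \<phi> (Ctx \<Psi>' \<xi>')" if "available \<phi> (Ctx \<Psi> \<xi>)" for \<phi>
      using that \<xi>'(2) available_trans[OF _ \<Psi>'(4)] by auto
  qed (use \<Psi>' \<xi>' in \<open>auto simp: ac_simps\<close>)
  then show ?case ..
next
  case Hole
  have "freshens_f A Hole Hole" by (simp add: freshens_f_def)
  then show ?case ..
next
  case (InPistil x \<Xi> \<Delta>)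
  from InPistil.IH[OF InPistil.prems] obtain \<Xi>' where "freshens A \<Xi> \<Xi>'" ..
  then obtain S where \<Xi>': "\<forall>\<Phi>. fill \<Xi> \<Phi> \<approx>\<^sub>\<alpha> fill \<Xi>' \<Phi>" "\<forall>\<phi>. available \<phi> \<Xi> \<longrightarrow> available \<phi> \<Xi>'"
    "binders (fill \<Xi>' {#}) = path_binders \<Xi> + S" "distinct_mset S" "set_mset S \<inter> A = {}"
    unfolding freshens_def by (elim conjE exE)
  have "finite (A \<union> set_mset S)" using InPistil.prems by simp
  from freshen_petals[OF InPistil.prems(1) this, of \<Delta>]
  obtain \<Delta>' where \<Delta>': "\<forall>\<gamma> \<Delta>\<^sub>0. {#\<gamma> \<rhd> \<Delta> + \<Delta>\<^sub>0#} \<approx>\<^sub>\<alpha> {#\<gamma> \<rhd> \<Delta>' + \<Delta>\<^sub>0#}"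
     "distinct_mset (sum_mset (image_mset binders_garden \<Delta>'))"
     "(\<Union>\<delta>\<in>set_mset \<Delta>'. bv_garden \<delta>) \<inter> (A \<union> set_mset S) = {}" .
  have "freshens_f A (InPistil x \<Xi> \<Delta>) (InPistil x \<Xi>' \<Delta>')"
    unfolding freshens_f_def
  proof (intro conjI allI impI exI[of _ "S + sum_mset (image_mset binders_garden \<Delta>')"])
    show "fill_f (InPistil x \<Xi> \<Delta>) \<Phi> \<approx>\<^sub>\<alpha> fill_f (InPistil x \<Xi>' \<Delta>') \<Phi>" for \<Phi>
      unfolding fill_f.simps using \<Delta>'(1)[rule_format, of "x \<cdot> fill \<Xi>' \<Phi>" "{#}"]
      by (intro alpha_trans[OF alpha_pistil[OF \<Xi>'(1)[rule_format]]]) simp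
    show "available_f \<phi> (InPistil x \<Xi>' \<Delta>')" if "available_f \<phi> (InPistil x \<Xi> \<Delta>)" for \<phi>
      using that \<Xi>'(2) by simp
    show "distinct_mset (S + sum_mset (image_mset binders_garden \<Delta>'))"
      using \<Xi>'(4) \<Delta>'(2,3) by (simp only: distinct_mset_add set_sum_binders_garden) blast
    show "set_mset (S + sum_mset (image_mset binders_garden \<Delta>')) \<inter> A = {}"
      using \<Xi>'(5) \<Delta>'(3) by (simp only: set_mset_union set_sum_binders_garden) blast
  qed (simp add: \<Xi>'(3) ac_simps)
  then show ?case ..
next
  case (InPetal \<gamma> x \<Xi> \<Delta>)
  obtain z \<Psi> where \<gamma>: "\<gamma> = z \<cdot> \<Psi>" by (cases \<gamma>)
  from InPetal.IH[OF InPetal.prems] obtain \<Xi>' where "freshens A \<Xi> \<Xi>'" ..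
  then obtain S where \<Xi>': "\<forall>\<Phi>. fill \<Xi> \<Phi> \<approx>\<^sub>\<alpha> fill \<Xi>' \<Phi>" "\<forall>\<phi>. available \<phi> \<Xi> \<longrightarrow> available \<phi> \<Xi>'"
    "binders (fill \<Xi>' {#}) = path_binders \<Xi> + S" "distinct_mset S" "set_mset S \<inter> A = {}"
    unfolding freshens_def by (elim conjE exE)
  have "finite (A \<union> set_mset S)" using InPetal.prems by simp
  from freshen[OF InPetal.prems(1) this] obtain \<Psi>' where \<Psi>': "\<Psi> \<approx>\<^sub>\<alpha> \<Psi>'" "distinct_mset (binders \<Psi>')"
    "bv \<Psi>' \<inter> (A \<union> set_mset S) = {}" "\<forall>\<phi>\<in>#\<Psi>. \<exists>\<phi>'\<in>#\<Psi>'. {#\<phi>#} \<approx>\<^sub>\<alpha> {#\<phi>'#}" .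
  have "finite (A \<union> set_mset S \<union> bv \<Psi>')" using InPetal.prems by simp
  from freshen_petals[OF InPetal.prems(1) this, of \<Delta>]
  obtain \<Delta>' where \<Delta>': "\<forall>\<gamma> \<Delta>\<^sub>0. {#\<gamma> \<rhd> \<Delta> + \<Delta>\<^sub>0#} \<approx>\<^sub>\<alpha> {#\<gamma> \<rhd> \<Delta>' + \<Delta>\<^sub>0#}"
     "distinct_mset (sum_mset (image_mset binders_garden \<Delta>'))"
     "(\<Union>\<delta>\<in>set_mset \<Delta>'. bv_garden \<delta>) \<inter> (A \<union> set_mset S \<union> bv \<Psi>') = {}" .
  have "freshens_f A (InPetal \<gamma> x \<Xi> \<Delta>) (InPetal (z \<cdot> \<Psi>') x \<Xi>' \<Delta>')"
    unfolding freshens_f_def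
  proof (intro conjI allI impI exI[of _ "S + binders \<Psi>' + sum_mset (image_mset binders_garden \<Delta>')"])
    show "fill_f (InPetal \<gamma> x \<Xi> \<Delta>) \<Phi> \<approx>\<^sub>\<alpha> fill_f (InPetal (z \<cdot> \<Psi>') x \<Xi>' \<Delta>') \<Phi>" for \<Phi>
      unfolding \<gamma> fill_f.simps
      using \<Delta>'(1)[rule_format, of "z \<cdot> \<Psi>'" "{#x \<cdot> fill \<Xi>' \<Phi>#}"]
      by (intro alpha_trans[OF alpha_pistil[OF \<Psi>'(1)]]
            alpha_trans[OF alpha_petal_body[OF \<Xi>'(1)[rule_format]]]) simp
    show "available_f \<phi> (InPetal (z \<cdot> \<Psi>') x \<Xi>' \<Delta>')" if "available_f \<phi> (InPetal \<gamma> x \<Xi> \<Delta>)" for \<phi>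
      using that \<Xi>'(2) available_trans[OF _ \<Psi>'(4)] by (auto simp: \<gamma>)
    show "distinct_mset (S + binders \<Psi>' + sum_mset (image_mset binders_garden \<Delta>'))"
      using \<Xi>'(4) \<Psi>'(2,3) \<Delta>'(2,3)
      by (simp only: distinct_mset_add set_sum_binders_garden set_mset_union set_binders) blast
    show "set_mset (S + binders \<Psi>' + sum_mset (image_mset binders_garden \<Delta>')) \<inter> A = {}"
      using \<Xi>'(5) \<Psi>'(3) \<Delta>'(3)
      by (simp only: set_mset_union set_sum_binders_garden set_binders) blast
  qed (simp add: \<gamma> \<Xi>'(3) ac_simps)
  then show ?case ..
qed

lemma size_fill: "size \<Phi> = size \<Psi> \<Longrightarrow> size (fill \<Xi> \<Phi>) = size (fill \<Xi> \<Psi>)"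
  and "size \<Phi> = size \<Psi> \<Longrightarrow> size (fill_f \<xi> \<Phi>) = size (fill_f \<xi> \<Psi>)"
  for \<Xi> :: "('p, 'v) ctx" and \<xi> :: "('p, 'v) fctx"
  by (induction \<Xi> and \<xi>) auto

text \<open>Serves to see that a variant of a single flower is again a single flower.\<close>

lemma alpha_size: "\<Phi> \<approx>\<^sub>\<alpha> \<Psi> \<Longrightarrow> size \<Phi> = size \<Psi>"
  unfolding alpha_eq_def
proof (induction rule: rtranclp_induct)
  case (step \<Psi> \<Theta>)
  from step(2) have "size \<Psi> = size \<Theta>"
    by cases (auto intro: size_fill)
  with step show ?case by simp
qed simp

lemma available_alpha:
    "{#\<phi>'#} \<approx>\<^sub>\<alpha> {#\<phi>#} \<Longrightarrow> available \<phi> \<Xi> \<Longrightarrow> available \<phi>' \<Xi>"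
  and "{#\<phi>'#} \<approx>\<^sub>\<alpha> {#\<phi>#} \<Longrightarrow> available_f \<phi> \<xi> \<Longrightarrow> available_f \<phi>' \<xi>"
  for \<Xi> :: "('p, 'v) ctx" and \<xi> :: "('p, 'v) fctx"
  by (induction \<Xi> and \<xi>) (auto intro: alpha_trans)

lemma is_bouquet_iff:
  "is_bouquet ar \<Phi> \<longleftrightarrow> wf ar \<Phi> \<and> distinct_mset (binders \<Phi>) \<and> bv \<Phi> \<inter> fv \<Phi> = {}"
  by (simp add: is_bouquet_def distinct_binders_iff)

lemma is_bouquet_empty [simp]: "is_bouquet ar {#}"
  by (simp add: is_bouquet_iff)

lemma fill_ctx_Hole: "fill (fill_ctx \<Xi> (Ctx \<Psi> Hole)) \<Phi> = fill \<Xi> (\<Psi> + \<Phi>)"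
  by (simp add: fill_fill_ctx)


section \<open>Reductions inside a context\<close>

text \<open>Bare renamings count as steps, so that reductions compose without a choice of
  representatives.\<close>

definition reduces :: "('p \<Rightarrow> nat) \<Rightarrow> ('p, 'v) bouquet \<Rightarrow> ('p, 'v) bouquet \<Rightarrow> bool" where
  "reduces ar = (\<lambda>\<Phi> \<Psi>. \<Phi> \<approx>\<^sub>\<alpha> \<Psi> \<or> natural_step ar \<Phi> \<Psi>)\<^sup>*\<^sup>*"

lemma reduces_refl [simp]: "reduces ar \<Phi> \<Phi>"
  by (simp add: reduces_def)

lemma reduces_trans [trans]: "reduces ar \<Phi> \<Psi> \<Longrightarrow> reduces ar \<Psi> \<Theta> \<Longrightarrow> reduces ar \<Phi> \<Theta>"
  by (simp add: reduces_def)

lemma reduces_alpha: "\<Phi> \<approx>\<^sub>\<alpha> \<Psi> \<Longrightarrow> reduces ar \<Phi> \<Psi>"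
  by (simp add: reduces_def r_into_rtranclp)

lemma reduces_step: "natural_step ar \<Phi> \<Psi> \<Longrightarrow> reduces ar \<Phi> \<Psi>"
  by (simp add: reduces_def r_into_rtranclp)

lemma alpha_step_trans: "\<Phi> \<approx>\<^sub>\<alpha> \<Psi> \<Longrightarrow> natural_step ar \<Psi> \<Theta> \<Longrightarrow> natural_step ar \<Phi> \<Theta>"
  unfolding natural_step_def using alpha_trans by blast

lemma step_alpha_trans: "natural_step ar \<Phi> \<Psi> \<Longrightarrow> \<Psi> \<approx>\<^sub>\<alpha> \<Theta> \<Longrightarrow> natural_step ar \<Phi> \<Theta>"
  unfolding natural_step_def using alpha_trans by blast

text \<open>A renaming is absorbed by an adjacent step, since \<open>natural_step\<close> is closed
  under \<alpha>-equivalence on both sides. Only a reduction without any natural step remains a bare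
  renaming.\<close>

lemma reduces_cases: "reduces ar \<Phi> \<Psi> \<Longrightarrow> \<Phi> \<approx>\<^sub>\<alpha> \<Psi> \<or> (natural_step ar)\<^sup>+\<^sup>+ \<Phi> \<Psi>"
  unfolding reduces_def
proof (induction rule: rtranclp_induct)
  case (step \<Psi> \<Theta>)
  show ?case
  proof (cases "natural_step ar \<Psi> \<Theta>")
    case True
    with step(3) show ?thesis
      by (meson alpha_step_trans tranclp.intros)
  next
    case False
    with step(2) have "\<Psi> \<approx>\<^sub>\<alpha> \<Theta>" by simp
    with step(3) show ?thesis
      by (metis alpha_trans step_alpha_trans tranclp.cases tranclp.intros)
  qed
qed simp

section \<open>Applying rules in contexts that are freshened on demand\<close>

locale sequent =
  fixes ar :: "'p \<Rightarrow> nat" and B :: "'v set"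
  assumes infinite_vars: "infinite (UNIV :: 'v set)"
    and finite_B: "finite B"
begin

text \<open>\<open>B\<close> holds the binders of the flowers under consideration; the other variables serve as
  parameters, so that substituting parameters never causes a capture.\<close>

definition good :: "('p, 'v) ctx \<Rightarrow> bool" where
  "good \<Xi> \<longleftrightarrow> distinct_mset (path_binders \<Xi>) \<and>
     set_mset (path_binders \<Xi>) \<inter> (fv (fill \<Xi> {#}) \<union> B) = {} \<and>
     fv (fill \<Xi> {#}) \<inter> B = {} \<and> wf ar (fill \<Xi> {#})"

text \<open>Like \<open>good\<close>, this says nothing about binders of \<open>\<Xi>\<close> off
  the path, which \<open>fresh_ctx\<close> renames. A filling has to avoid exactly what cannot be
  renamed: path binders and free variables of the context.\<close>

definition fits :: "('p, 'v) ctx \<Rightarrow> ('p, 'v) bouquet \<Rightarrow> bool" where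
  "fits \<Xi> \<Phi> \<longleftrightarrow> is_bouquet ar \<Phi> \<and> bv \<Phi> \<inter> (set_mset (path_binders \<Xi>) \<union> fv (fill \<Xi> {#})) = {}"

lemma fits_empty [simp]: "fits \<Xi> {#}"
  by (simp add: fits_def)

lemma good_fill_ctx:
  assumes "good \<Xi>" "distinct_mset (path_binders \<Theta>)"
    and disj: "set_mset (path_binders \<Theta>) \<inter>
      (set_mset (path_binders \<Xi>) \<union> B \<union> fv (fill \<Xi> {#}) \<union> fv (fill \<Theta> {#})) = {}"
    and "fv (fill \<Theta> {#}) \<inter> B = {}" "wf ar (fill \<Theta> {#})"
  shows "good (fill_ctx \<Xi> \<Theta>)"
  unfolding good_def
proof (intro conjI)
  have fv: "fv (fill (fill_ctx \<Xi> \<Theta>) {#}) = fv (fill \<Xi> {#}) \<union> (fv (fill \<Theta> {#}) - set_mset (path_binders \<Xi>))"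
    unfolding fill_fill_ctx by (rule fv_fill(1))
  show "distinct_mset (path_binders (fill_ctx \<Xi> \<Theta>))"
    using assms(1,2) disj unfolding good_def path_binders_fill_ctx distinct_mset_add by blast
  show "set_mset (path_binders (fill_ctx \<Xi> \<Theta>)) \<inter> (fv (fill (fill_ctx \<Xi> \<Theta>) {#}) \<union> B) = {}"
    using assms(1) disj unfolding fv good_def path_binders_fill_ctx set_mset_union by blast
  show "fv (fill (fill_ctx \<Xi> \<Theta>) {#}) \<inter> B = {}"
    using assms unfolding fv good_def by blast
  show "wf ar (fill (fill_ctx \<Xi> \<Theta>) {#})"
    using assms(1,5) wf_fill(1)[where ar = ar and \<Xi> = \<Xi> and \<Phi> = "fill \<Theta> {#}"]
    unfolding fill_fill_ctx good_def by blast
qed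

text \<open>The binders of the result are those of the path, the fresh ones \<open>S\<close> and
  those of \<open>\<Phi>\<close>. The first are controlled by \<open>good\<close>, the last by
  \<open>fits\<close>, and \<open>S\<close> avoids both together with all free variables.\<close>

lemma is_bouquet_fill:
  assumes "good \<Xi>" "fits \<Xi> \<Phi>"
    and fr: "freshens (set_mset (path_binders \<Xi>) \<union> fv (fill \<Xi> {#}) \<union> fv \<Phi> \<union> bv \<Phi>) \<Xi> \<Xi>'"
  shows "is_bouquet ar (fill \<Xi>' \<Phi>)"
proof -
  from fr obtain S where S: "binders (fill \<Xi>' {#}) = path_binders \<Xi> + S" "distinct_mset S"
    "set_mset S \<inter> (set_mset (path_binders \<Xi>) \<union> fv (fill \<Xi> {#}) \<union> fv \<Phi> \<union> bv \<Phi>) = {}"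
    unfolding freshens_def by (elim conjE exE)
  from fr have alpha: "fill \<Xi> \<Phi> \<approx>\<^sub>\<alpha> fill \<Xi>' \<Phi>"
    unfolding freshens_def by (elim conjE allE)
  have binders: "binders (fill \<Xi>' \<Phi>) = path_binders \<Xi> + S + binders \<Phi>"
    using binders_fill[of \<Xi>' \<Phi>] S(1) by simp
  then have bv: "bv (fill \<Xi>' \<Phi>) = set_mset (path_binders \<Xi>) \<union> set_mset S \<union> bv \<Phi>"
    by (metis set_binders set_mset_union)
  have fv: "fv (fill \<Xi>' \<Phi>) = fv (fill \<Xi> {#}) \<union> (fv \<Phi> - set_mset (path_binders \<Xi>))"
    using alpha_fv[OF alpha] fv_fill(1)[of \<Xi> \<Phi>] by simp
  have "wf ar (fill \<Xi>' \<Phi>)"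
    using alpha_wf[OF alpha, of ar] wf_fill(1)[where ar = ar and \<Xi> = \<Xi> and \<Phi> = \<Phi>] assms(1,2)
    unfolding good_def fits_def is_bouquet_iff by blast
  moreover have "distinct_mset (binders (fill \<Xi>' \<Phi>))"
    using assms(1,2) S(2,3)
    unfolding binders good_def fits_def is_bouquet_iff distinct_mset_add set_mset_union set_binders
    by blast
  moreover have "bv (fill \<Xi>' \<Phi>) \<inter> fv (fill \<Xi>' \<Phi>) = {}"
    using assms(1,2) S(3) unfolding fv bv good_def fits_def is_bouquet_iff by blast
  ultimately show ?thesis by (simp add: is_bouquet_iff)
qed

lemma fresh_ctx:
  assumes "good \<Xi>" "fits \<Xi> \<Phi>"
  obtains \<Xi>' where "is_bouquet ar (fill \<Xi>' \<Phi>)" "\<forall>\<Psi>. fill \<Xi> \<Psi> \<approx>\<^sub>\<alpha> fill \<Xi>' \<Psi>"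
    "\<forall>\<phi>. available \<phi> \<Xi> \<longrightarrow> available \<phi> \<Xi>'"
proof -
  let ?A = "set_mset (path_binders \<Xi>) \<union> fv (fill \<Xi> {#}) \<union> fv \<Phi> \<union> bv \<Phi>"
  have "finite ?A" by simp
  from freshen_ctx(1)[OF infinite_vars this] obtain \<Xi>' where \<Xi>': "freshens ?A \<Xi> \<Xi>'" ..
  then have "\<forall>\<Psi>. fill \<Xi> \<Psi> \<approx>\<^sub>\<alpha> fill \<Xi>' \<Psi>" "\<forall>\<phi>. available \<phi> \<Xi> \<longrightarrow> available \<phi> \<Xi>'"
    by (simp_all add: freshens_def)
  with is_bouquet_fill[OF assms \<Xi>'] show thesis by (rule that)
qed

text \<open>The off-path binders are renamed to suit the left-hand side, the rule is applied, and
  the right-hand side is carried back by the \<alpha>-equivalence of \<open>\<Xi>\<close> and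
  \<open>\<Xi>'\<close>, which holds for every filling.\<close>

lemma reduces_rule:
  assumes "good \<Xi>" "fits \<Xi> \<Phi>" "natural_rule \<Phi> \<Psi>"
  shows "reduces ar (fill \<Xi> \<Phi>) (fill \<Xi> \<Psi>)"
proof -
  from fresh_ctx[OF assms(1,2)] obtain \<Xi>' where \<Xi>': "is_bouquet ar (fill \<Xi>' \<Phi>)"
    "\<forall>\<Psi>. fill \<Xi> \<Psi> \<approx>\<^sub>\<alpha> fill \<Xi>' \<Psi>" "\<forall>\<phi>. available \<phi> \<Xi> \<longrightarrow> available \<phi> \<Xi>'" .
  then have "natural_step ar (fill \<Xi> \<Phi>) (fill \<Xi> \<Psi>)"
    unfolding natural_step_def using assms(3) alpha_sym by blast
  then show ?thesis by (rule reduces_step)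
qed

text \<open>Erasing needs a left-hand side without repeated binders, so \<open>\<phi>\<close> is
  first replaced by a variant fresh for the context. Inserting starts from the empty hole, so
  \<open>\<phi>\<close> is inserted as it is, even if it shares binders with the flower it
  copies.\<close>

lemma pollinate:
  assumes "good \<Xi>" "available \<phi> \<Xi>" "wf_flower ar \<phi>"
  shows pollinate_down: "reduces ar (fill \<Xi> {#\<phi>#}) (fill \<Xi> {#})"
    and pollinate_up: "reduces ar (fill \<Xi> {#}) (fill \<Xi> {#\<phi>#})"
proof -
  let ?A = "set_mset (path_binders \<Xi>) \<union> fv (fill \<Xi> {#}) \<union> fv_flower \<phi>"
  have "finite ?A" by simp
  from freshen[OF infinite_vars this, of "{#\<phi>#}"] obtain \<Phi> where \<Phi>: "{#\<phi>#} \<approx>\<^sub>\<alpha> \<Phi>"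
    "distinct_mset (binders \<Phi>)" "bv \<Phi> \<inter> ?A = {}" "\<forall>\<phi>\<in>#{#\<phi>#}. \<exists>\<phi>'\<in>#\<Phi>. {#\<phi>#} \<approx>\<^sub>\<alpha> {#\<phi>'#}" .
  from alpha_size[OF \<Phi>(1)] obtain \<phi>' where \<phi>': "\<Phi> = {#\<phi>'#}"
    by (metis size_1_singleton_mset size_single)
  have "fv \<Phi> = fv_flower \<phi>"
    using alpha_fv[OF \<Phi>(1)] by simp
  then have fits: "fits \<Xi> \<Phi>"
    using \<Phi>(2,3) alpha_wf[OF \<Phi>(1), of ar] assms(3) unfolding fits_def is_bouquet_iff by auto
  from fresh_ctx[OF assms(1) fits] obtain \<Xi>' where \<Xi>': "is_bouquet ar (fill \<Xi>' \<Phi>)"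
    "\<forall>\<Psi>. fill \<Xi> \<Psi> \<approx>\<^sub>\<alpha> fill \<Xi>' \<Psi>" "\<forall>\<phi>. available \<phi> \<Xi> \<longrightarrow> available \<phi> \<Xi>'" .
  have "available \<phi>' \<Xi>'"
    using \<Xi>'(3) assms(2) available_alpha(1)[OF alpha_sym[OF \<Phi>(1)[unfolded \<phi>']]] by blast
  then have poll: "can_pollinate \<Phi> \<Xi>'"
    by (simp add: can_pollinate_def can_pollinate_flower_iff \<phi>')
  \<comment> \<open>The pollination rules mention the whole context themselves, so the step takes
    place in the trivial context.\<close>
  have down: "natural_step ar (fill \<Xi>' \<Phi>) (fill \<Xi>' {#})"
    unfolding natural_step_def
    by (intro exI[of _ "Ctx {#} Hole"] exI[of _ "fill \<Xi>' \<Phi>"] exI[of _ "fill \<Xi>' {#}"])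
      (simp add: \<Xi>'(1) poll poll_down)
  have "reduces ar (fill \<Xi> {#\<phi>#}) (fill \<Xi>' \<Phi>)"
    using alpha_trans[OF alpha_fill[OF \<Phi>(1)] \<Xi>'(2)[rule_format]] by (rule reduces_alpha)
  also note reduces_step[OF down]
  also have "reduces ar (fill \<Xi>' {#}) (fill \<Xi> {#})"
    using alpha_sym[OF \<Xi>'(2)[rule_format]] by (rule reduces_alpha)
  finally show "reduces ar (fill \<Xi> {#\<phi>#}) (fill \<Xi> {#})" .
  from fresh_ctx[OF assms(1) fits_empty] obtain \<Xi>'' where \<Xi>'': "is_bouquet ar (fill \<Xi>'' {#})"
    "\<forall>\<Psi>. fill \<Xi> \<Psi> \<approx>\<^sub>\<alpha> fill \<Xi>'' \<Psi>" "\<forall>\<phi>. available \<phi> \<Xi> \<longrightarrow> available \<phi> \<Xi>''" .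
  have "can_pollinate {#\<phi>#} \<Xi>''"
    using \<Xi>''(3) assms(2) by (simp add: can_pollinate_def can_pollinate_flower_iff)
  then have up: "natural_step ar (fill \<Xi>'' {#}) (fill \<Xi>'' {#\<phi>#})"
    unfolding natural_step_def
    by (intro exI[of _ "Ctx {#} Hole"] exI[of _ "fill \<Xi>'' {#}"] exI[of _ "fill \<Xi>'' {#\<phi>#}"])
      (simp add: \<Xi>''(1) poll_up)
  have "reduces ar (fill \<Xi> {#}) (fill \<Xi>'' {#})"
    using \<Xi>''(2)[rule_format] by (rule reduces_alpha)
  also note reduces_step[OF up]
  also have "reduces ar (fill \<Xi>'' {#\<phi>#}) (fill \<Xi> {#\<phi>#})"
    using alpha_sym[OF \<Xi>''(2)[rule_format]] by (rule reduces_alpha)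
  finally show "reduces ar (fill \<Xi> {#}) (fill \<Xi> {#\<phi>#})" .
qed

end

lemma map_bouquet_fixed:
  assumes "\<And>v. v \<in> fv \<Phi> \<union> bv \<Phi> \<Longrightarrow> \<rho> v = v"
  shows "map_bouquet \<rho> \<Phi> = \<Phi>"
  using map_eq_subst[of \<Phi> \<rho>] subst_id[of \<Phi> \<rho>] assms by simp

abbreviation unit_garden :: "('p, 'v) garden" where
  "unit_garden \<equiv> {||} \<cdot> {#}"


section \<open>Provability from available flowers\<close>

context sequent
begin

text \<open>Since \<open>B\<close> is fixed, \<open>\<theta>\<close> passes under sprinklers
  unchanged (\<open>without_param_map\<close>), and since parameters stay outside \<open>B\<close>,
  nothing is captured there.\<close>

definition param_map :: "('v \<Rightarrow> 'v) \<Rightarrow> bool" where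
  "param_map \<theta> \<longleftrightarrow> (\<forall>v\<in>B. \<theta> v = v) \<and> (\<forall>v. v \<notin> B \<longrightarrow> \<theta> v \<notin> B)"

text \<open>Serves both readings of a sprinkler: as an instantiation by arbitrary parameters and,
  under the conditions of \<open>fresh_params\<close>, as a choice of eigenvariables.\<close>

definition opens :: "'v fset \<Rightarrow> ('v \<Rightarrow> 'v) \<Rightarrow> bool" where
  "opens x \<sigma> \<longleftrightarrow> (\<forall>v. if v |\<in>| x then \<sigma> v \<notin> B else \<sigma> v = v)"

definition fragment :: "('p, 'v) bouquet \<Rightarrow> bool" where
  "fragment \<Phi> \<longleftrightarrow> is_bouquet ar \<Phi> \<and> bv \<Phi> \<subseteq> B \<and> fv \<Phi> \<inter> B = {}"

definition fragment_garden :: "('p, 'v) garden \<Rightarrow> bool" where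
  "fragment_garden \<gamma> \<longleftrightarrow> wf_garden ar \<gamma> \<and> distinct_mset (binders_garden \<gamma>) \<and>
     bv_garden \<gamma> \<subseteq> B \<and> fv_garden \<gamma> \<inter> B = {}"

definition provable :: "('p, 'v) flower set \<Rightarrow> ('p, 'v) bouquet \<Rightarrow> bool" where
  "provable H \<Phi> \<longleftrightarrow> (\<forall>\<theta> \<Xi>. param_map \<theta> \<and> good \<Xi> \<and> (\<forall>\<phi>\<in>H. available (subst_flower \<theta> \<phi>) \<Xi>) \<longrightarrow>
     reduces ar (fill \<Xi> (subst \<theta> \<Phi>)) (fill \<Xi> {#}))"

lemma provableD:
  assumes "provable H \<Phi>" "param_map \<theta>" "good \<Xi>" "\<forall>\<phi>\<in>H. available (subst_flower \<theta> \<phi>) \<Xi>"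
  shows "reduces ar (fill \<Xi> (subst \<theta> \<Phi>)) (fill \<Xi> {#})"
  using assms unfolding provable_def by blast

lemma provable_mono: "provable H \<Phi> \<Longrightarrow> H \<subseteq> H' \<Longrightarrow> provable H' \<Phi>"
  unfolding provable_def by blast

lemma param_map_B: "param_map \<theta> \<Longrightarrow> \<theta> v = v \<or> \<theta> v \<notin> B"
  unfolding param_map_def by blast

lemma param_map_id: "param_map id"
  by (simp add: param_map_def)

lemma without_param_map: "param_map \<theta> \<Longrightarrow> X \<subseteq> B \<Longrightarrow> without \<theta> X = \<theta>"
  by (auto simp: param_map_def override_on_def fun_eq_iff)

lemma subst_param_map_garden:
  "param_map \<theta> \<Longrightarrow> fset x \<subseteq> B \<Longrightarrow> subst_garden \<theta> (x \<cdot> \<Phi>) = x \<cdot> subst \<theta> \<Phi>"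
  by (simp add: without_param_map)

lemma subst_param_map_flower:
  "param_map \<theta> \<Longrightarrow> fset x \<subseteq> B \<Longrightarrow>
   subst_flower \<theta> ((x \<cdot> \<Phi>) \<rhd> \<Delta>) = (x \<cdot> subst \<theta> \<Phi>) \<rhd> image_mset (subst_garden \<theta>) \<Delta>"
  by (simp add: without_param_map)

lemma fits_fragment: "good \<Xi> \<Longrightarrow> fragment \<Phi> \<Longrightarrow> fits \<Xi> \<Phi>"
  unfolding good_def fragment_def fits_def by blast

lemma fragment_subst: "param_map \<theta> \<Longrightarrow> fragment \<Phi> \<Longrightarrow> fragment (subst \<theta> \<Phi>)"
proof -
  assume \<theta>: "param_map \<theta>" and \<Phi>: "fragment \<Phi>"
  have "fv (subst \<theta> \<Phi>) \<inter> B = {}"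
    using fv_subst[of \<theta> \<Phi>] \<theta> \<Phi> unfolding param_map_def fragment_def by blast
  with \<Phi> show ?thesis unfolding fragment_def is_bouquet_iff by auto
qed

lemma opens_B: "opens x \<sigma> \<Longrightarrow> \<sigma> v = v \<or> \<sigma> v \<notin> B"
  unfolding opens_def by metis

text \<open>Instances commute with parameter maps: \<open>\<theta>\<close> applied to the
  \<open>\<sigma>\<close>-instance of a flower is the \<open>\<sigma>'\<close>-instance of its
  \<open>\<theta>\<close>-image. The rules ipis and ipet produce the latter, since the
  \<open>\<theta>\<close>-image is what the context contains.\<close>

lemma opens_comm:
  assumes "param_map \<theta>" "fset x \<subseteq> B" "opens x \<sigma>"
  defines "\<sigma>' \<equiv> \<lambda>v. if v |\<in>| x then \<theta> (\<sigma> v) else v"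
  shows "opens x \<sigma>'" "\<sigma>' \<circ> \<theta> = \<theta> \<circ> \<sigma>"
proof -
  show "opens x \<sigma>'"
    using assms unfolding opens_def param_map_def by auto
  show "\<sigma>' \<circ> \<theta> = \<theta> \<circ> \<sigma>"
  proof
    fix v
    have "\<sigma> v = v" "\<theta> v |\<notin>| x" if "v |\<notin>| x"
      using that assms(1-3) unfolding opens_def param_map_def by (metis, metis subsetD)
    moreover have "\<theta> v = v" if "v |\<in>| x"
      using that assms(1,2) unfolding param_map_def by blast
    ultimately show "(\<sigma>' \<circ> \<theta>) v = (\<theta> \<circ> \<sigma>) v"
      unfolding \<sigma>'_def by (cases "v |\<in>| x") simp_all
  qed
qed

text \<open>The rules ask for the exact support. Each variable of \<open>x\<close> lies in
  \<open>B\<close> and is sent outside \<open>B\<close>, hence is really moved.\<close>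

lemma opens_support: "opens x \<sigma> \<Longrightarrow> fset x \<subseteq> B \<Longrightarrow> has_support \<sigma> x"
  unfolding opens_def has_support_def by (auto split: if_splits) (metis subsetD)+

lemma opens_capture_avoiding: "opens x \<sigma> \<Longrightarrow> bv \<Phi> \<subseteq> B \<Longrightarrow> capture_avoiding \<sigma> x \<Phi>"
  unfolding opens_def capture_avoiding_def by (auto split: if_splits)

lemma subst_opens_comm:
  assumes "param_map \<theta>" "opens x \<sigma>" "opens x \<sigma>'" "\<sigma>' \<circ> \<theta> = \<theta> \<circ> \<sigma>" "bv \<Phi> \<subseteq> B"
  shows "subst \<sigma>' (subst \<theta> \<Phi>) = subst \<theta> (subst \<sigma> \<Phi>)"
  using subst_subst[OF assms(5) param_map_B[OF assms(1)], of \<sigma>'] subst_subst[OF assms(5) opens_B[OF assms(2)], of \<theta>]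
  by (simp only: assms(4))

lemma subst_petals_opens_comm:
  assumes "param_map \<theta>" "opens x \<sigma>" "opens x \<sigma>'" "\<sigma>' \<circ> \<theta> = \<theta> \<circ> \<sigma>" "\<forall>\<delta>\<in>#\<Delta>. bv_garden \<delta> \<subseteq> B"
  shows "image_mset (subst_garden \<sigma>') (image_mset (subst_garden \<theta>) \<Delta>)
    = image_mset (subst_garden \<theta>) (image_mset (subst_garden \<sigma>) \<Delta>)"
  unfolding multiset.map_comp
proof (rule image_mset_cong)
  fix \<delta> assume "\<delta> \<in># \<Delta>"
  with assms(5) have "bv_garden \<delta> \<subseteq> B" by blast
  from subst_subst_garden[OF this param_map_B[OF assms(1)], of \<sigma>']
    subst_subst_garden[OF this opens_B[OF assms(2)], of \<theta>]
  show "(subst_garden \<sigma>' \<circ> subst_garden \<theta>) \<delta> = (subst_garden \<theta> \<circ> subst_garden \<sigma>) \<delta>"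
    by (simp only: assms(4) comp_def[of "subst_garden _" "subst_garden _"])
qed

subsection \<open>Structural rules\<close>

lemma provable_assm: "\<phi> \<in> H \<Longrightarrow> wf_flower ar \<phi> \<Longrightarrow> provable H {#\<phi>#}"
  unfolding provable_def by (auto intro!: pollinate_down)

lemma provable_empty: "provable H {#}"
  by (simp add: provable_def)

text \<open>\<open>\<Phi>\<close> is erased while \<open>\<Psi>\<close> stays beside the hole as
  part of the context; the assumptions on \<open>\<Psi>\<close> keep that context
  \<open>good\<close>.\<close>

lemma provable_plus:
  assumes "provable H \<Phi>" "provable H \<Psi>" "wf ar \<Psi>" "fv \<Psi> \<inter> B = {}"
  shows "provable H (\<Phi> + \<Psi>)"
  unfolding provable_def
proof (intro allI impI, elim conjE)
  fix \<theta> \<Xi> assume *: "param_map \<theta>" "good \<Xi>" "\<forall>\<phi>\<in>H. available (subst_flower \<theta> \<phi>) \<Xi>"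
  have "fv (subst \<theta> \<Psi>) \<inter> B = {}"
    using fv_subst[of \<theta> \<Psi>] *(1) assms(4) unfolding param_map_def by blast
  then have "good (fill_ctx \<Xi> (Ctx (subst \<theta> \<Psi>) Hole))"
    using assms(3) by (intro good_fill_ctx[OF *(2)]) auto
  from provableD[OF assms(1) *(1) this] *(3)
  have "reduces ar (fill \<Xi> (subst \<theta> \<Psi> + subst \<theta> \<Phi>)) (fill \<Xi> (subst \<theta> \<Psi>))"
    by (simp add: fill_ctx_Hole)
  also have "reduces ar \<dots> (fill \<Xi> {#})"
    by (rule provableD[OF assms(2) *])
  finally show "reduces ar (fill \<Xi> (subst \<theta> (\<Phi> + \<Psi>))) (fill \<Xi> {#})"
    by (simp add: add.commute)
qed

subsection \<open>Introduction of a petal\<close>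

text \<open>Rule ipet adds a copy of the petal with its whole sprinkler instantiated. The premise
  erases the body of the copy, which leaves an empty petal, and epet removes the flower.\<close>

lemma provable_petal:
  assumes frag: "fragment {#unit_garden \<rhd> add_mset (y \<cdot> \<Psi>) \<Delta>#}"
    and \<sigma>: "opens y \<sigma>" and prov: "provable H (subst \<sigma> \<Psi>)"
  shows "provable H {#unit_garden \<rhd> add_mset (y \<cdot> \<Psi>) \<Delta>#}"
  unfolding provable_def
proof (intro allI impI, elim conjE)
  fix \<theta> \<Xi> assume *: "param_map \<theta>" "good \<Xi>" "\<forall>\<phi>\<in>H. available (subst_flower \<theta> \<phi>) \<Xi>"
  have y: "fset y \<subseteq> B" and bv: "bv \<Psi> \<subseteq> B"
    using frag by (auto simp: fragment_def)
  obtain \<sigma>' where \<sigma>': "opens y \<sigma>'" "\<sigma>' \<circ> \<theta> = \<theta> \<circ> \<sigma>"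
    using opens_comm[OF *(1) y \<sigma>] by blast
  define \<Psi>' \<Delta>' where "\<Psi>' = subst \<theta> \<Psi>" and "\<Delta>' = image_mset (subst_garden \<theta>) \<Delta>"
  let ?rest = "add_mset (y \<cdot> \<Psi>') \<Delta>'"
  have eq: "subst \<theta> {#unit_garden \<rhd> add_mset (y \<cdot> \<Psi>) \<Delta>#} = {#unit_garden \<rhd> ?rest#}"
    using subst_param_map_flower[OF *(1), of "{||}"] subst_param_map_garden[OF *(1) y]
    by (simp add: \<Psi>'_def \<Delta>'_def)
  have frag': "fragment {#unit_garden \<rhd> ?rest#}"
    using fragment_subst[OF *(1) frag] unfolding eq .
  then have frag'': "fragment {#unit_garden \<rhd> add_mset unit_garden ?rest#}"
    by (simp add: fragment_def is_bouquet_iff)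
  have "natural_rule {#unit_garden \<rhd> add_mset (({||} |\<union>| y) \<cdot> \<Psi>') \<Delta>'#}
     {#unit_garden \<rhd> add_mset ({||} \<cdot> subst \<sigma>' \<Psi>') (add_mset (({||} |\<union>| y) \<cdot> \<Psi>') \<Delta>')#}"
    using opens_support[OF \<sigma>'(1) y] opens_capture_avoiding[OF \<sigma>'(1), of \<Psi>'] bv
    by (intro natural_rule.ipet) (simp_all add: \<Psi>'_def)
  moreover have "subst \<sigma>' \<Psi>' = subst \<theta> (subst \<sigma> \<Psi>)"
    unfolding \<Psi>'_def by (rule subst_opens_comm[OF *(1) \<sigma> \<sigma>' bv])
  ultimately have "reduces ar (fill \<Xi> {#unit_garden \<rhd> ?rest#})
      (fill \<Xi> {#unit_garden \<rhd> add_mset ({||} \<cdot> subst \<theta> (subst \<sigma> \<Psi>)) ?rest#})"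
    using reduces_rule[OF *(2) fits_fragment[OF *(2) frag']] by simp
  also have "reduces ar \<dots> (fill \<Xi> {#unit_garden \<rhd> add_mset unit_garden ?rest#})"
  proof -
    let ?\<Theta> = "Ctx {#} (InPetal unit_garden {||} (Ctx {#} Hole) ?rest)"
    have "good (fill_ctx \<Xi> ?\<Theta>)"
      using frag'' by (intro good_fill_ctx[OF *(2)]) (simp_all add: fragment_def is_bouquet_iff)
    from provableD[OF prov *(1) this] *(3) show ?thesis
      by (simp add: fill_fill_ctx)
  qed
  also have "reduces ar \<dots> (fill \<Xi> {#})"
    by (rule reduces_rule[OF *(2) fits_fragment[OF *(2) frag''] natural_rule.epet])
  finally show "reduces ar (fill \<Xi> (subst \<theta> {#unit_garden \<rhd> add_mset (y \<cdot> \<Psi>) \<Delta>#})) (fill \<Xi> {#})"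
    unfolding eq .
qed

subsection \<open>Opening a pistil\<close>

text \<open>A renaming \<open>\<rho>\<close> gives the sprinkler fresh names; the parameters \<open>\<tau>\<close> that stand for it in the
  premise are then mapped to these names.\<close>

definition opener :: "('v \<Rightarrow> 'v) \<Rightarrow> 'v fset \<Rightarrow> ('v \<Rightarrow> 'v) \<Rightarrow> 'v set \<Rightarrow> ('v \<Rightarrow> 'v) \<Rightarrow> ('v \<Rightarrow> 'v) \<Rightarrow> bool" where
  "opener \<theta> y \<tau> A \<rho> \<theta>' \<longleftrightarrow> bij \<rho> \<and> param_map \<theta>' \<and> (\<forall>v\<in>fset y. \<rho> v \<notin> A \<union> B) \<and>
     (\<forall>v\<in>A \<union> B. v |\<notin>| y \<longrightarrow> \<rho> v = v) \<and> (\<forall>v. v \<notin> \<tau> ` fset y \<longrightarrow> \<theta>' v = \<theta> v) \<and>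
     (\<forall>v. v |\<in>| y \<or> v \<notin> \<tau> ` fset y \<and> \<theta> v \<in> A \<union> B \<longrightarrow> \<theta>' (\<tau> v) = \<rho> (\<theta> v))"

lemma openerD:
  assumes "opener \<theta> y \<tau> A \<rho> \<theta>'"
  shows "bij \<rho>" "param_map \<theta>'" "v |\<in>| y \<Longrightarrow> \<rho> v \<notin> A \<union> B" "v \<in> A \<union> B \<Longrightarrow> v |\<notin>| y \<Longrightarrow> \<rho> v = v"
    "v \<notin> \<tau> ` fset y \<Longrightarrow> \<theta>' v = \<theta> v"
    "v |\<in>| y \<or> v \<notin> \<tau> ` fset y \<and> \<theta> v \<in> A \<union> B \<Longrightarrow> \<theta>' (\<tau> v) = \<rho> (\<theta> v)"
  using assms unfolding opener_def by blast+

lemma opener_exists: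
  assumes "param_map \<theta>" "fset y \<subseteq> B" "opens y \<tau>" "inj_on \<tau> (fset y)" "finite A"
  obtains \<rho> \<theta>' where "opener \<theta> y \<tau> A \<rho> \<theta>'"
proof -
  have "finite (A \<union> B)" using assms(5) finite_B by simp
  from fresh_swap[OF infinite_vars finite_fset this, of y]
  obtain \<rho> where \<rho>: "bij \<rho>" "\<And>v. v |\<in>| y \<Longrightarrow> \<rho> v \<notin> A \<union> B" "\<And>v. v \<in> A \<union> B \<Longrightarrow> v |\<notin>| y \<Longrightarrow> \<rho> v = v"
    by metis
  \<comment> \<open>Sends the parameter \<open>\<tau> u\<close> of a sprinkler variable
    \<open>u\<close> to the new name \<open>\<rho> u\<close>; \<open>inv_into\<close> recovers
    \<open>u\<close> because \<open>\<tau>\<close> is injective on the sprinkler.\<close>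
  define \<theta>' where "\<theta>' v = (if v \<in> \<tau> ` fset y then \<rho> (inv_into (fset y) \<tau> v) else \<theta> v)" for v
  have \<tau>: "\<tau> v \<notin> B" if "v |\<in>| y" for v
    using assms(3) that unfolding opens_def by metis
  have 1: "\<theta>' (\<tau> v) = \<rho> v" if "v |\<in>| y" for v
    using that assms(4) by (simp add: \<theta>'_def)
  have 2: "\<theta>' v = \<theta> v" if "v \<notin> \<tau> ` fset y" for v
    using that by (simp add: \<theta>'_def)
  have "param_map \<theta>'"
    unfolding param_map_def
  proof (intro conjI ballI allI impI)
    show "\<theta>' v = v" if "v \<in> B" for v
    proof -
      have "v \<notin> \<tau> ` fset y" using \<tau> that by blast
      then show ?thesis using 2 assms(1) that unfolding param_map_def by simp
    qed
    show "\<theta>' v \<notin> B" if "v \<notin> B" for v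
    proof (cases "v \<in> \<tau> ` fset y")
      case True
      then obtain u where "u |\<in>| y" "v = \<tau> u" by blast
      with 1 \<rho>(2) show ?thesis by simp
    next
      case False
      with 2 assms(1) that show ?thesis unfolding param_map_def by simp
    qed
  qed
  moreover have "\<theta>' (\<tau> v) = \<rho> (\<theta> v)" if "v |\<in>| y \<or> v \<notin> \<tau> ` fset y \<and> \<theta> v \<in> A \<union> B" for v
  proof (cases "v |\<in>| y")
    case True
    then have "\<theta> v = v" using assms(1,2) unfolding param_map_def by blast
    with 1[OF True] show ?thesis by simp
  next
    case False
    with that have *: "v \<notin> \<tau> ` fset y" "\<theta> v \<in> A \<union> B" by blast+
    have "\<theta> v |\<notin>| y"
      using False assms(1,2) unfolding param_map_def by (metis subsetD)
    with \<rho>(3)[OF *(2)] have "\<rho> (\<theta> v) = \<theta> v" by simp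
    moreover have "\<tau> v = v" using False assms(3) unfolding opens_def by metis
    ultimately show ?thesis using 2[OF *(1)] by simp
  qed
  ultimately have "opener \<theta> y \<tau> A \<rho> \<theta>'"
    using \<rho> 2 unfolding opener_def by blast
  then show thesis by (rule that)
qed

text \<open>The renamed flower in the context is the \<open>\<theta>'\<close>-instance of the flower
  that the premise has opened by \<open>\<tau>\<close>. On sprinkler variables both sides give the
  new names, and elsewhere both act as \<open>\<theta>\<close>.\<close>

lemma opener_subst_flower:
  assumes op: "opener \<theta> y \<tau> A \<rho> \<theta>'" and \<theta>: "param_map \<theta>" and \<tau>: "opens y \<tau>"
    and bv: "bv_flower \<phi> \<subseteq> B" "bv_flower \<phi> \<inter> fset y = {}"
    and fv: "fv_flower \<phi> \<inter> \<tau> ` fset y = {}" "\<theta> ` (fv_flower \<phi> - fset y) \<subseteq> A \<union> B"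
  shows "map_flower id \<rho> (subst_flower \<theta> \<phi>) = subst_flower \<theta>' (subst_flower \<tau> \<phi>)"
proof -
  have "map_flower id \<rho> (subst_flower \<theta> \<phi>) = subst_flower \<rho> (subst_flower \<theta> \<phi>)"
    using bv openerD(4)[OF op] by (intro map_eq_subst_flower) auto
  also have "\<dots> = subst_flower (\<rho> \<circ> \<theta>) \<phi>"
    by (rule subst_subst_flower[OF bv(1) param_map_B[OF \<theta>]])
  also have "\<dots> = subst_flower (\<theta>' \<circ> \<tau>) \<phi>"
  proof (rule subst_flower_cong)
    fix v assume v: "v \<in> fv_flower \<phi>"
    have "v |\<in>| y \<or> v \<notin> \<tau> ` fset y \<and> \<theta> v \<in> A \<union> B"
      using fv v by blast
    from openerD(6)[OF op this] show "(\<rho> \<circ> \<theta>) v = (\<theta>' \<circ> \<tau>) v" by simp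
  qed
  also have "\<dots> = subst_flower \<theta>' (subst_flower \<tau> \<phi>)"
    by (rule subst_subst_flower[OF bv(1) opens_B[OF \<tau>], symmetric])
  finally show ?thesis .
qed

lemma opener_subst_garden:
  assumes op: "opener \<theta> y \<tau> A \<rho> \<theta>'" and \<theta>: "param_map \<theta>" and \<tau>: "opens y \<tau>"
    and bv: "bv_garden \<delta> \<subseteq> B" "bv_garden \<delta> \<inter> fset y = {}"
    and fv: "fv_garden \<delta> \<inter> \<tau> ` fset y = {}" "\<theta> ` (fv_garden \<delta> - fset y) \<subseteq> A \<union> B"
  shows "map_garden id \<rho> (subst_garden \<theta> \<delta>) = subst_garden \<theta>' (subst_garden \<tau> \<delta>)"
proof -
  have "map_garden id \<rho> (subst_garden \<theta> \<delta>) = subst_garden \<rho> (subst_garden \<theta> \<delta>)"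
    using bv openerD(4)[OF op] by (intro map_eq_subst_garden) auto
  also have "\<dots> = subst_garden (\<rho> \<circ> \<theta>) \<delta>"
    by (rule subst_subst_garden[OF bv(1) param_map_B[OF \<theta>]])
  also have "\<dots> = subst_garden (\<theta>' \<circ> \<tau>) \<delta>"
  proof (rule subst_garden_cong)
    fix v assume v: "v \<in> fv_garden \<delta>"
    have "v |\<in>| y \<or> v \<notin> \<tau> ` fset y \<and> \<theta> v \<in> A \<union> B"
      using fv v by blast
    from openerD(6)[OF op this] show "(\<rho> \<circ> \<theta>) v = (\<theta>' \<circ> \<tau>) v" by simp
  qed
  also have "\<dots> = subst_garden \<theta>' (subst_garden \<tau> \<delta>)"
    by (rule subst_subst_garden[OF bv(1) opens_B[OF \<tau>], symmetric])
  finally show ?thesis .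
qed

text \<open>The eigenvariable condition with respect to the hypotheses and the garden that is
  opened. Freshness for the conclusion is stated separately in the rules.\<close>

definition fresh_params :: "('p, 'v) flower set \<Rightarrow> ('p, 'v) garden \<Rightarrow> ('v \<Rightarrow> 'v) \<Rightarrow> bool" where
  "fresh_params H \<gamma> \<tau> \<longleftrightarrow> opens (sprinkler \<gamma>) \<tau> \<and> inj_on \<tau> (fset (sprinkler \<gamma>)) \<and>
     \<tau> ` fset (sprinkler \<gamma>) \<inter> ((\<Union>\<phi>\<in>H. fv_flower \<phi>) \<union> fv_garden \<gamma>) = {}"

text \<open>The common end of flower introduction and case analysis: below a pistil whose sprinkler
  \<open>\<rho>\<close> has made new, the goal \<open>\<Phi>\<close> is erased with the pistil's
  flowers available, and epet removes the remaining flower.\<close>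

lemma reduces_pistil:
  assumes \<theta>: "param_map \<theta>" and good: "good \<Xi>"
    and avail: "\<forall>\<phi>\<in>H. available (subst_flower \<theta> \<phi>) \<Xi>"
    and frag: "fragment_garden (y \<cdot> \<Psi>)" and \<tau>: "fresh_params H (y \<cdot> \<Psi>) \<tau>"
    and prov: "provable (H \<union> set_mset (subst \<tau> \<Psi>)) \<Phi>"
    and op: "opener \<theta> y \<tau> A \<rho> \<theta>'"
    and A0: "set_mset (path_binders \<Xi>) \<union> fv (fill \<Xi> {#}) \<union> \<theta> ` fv_garden (y \<cdot> \<Psi>) \<subseteq> A"
  shows "reduces ar (fill \<Xi> {#map_garden id \<rho> (subst_garden \<theta> (y \<cdot> \<Psi>)) \<rhd> {#{||} \<cdot> subst \<theta>' \<Phi>#}#}) (fill \<Xi> {#})"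
proof -
  have y: "fset y \<subseteq> B" and bv: "bv \<Psi> \<subseteq> B" and dist: "bv \<Psi> \<inter> fset y = {}"
    using frag by (auto simp: fragment_garden_def)
  have opens: "opens y \<tau>" and \<tau>fv: "\<tau> ` fset y \<inter> (\<Union>\<phi>\<in>H. fv_flower \<phi>) = {}"
    "\<tau> ` fset y \<inter> (fv \<Psi> - fset y) = {}" "\<tau> ` fset y \<inter> fset y = {}"
    using \<tau> y unfolding fresh_params_def opens_def by auto
  have \<theta>y: "subst_garden \<theta> (y \<cdot> \<Psi>) = y \<cdot> subst \<theta> \<Psi>"
    by (rule subst_param_map_garden[OF \<theta> y])
  have fv\<theta>: "\<theta> ` (fv \<Psi> - fset y) \<inter> B = {}"
    using frag \<theta> unfolding fragment_garden_def param_map_def by auto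
  have A: "set_mset (path_binders \<Xi>) \<union> fv (fill \<Xi> {#}) \<union> fv_garden (subst_garden \<theta> (y \<cdot> \<Psi>)) \<subseteq> A"
    using A0 fv_subst_garden[of \<theta> "y \<cdot> \<Psi>"] by blast
  have bij: "bij \<rho>" by (rule openerD(1)[OF op])
  have inj: "inj \<rho>" by (rule bij_is_inj[OF bij])
  define y' \<Psi>' where "y' = \<rho> |`| y" and "\<Psi>' = map_bouquet \<rho> (subst \<theta> \<Psi>)"
  have map: "map_garden id \<rho> (subst_garden \<theta> (y \<cdot> \<Psi>)) = y' \<cdot> \<Psi>'"
    by (simp only: \<theta>y y'_def \<Psi>'_def garden.map)
  have y': "fset y' \<inter> (A \<union> B) = {}"
    using openerD(3)[OF op] by (auto simp: y'_def)
  have fv_y: "fv_garden (y' \<cdot> \<Psi>') = fv_garden (subst_garden \<theta> (y \<cdot> \<Psi>))"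
  proof -
    have "\<rho> v = v" if "v \<in> fv_garden (subst_garden \<theta> (y \<cdot> \<Psi>))" for v
      using that A \<theta>y by (intro openerD(4)[OF op]) auto
    then show ?thesis unfolding map[symmetric] using fv_map_fixed(2)[OF bij] by blast
  qed
  have fvB: "fv_garden (subst_garden \<theta> (y \<cdot> \<Psi>)) \<inter> B = {}"
    using fv_subst_garden[of \<theta> "y \<cdot> \<Psi>"] fv\<theta> by auto
  have wf: "wf ar \<Psi>'"
    using frag by (simp add: \<Psi>'_def fragment_garden_def)
  have unit: "fits \<Xi> {#(y' \<cdot> \<Psi>') \<rhd> {#unit_garden#}#}"
    unfolding fits_def is_bouquet_iff
  proof (intro conjI)
    show "wf ar {#(y' \<cdot> \<Psi>') \<rhd> {#unit_garden#}#}"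
      using wf by simp
    have "distinct_mset (binders_garden (y' \<cdot> \<Psi>'))"
      unfolding map[symmetric] using frag
      by (simp only: binders_map_garden[OF inj] binders_subst_garden fragment_garden_def distinct_mset_image[OF inj])
    then show "distinct_mset (binders {#(y' \<cdot> \<Psi>') \<rhd> {#unit_garden#}#})"
      by simp
    \<comment> \<open>Binders inside the body keep their names in \<open>B\<close>; only the
      sprinkler leaves \<open>A \<union> B\<close>. Avoiding \<open>A - B\<close> suffices, since
      the path binders and free variables to be avoided lie outside \<open>B\<close>.\<close>
    have bv': "bv_garden (y' \<cdot> \<Psi>') \<inter> (A - B) = {}"
    proof -
      have "\<rho> v \<notin> A - B" if "v \<in> bv_garden (y \<cdot> \<Psi>)" for v
      proof (cases "v |\<in>| y")
        case True
        then show ?thesis using openerD(3)[OF op] by blast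
      next
        case False
        with that bv have "v \<in> B" by auto
        with openerD(4)[OF op _ False] show ?thesis by simp
      qed
      then show ?thesis unfolding map[symmetric] bv_map_garden bv_subst_garden by blast
    qed
    have fv: "fv {#(y' \<cdot> \<Psi>') \<rhd> {#unit_garden#}#} = fv_garden (subst_garden \<theta> (y \<cdot> \<Psi>))"
      using fv_y by simp
    have bve: "bv {#(y' \<cdot> \<Psi>') \<rhd> {#unit_garden#}#} = bv_garden (y' \<cdot> \<Psi>')"
      by simp
    show "bv {#(y' \<cdot> \<Psi>') \<rhd> {#unit_garden#}#} \<inter> fv {#(y' \<cdot> \<Psi>') \<rhd> {#unit_garden#}#} = {}"
      unfolding fv bve using bv' A fvB by blast
    show "bv {#(y' \<cdot> \<Psi>') \<rhd> {#unit_garden#}#} \<inter> (set_mset (path_binders \<Xi>) \<union> fv (fill \<Xi> {#})) = {}"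
      unfolding bve using bv' A good unfolding good_def by blast
  qed
  let ?\<Theta> = "Ctx {#} (InPetal (y' \<cdot> \<Psi>') {||} (Ctx {#} Hole) {#})"
  have good': "good (fill_ctx \<Xi> ?\<Theta>)"
  proof (rule good_fill_ctx[OF good])
    show "distinct_mset (path_binders ?\<Theta>)" by simp
    have fv: "fv (fill ?\<Theta> {#}) = fv_garden (subst_garden \<theta> (y \<cdot> \<Psi>))"
      using fv_y by simp
    show "set_mset (path_binders ?\<Theta>) \<inter>
      (set_mset (path_binders \<Xi>) \<union> B \<union> fv (fill \<Xi> {#}) \<union> fv (fill ?\<Theta> {#})) = {}"
      unfolding fv using y' A by (simp, blast)
    show "fv (fill ?\<Theta> {#}) \<inter> B = {}" unfolding fv by (rule fvB)
    show "wf ar (fill ?\<Theta> {#})" using wf by simp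
  qed
  have avail': "\<forall>\<phi>\<in>H \<union> set_mset (subst \<tau> \<Psi>). available (subst_flower \<theta>' \<phi>) (fill_ctx \<Xi> ?\<Theta>)"
  proof
    fix \<phi> assume "\<phi> \<in> H \<union> set_mset (subst \<tau> \<Psi>)"
    then show "available (subst_flower \<theta>' \<phi>) (fill_ctx \<Xi> ?\<Theta>)"
    proof
      assume \<phi>: "\<phi> \<in> H"
      \<comment> \<open>\<open>\<theta>'\<close> differs from \<open>\<theta>\<close> only on the
        parameters that stand for the sprinkler, and these do not occur in the hypotheses.\<close>
      have "subst_flower \<theta>' \<phi> = subst_flower \<theta> \<phi>"
        using \<tau>fv(1) \<phi> by (intro subst_flower_cong openerD(5)[OF op]) blast
      with avail \<phi> show ?thesis by simp
    next
      assume "\<phi> \<in> set_mset (subst \<tau> \<Psi>)"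
      then obtain \<psi> where \<psi>: "\<psi> \<in># \<Psi>" "\<phi> = subst_flower \<tau> \<psi>" by auto
      have "map_flower id \<rho> (subst_flower \<theta> \<psi>) = subst_flower \<theta>' \<phi>"
        unfolding \<psi>(2)
      proof (rule opener_subst_flower[OF op \<theta> opens])
        show "bv_flower \<psi> \<subseteq> B" "bv_flower \<psi> \<inter> fset y = {}"
          using bv dist bv_mono[OF \<psi>(1)] by blast+
        show "fv_flower \<psi> \<inter> \<tau> ` fset y = {}"
          using \<tau>fv fv_mono[OF \<psi>(1)] by blast
        show "\<theta> ` (fv_flower \<psi> - fset y) \<subseteq> A \<union> B"
          using A0 fv_mono[OF \<psi>(1)] by (simp, blast)
      qed
      then have "subst_flower \<theta>' \<phi> \<in># \<Psi>'"
        using \<psi>(1) by (force simp: \<Psi>'_def)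
      then have "available (subst_flower \<theta>' \<phi>) ?\<Theta>"
        by (auto intro: alpha_refl)
      then show ?thesis by simp
    qed
  qed
  have "reduces ar (fill \<Xi> {#(y' \<cdot> \<Psi>') \<rhd> {#{||} \<cdot> subst \<theta>' \<Phi>#}#}) (fill \<Xi> {#(y' \<cdot> \<Psi>') \<rhd> {#unit_garden#}#})"
    using provableD[OF prov openerD(2)[OF op] good' avail'] by (simp add: fill_fill_ctx)
  also have "reduces ar \<dots> (fill \<Xi> {#})"
    by (rule reduces_rule[OF good unit natural_rule.epet])
  finally show ?thesis unfolding map .
qed

text \<open>The right rule, with \<open>\<tau>\<close> as eigenvariables. The flower is first
  renamed so that its sprinkler is new in the context; \<open>\<theta>'\<close> then reads the
  premise with the eigenvariables replaced by these names, in the petals as well as in the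
  pistil.\<close>

lemma provable_flower:
  assumes frag: "fragment {#(x \<cdot> \<Phi>) \<rhd> \<Delta>#}" and \<tau>: "fresh_params H (x \<cdot> \<Phi>) \<tau>"
    and \<tau>\<phi>: "\<tau> ` fset x \<inter> fv_flower ((x \<cdot> \<Phi>) \<rhd> \<Delta>) = {}"
    and prov: "provable (H \<union> set_mset (subst \<tau> \<Phi>)) {#unit_garden \<rhd> image_mset (subst_garden \<tau>) \<Delta>#}"
  shows "provable H {#(x \<cdot> \<Phi>) \<rhd> \<Delta>#}"
  unfolding provable_def
proof (intro allI impI, elim conjE)
  fix \<theta> \<Xi> assume *: "param_map \<theta>" "good \<Xi>" "\<forall>\<phi>\<in>H. available (subst_flower \<theta> \<phi>) \<Xi>"
  let ?\<phi> = "(x \<cdot> \<Phi>) \<rhd> \<Delta>"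
  define A where "A = set_mset (path_binders \<Xi>) \<union> fv (fill \<Xi> {#}) \<union> \<theta> ` fv_flower ?\<phi>"
  have x: "fset x \<subseteq> B" and opens: "opens x \<tau>" and inj_\<tau>: "inj_on \<tau> (fset x)"
    using frag \<tau> by (auto simp: fragment_def fresh_params_def)
  have fragx: "fragment_garden (x \<cdot> \<Phi>)"
    using frag by (auto simp: fragment_def fragment_garden_def is_bouquet_iff)
  have "finite A" unfolding A_def by (simp del: fv_flower.simps)
  from opener_exists[OF *(1) x opens inj_\<tau> this] obtain \<rho> \<theta>' where op: "opener \<theta> x \<tau> A \<rho> \<theta>'" .
  have bij: "bij \<rho>" by (rule openerD(1)[OF op])
  have inj: "inj \<rho>" by (rule bij_is_inj[OF bij])
  define \<phi>\<theta> where "\<phi>\<theta> = subst_flower \<theta> ?\<phi>"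
  have frag\<theta>: "fragment {#\<phi>\<theta>#}"
    using fragment_subst[OF *(1) frag] by (simp add: \<phi>\<theta>_def)
  have fvA: "fv_flower \<phi>\<theta> \<subseteq> A"
    using fv_subst_flower[of \<theta> ?\<phi>] unfolding A_def \<phi>\<theta>_def by blast
  have fvB: "fv_flower \<phi>\<theta> \<inter> B = {}" and bvB: "bv_flower \<phi>\<theta> \<subseteq> B"
    using frag\<theta> by (simp_all add: fragment_def)
  define x' \<Phi>' \<Delta>' where "x' = \<rho> |`| x" and "\<Phi>' = map_bouquet \<rho> (subst \<theta> \<Phi>)"
    and "\<Delta>' = image_mset (map_garden id \<rho>) (image_mset (subst_garden \<theta>) \<Delta>)"
  have map: "map_flower id \<rho> \<phi>\<theta> = (x' \<cdot> \<Phi>') \<rhd> \<Delta>'"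
    unfolding \<phi>\<theta>_def subst_param_map_flower[OF *(1) x] x'_def \<Phi>'_def \<Delta>'_def flower.map garden.map ..
  have mapx: "map_garden id \<rho> (subst_garden \<theta> (x \<cdot> \<Phi>)) = x' \<cdot> \<Phi>'"
    unfolding subst_param_map_garden[OF *(1) x] x'_def \<Phi>'_def garden.map ..
  have \<rho>fix: "\<rho> v = v" if "v \<in> fv {#\<phi>\<theta>#}" for v
    using that fvA fvB x by (intro openerD(4)[OF op]) auto
  have alpha: "{#\<phi>\<theta>#} \<approx>\<^sub>\<alpha> {#(x' \<cdot> \<Phi>') \<rhd> \<Delta>'#}"
  proof -
    have "{#\<phi>\<theta>#} \<approx>\<^sub>\<alpha> map_bouquet \<rho> {#\<phi>\<theta>#}"
      by (rule alpha_rename[OF bij \<rho>fix])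
    with map show ?thesis by simp
  qed
  have fv': "fv {#(x' \<cdot> \<Phi>') \<rhd> \<Delta>'#} = fv_flower \<phi>\<theta>"
    using alpha_fv[OF alpha] by (simp del: fv_flower.simps)
  have wf': "wf ar {#(x' \<cdot> \<Phi>') \<rhd> \<Delta>'#}"
    using alpha_wf[OF alpha, of ar] frag\<theta> by (simp add: fragment_def is_bouquet_iff)
  have x'A: "fset x' \<inter> (A \<union> B) = {}"
    using openerD(3)[OF op] by (auto simp: x'_def)
  \<comment> \<open>What epis makes of the empty bouquet. For srep it is an empty flower with the
    single petal \<open>unit_garden\<close>, which becomes the pistil of
    \<open>unit_garden \<rhd> \<Delta>'\<close>.\<close>
  let ?u = "unit_garden \<rhd> {#unit_garden#}"
  have fits: "fits \<Xi> {#(x' \<cdot> add_mset ?u \<Phi>') \<rhd> \<Delta>'#}"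
    unfolding fits_def is_bouquet_iff
  proof (intro conjI)
    let ?L = "{#(x' \<cdot> add_mset ?u \<Phi>') \<rhd> \<Delta>'#}"
    show "wf ar ?L" using wf' by simp
    have "binders ?L = binders_flower ((x' \<cdot> \<Phi>') \<rhd> \<Delta>')" by simp
    also have "\<dots> = image_mset \<rho> (binders_flower \<phi>\<theta>)"
      unfolding map[symmetric] by (rule binders_map_flower[OF inj])
    finally show "distinct_mset (binders ?L)"
      using frag\<theta> by (simp add: distinct_mset_image[OF inj] fragment_def is_bouquet_iff)
    have "bv ?L = bv_flower ((x' \<cdot> \<Phi>') \<rhd> \<Delta>')" by simp
    also have "\<dots> = \<rho> ` bv_flower \<phi>\<theta>"
      unfolding map[symmetric] by (rule bv_map_flower)
    finally have bve: "bv ?L = \<rho> ` bv_flower \<phi>\<theta>" .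
    have "\<rho> v \<notin> A - B" if "v \<in> B" for v
    proof (cases "v |\<in>| x")
      case True
      then show ?thesis using openerD(3)[OF op] by blast
    next
      case False
      with that openerD(4)[OF op _ False] show ?thesis by simp
    qed
    then have bv': "bv ?L \<inter> (A - B) = {}"
      unfolding bve using bvB by blast
    have "fv ?L = fv {#(x' \<cdot> \<Phi>') \<rhd> \<Delta>'#}" by simp
    then have fve: "fv ?L = fv_flower \<phi>\<theta>" unfolding fv' .
    show "bv ?L \<inter> fv ?L = {}"
      unfolding fve using bv' fvA fvB by blast
    show "bv ?L \<inter> (set_mset (path_binders \<Xi>) \<union> fv (fill \<Xi> {#})) = {}"
      using bv' *(2) unfolding A_def good_def by blast
  qed
  let ?\<Theta> = "Ctx {#} (InPistil x' (Ctx \<Phi>' Hole) \<Delta>')"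
  have "good (fill_ctx \<Xi> ?\<Theta>)"
  proof (rule good_fill_ctx[OF *(2)])
    have fv: "fv (fill ?\<Theta> {#}) = fv_flower \<phi>\<theta>"
      using fv' by simp
    show "set_mset (path_binders ?\<Theta>) \<inter>
      (set_mset (path_binders \<Xi>) \<union> B \<union> fv (fill \<Xi> {#}) \<union> fv (fill ?\<Theta> {#})) = {}"
      unfolding fv using x'A fvA by (simp add: A_def, blast)
    show "fv (fill ?\<Theta> {#}) \<inter> B = {}" unfolding fv by (rule fvB)
    show "wf ar (fill ?\<Theta> {#})" using wf' by simp
  qed simp
  from reduces_rule[OF this fits_empty natural_rule.epis]
  have epis: "reduces ar (fill \<Xi> {#(x' \<cdot> \<Phi>') \<rhd> \<Delta>'#}) (fill \<Xi> {#(x' \<cdot> add_mset ?u \<Phi>') \<rhd> \<Delta>'#})"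
    by (simp add: fill_fill_ctx)
  have srep: "reduces ar (fill \<Xi> {#(x' \<cdot> add_mset ?u \<Phi>') \<rhd> \<Delta>'#})
      (fill \<Xi> {#(x' \<cdot> \<Phi>') \<rhd> {#{||} \<cdot> {#unit_garden \<rhd> \<Delta>'#}#}#})"
    using reduces_rule[OF *(2) fits natural_rule.srep] by simp
  have \<Delta>': "\<Delta>' = image_mset (subst_garden \<theta>') (image_mset (subst_garden \<tau>) \<Delta>)"
    unfolding \<Delta>'_def multiset.map_comp
  proof (rule image_mset_cong, simp only: comp_def)
    fix \<delta> assume \<delta>: "\<delta> \<in># \<Delta>"
    show "map_garden id \<rho> (subst_garden \<theta> \<delta>) = subst_garden \<theta>' (subst_garden \<tau> \<delta>)"
    proof (rule opener_subst_garden[OF op *(1) opens])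
      have "set_mset (binders_garden (x \<cdot> \<Phi>)) \<inter> (\<Union>\<delta>\<in>set_mset \<Delta>. bv_garden \<delta>) = {}"
        using frag unfolding fragment_def is_bouquet_iff
        by (simp only: binders_add_mset binders_empty add_0_right binders_flower.simps distinct_mset_add
            set_sum_binders_garden)
      then show "bv_garden \<delta> \<inter> fset x = {}"
        using \<delta> unfolding set_binders_garden bv_garden_eq by blast
      show "bv_garden \<delta> \<subseteq> B"
        using frag \<delta> unfolding fragment_def by auto
      have fv\<delta>: "fv_garden \<delta> - fset x \<subseteq> fv_flower ?\<phi>"
        using \<delta> by auto
      \<comment> \<open>A sprinkler variable lies in \<open>B\<close>, where \<open>\<tau>\<close>
        takes no values on \<open>x\<close>; any other free variable of \<open>\<delta>\<close> is
        free in the flower and is excluded by the assumption on \<open>\<tau>\<close>.\<close>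
      show "fv_garden \<delta> \<inter> \<tau> ` fset x = {}"
        using fv\<delta> \<tau>\<phi> opens x unfolding opens_def by (smt (verit) Diff_iff disjoint_iff image_iff subsetD)
      show "\<theta> ` (fv_garden \<delta> - fset x) \<subseteq> A \<union> B"
        using fv\<delta> unfolding A_def by blast
    qed
  qed
  have A0: "set_mset (path_binders \<Xi>) \<union> fv (fill \<Xi> {#}) \<union> \<theta> ` fv_garden (x \<cdot> \<Phi>) \<subseteq> A"
    unfolding A_def by auto
  have "subst_flower \<theta>' (unit_garden \<rhd> image_mset (subst_garden \<tau>) \<Delta>) = unit_garden \<rhd> \<Delta>'"
    unfolding \<Delta>' by (simp add: subst_param_map_flower[OF openerD(2)[OF op]] del: subst_flower.simps)
  then have pistil: "reduces ar (fill \<Xi> {#(x' \<cdot> \<Phi>') \<rhd> {#{||} \<cdot> {#unit_garden \<rhd> \<Delta>'#}#}#}) (fill \<Xi> {#})"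
    using reduces_pistil[OF * fragx \<tau> prov op A0] unfolding mapx by (simp del: subst_flower.simps)
  have "reduces ar (fill \<Xi> {#\<phi>\<theta>#}) (fill \<Xi> {#(x' \<cdot> \<Phi>') \<rhd> \<Delta>'#})"
    by (rule reduces_alpha[OF alpha_fill[OF alpha]])
  also note epis also note srep also note pistil
  finally show "reduces ar (fill \<Xi> (subst \<theta> {#?\<phi>#})) (fill \<Xi> {#})"
    unfolding \<phi>\<theta>_def by (simp del: subst_flower.simps)
qed

subsection \<open>Case analysis on an available flower\<close>

text \<open>One case of the case analysis, after srep has made the petal \<open>\<delta>\<close> the
  pistil of a flower whose only petal is the goal. The goal is present as a variant
  \<open>\<Phi>'\<close> with binders outside \<open>B\<close>, so the renaming of the sprinkler of
  \<open>\<delta>\<close> leaves it alone.\<close>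

lemma reduces_petal:
  assumes \<theta>: "param_map \<theta>" and good: "good \<Xi>"
    and avail: "\<forall>\<phi>\<in>H. available (subst_flower \<theta> \<phi>) \<Xi>"
    and frag: "fragment_garden \<delta>" and \<tau>: "fresh_params H \<delta> \<tau>"
    and \<tau>\<Phi>: "\<tau> ` fset (sprinkler \<delta>) \<inter> fv \<Phi> = {}" and \<Phi>B: "fv \<Phi> \<inter> B = {}"
    and prov: "provable (H \<union> set_mset (subst \<tau> (body \<delta>))) \<Phi>"
    and \<Phi>': "subst \<theta> \<Phi> \<approx>\<^sub>\<alpha> \<Phi>'" "bv \<Phi>' \<inter> B = {}"
  shows "reduces ar (fill \<Xi> {#subst_garden \<theta> \<delta> \<rhd> {#{||} \<cdot> \<Phi>'#}#}) (fill \<Xi> {#})"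
proof -
  obtain y \<Psi> where \<delta>: "\<delta> = y \<cdot> \<Psi>" by (cases \<delta>)
  note frag = frag[unfolded \<delta>] and \<tau> = \<tau>[unfolded \<delta>] and prov = prov[unfolded \<delta> garden.sel]
  define A where "A = set_mset (path_binders \<Xi>) \<union> fv (fill \<Xi> {#}) \<union> \<theta> ` fv_garden \<delta> \<union> bv \<Phi>' \<union> fv \<Phi>'"
  have y: "fset y \<subseteq> B" and opens: "opens y \<tau>" and inj_\<tau>: "inj_on \<tau> (fset y)"
    using frag \<tau> by (auto simp: fragment_garden_def fresh_params_def)
  have "finite A" unfolding A_def by simp
  from opener_exists[OF \<theta> y opens inj_\<tau> this] obtain \<rho> \<theta>' where op: "opener \<theta> y \<tau> A \<rho> \<theta>'" .
  have bij: "bij \<rho>" by (rule openerD(1)[OF op])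
  have fv\<Phi>': "fv \<Phi>' \<inter> B = {}"
    using alpha_fv[OF \<Phi>'(1)] fv_subst[of \<theta> \<Phi>] \<Phi>B \<theta> unfolding param_map_def by blast
  have fv\<delta>: "fv_garden (subst_garden \<theta> \<delta>) \<subseteq> A" "fv_garden (subst_garden \<theta> \<delta>) \<inter> B = {}"
    using fv_subst_garden[of \<theta> \<delta>] frag \<theta> unfolding A_def \<delta> fragment_garden_def param_map_def by blast+
  let ?\<phi> = "subst_garden \<theta> \<delta> \<rhd> {#{||} \<cdot> \<Phi>'#}"
  have "fv {#?\<phi>#} \<subseteq> A - B"
    using fv\<delta> fv\<Phi>' by (auto simp: A_def)
  then have \<rho>fix: "\<rho> v = v" if "v \<in> fv {#?\<phi>#}" for v
    using that y by (intro openerD(4)[OF op]) blast+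
  have "map_bouquet \<rho> \<Phi>' = \<Phi>'"
    using \<Phi>'(2) fv\<Phi>' y by (intro map_bouquet_fixed openerD(4)[OF op]) (auto simp: A_def)
  then have "map_bouquet \<rho> {#?\<phi>#} = {#map_garden id \<rho> (subst_garden \<theta> \<delta>) \<rhd> {#{||} \<cdot> \<Phi>'#}#}"
    by (simp only: image_mset_add_mset image_mset_empty flower.map garden.map fimage_fempty)
  moreover have "{#?\<phi>#} \<approx>\<^sub>\<alpha> map_bouquet \<rho> {#?\<phi>#}"
    by (rule alpha_rename[OF bij \<rho>fix])
  ultimately have "{#?\<phi>#} \<approx>\<^sub>\<alpha> {#map_garden id \<rho> (subst_garden \<theta> \<delta>) \<rhd> {#{||} \<cdot> \<Phi>'#}#}"
    by simp
  also have "\<dots> \<approx>\<^sub>\<alpha> {#map_garden id \<rho> (subst_garden \<theta> \<delta>) \<rhd> {#{||} \<cdot> subst \<theta> \<Phi>#}#}"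
    by (rule alpha_petal_body[OF alpha_sym[OF \<Phi>'(1)]])
  also have "subst \<theta> \<Phi> = subst \<theta>' \<Phi>"
    using \<tau>\<Phi> by (intro subst_cong openerD(5)[OF op, symmetric]) (auto simp: \<delta>)
  finally have "reduces ar (fill \<Xi> {#?\<phi>#})
      (fill \<Xi> {#map_garden id \<rho> (subst_garden \<theta> \<delta>) \<rhd> {#{||} \<cdot> subst \<theta>' \<Phi>#}#})"
    by (rule reduces_alpha[OF alpha_fill])
  also have "reduces ar \<dots> (fill \<Xi> {#})"
    unfolding \<delta> by (rule reduces_pistil[OF \<theta> good avail frag \<tau> prov op]) (auto simp: A_def \<delta>)
  finally show ?thesis .
qed

lemma fragment_instance:
  assumes frag: "fragment {#(x \<cdot> \<Phi>) \<rhd> \<Delta>#}" and "opens x \<sigma>"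
  shows "fragment {#({||} \<cdot> subst \<sigma> \<Phi>) \<rhd> image_mset (subst_garden \<sigma>) \<Delta>#}"
  unfolding fragment_def is_bouquet_iff
proof (intro conjI)
  let ?\<psi> = "{#({||} \<cdot> subst \<sigma> \<Phi>) \<rhd> image_mset (subst_garden \<sigma>) \<Delta>#}"
  show "wf ar ?\<psi>"
    using frag by (simp add: fragment_def is_bouquet_iff)
  have binders: "binders ?\<psi> = binders \<Phi> + sum_mset (image_mset binders_garden \<Delta>)"
    by (simp add: multiset.map_comp comp_def)
  have "distinct_mset (mset_set (fset x) + binders \<Phi> + sum_mset (image_mset binders_garden \<Delta>))"
    using frag by (simp only: fragment_def is_bouquet_iff binders_add_mset binders_empty add_0_right
        binders_flower.simps binders_garden_eq)
  then show "distinct_mset (binders ?\<psi>)"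
    unfolding binders distinct_mset_add set_mset_union by blast
  have "bv ?\<psi> \<subseteq> bv {#(x \<cdot> \<Phi>) \<rhd> \<Delta>#}"
    by auto
  then show bv: "bv ?\<psi> \<subseteq> B"
    using frag unfolding fragment_def by blast
  have \<sigma>: "\<sigma> ` V \<inter> B = {}" if "V - fset x \<subseteq> fv {#(x \<cdot> \<Phi>) \<rhd> \<Delta>#}" for V
  proof -
    have "\<sigma> v \<notin> B" if "v \<in> V" for v
    proof (cases "v |\<in>| x")
      case True
      with assms(2) show ?thesis unfolding opens_def by simp
    next
      case False
      with that \<open>V - fset x \<subseteq> _\<close> have "v \<notin> B" using frag unfolding fragment_def by blast
      with assms(2) False show ?thesis unfolding opens_def by simp
    qed
    then show ?thesis by blast
  qed
  have "fv (subst \<sigma> \<Phi>) \<inter> B = {}"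
  proof -
    have "fv \<Phi> - fset x \<subseteq> fv {#(x \<cdot> \<Phi>) \<rhd> \<Delta>#}" by simp
    from \<sigma>[OF this] fv_subst[of \<sigma> \<Phi>] show ?thesis by blast
  qed
  moreover have "fv_garden (subst_garden \<sigma> \<delta>) \<inter> B = {}" if "\<delta> \<in># \<Delta>" for \<delta>
  proof -
    have "fv_garden \<delta> - fset x \<subseteq> fv {#(x \<cdot> \<Phi>) \<rhd> \<Delta>#}" using that by auto
    from \<sigma>[OF this] fv_subst_garden[of \<sigma> \<delta>] show ?thesis by blast
  qed
  ultimately show fv: "fv ?\<psi> \<inter> B = {}"
    by (simp add: Int_Un_distrib2) blast
  show "bv ?\<psi> \<inter> fv ?\<psi> = {}" using bv fv by blast
qed

lemma fragment_petal:
  assumes "fragment {#\<gamma> \<rhd> \<Delta>#}" "\<delta> \<in># \<Delta>" "sprinkler \<gamma> = {||}"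
  shows "fragment_garden \<delta>"
  unfolding fragment_garden_def
proof (intro conjI)
  have "distinct_mset (binders_garden \<gamma> + sum_mset (image_mset binders_garden \<Delta>))"
    using assms(1) by (simp only: fragment_def is_bouquet_iff binders_add_mset binders_empty add_0_right
        binders_flower.simps)
  then show "distinct_mset (binders_garden \<delta>)"
    using assms(2) unfolding distinct_mset_add by (blast intro: distinct_binders_petal)
  show "wf_garden ar \<delta>"
    using assms(1,2) by (simp add: fragment_def is_bouquet_iff)
  have "bv_garden \<delta> \<subseteq> bv {#\<gamma> \<rhd> \<Delta>#}" "fv_garden \<delta> \<subseteq> fv {#\<gamma> \<rhd> \<Delta>#}"
    using assms(2,3) by auto
  then show "bv_garden \<delta> \<subseteq> B" "fv_garden \<delta> \<inter> B = {}"
    using assms(1) unfolding fragment_def by blast+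
qed

text \<open>The left rule. The goal is replaced by a variant \<open>\<Psi>'\<close> with binders
  outside \<open>B\<close>, since it comes to stand in one flower with petals whose binders lie in
  \<open>B\<close>. The copies that srep makes of \<open>\<Psi>'\<close> share binders;
  \<open>good\<close> ignores this, as it concerns binders off the path.\<close>

lemma provable_cases:
  assumes \<phi>: "(x \<cdot> \<Phi>) \<rhd> \<Delta> \<in> H" and frag: "fragment {#(x \<cdot> \<Phi>) \<rhd> \<Delta>#}"
    and \<sigma>: "opens x \<sigma>" and prov: "provable H (subst \<sigma> \<Phi>)" and frag\<Psi>: "fragment \<Psi>"
    and petals: "\<And>\<delta>. \<delta> \<in># image_mset (subst_garden \<sigma>) \<Delta> \<Longrightarrow> \<exists>\<tau>. fresh_params H \<delta> \<tau> \<and>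
      \<tau> ` fset (sprinkler \<delta>) \<inter> fv \<Psi> = {} \<and> provable (H \<union> set_mset (subst \<tau> (body \<delta>))) \<Psi>"
  shows "provable H \<Psi>"
  unfolding provable_def
proof (intro allI impI, elim conjE)
  fix \<theta> \<Xi> assume *: "param_map \<theta>" "good \<Xi>" "\<forall>\<phi>\<in>H. available (subst_flower \<theta> \<phi>) \<Xi>"
  let ?\<phi> = "(x \<cdot> \<Phi>) \<rhd> \<Delta>"
  have x: "fset x \<subseteq> B" and bv\<Phi>: "bv \<Phi> \<subseteq> B" and bv\<Delta>: "\<forall>\<delta>\<in>#\<Delta>. bv_garden \<delta> \<subseteq> B"
    using frag by (auto simp: fragment_def)
  obtain \<sigma>' where \<sigma>': "opens x \<sigma>'" "\<sigma>' \<circ> \<theta> = \<theta> \<circ> \<sigma>"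
    using opens_comm[OF *(1) x \<sigma>] by blast
  define \<phi>\<theta> where "\<phi>\<theta> = (x \<cdot> subst \<theta> \<Phi>) \<rhd> image_mset (subst_garden \<theta>) \<Delta>"
  have \<phi>\<theta>: "subst_flower \<theta> ?\<phi> = \<phi>\<theta>"
    unfolding \<phi>\<theta>_def by (rule subst_param_map_flower[OF *(1) x])
  have frag\<theta>: "fragment {#\<phi>\<theta>#}"
    using fragment_subst[OF *(1) frag] \<phi>\<theta> by (simp del: subst_flower.simps)
  define \<Delta>\<sigma> where "\<Delta>\<sigma> = image_mset (subst_garden \<sigma>) \<Delta>"
  define \<Phi>1 \<Delta>1 where "\<Phi>1 = subst \<theta> (subst \<sigma> \<Phi>)" and "\<Delta>1 = image_mset (subst_garden \<theta>) \<Delta>\<sigma>"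
  let ?\<psi> = "({||} \<cdot> \<Phi>1) \<rhd> \<Delta>1"
  have frag\<sigma>: "fragment {#({||} \<cdot> subst \<sigma> \<Phi>) \<rhd> \<Delta>\<sigma>#}"
    unfolding \<Delta>\<sigma>_def by (rule fragment_instance[OF frag \<sigma>])
  have frag\<psi>: "fragment {#?\<psi>#}"
    using fragment_subst[OF *(1) frag\<sigma>] subst_param_map_flower[OF *(1), of "{||}" "subst \<sigma> \<Phi>" \<Delta>\<sigma>]
    unfolding \<Phi>1_def \<Delta>1_def by (simp del: subst_flower.simps)
  have fv\<Psi>B: "fv (subst \<theta> \<Psi>) \<inter> B = {}"
    using fragment_subst[OF *(1) frag\<Psi>] unfolding fragment_def by blast
  define A where "A = set_mset (path_binders \<Xi>) \<union> fv (fill \<Xi> {#}) \<union> fv (subst \<theta> \<Psi>) \<union> fv {#?\<psi>#} \<union> B"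
  have "finite A" unfolding A_def using finite_B by (simp del: fv_add_mset)
  from freshen[OF infinite_vars this, of "subst \<theta> \<Psi>"] obtain \<Psi>' where \<Psi>': "subst \<theta> \<Psi> \<approx>\<^sub>\<alpha> \<Psi>'"
    "distinct_mset (binders \<Psi>')" "bv \<Psi>' \<inter> A = {}" .
  have fv\<Psi>': "fv \<Psi>' = fv (subst \<theta> \<Psi>)"
    using alpha_fv[OF \<Psi>'(1)] by simp
  have wf\<Psi>': "wf ar \<Psi>'"
    using alpha_wf[OF \<Psi>'(1), of ar] frag\<Psi> by (simp add: fragment_def is_bouquet_iff)
  have bv\<Psi>': "bv \<Psi>' \<inter> B = {}"
    using \<Psi>'(3) unfolding A_def by blast
  have fits\<Psi>': "fits \<Xi> \<Psi>'"
    unfolding fits_def is_bouquet_iff using wf\<Psi>' \<Psi>'(2,3) fv\<Psi>' unfolding A_def by blast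
  have "reduces ar (fill \<Xi> (subst \<theta> \<Psi>)) (fill \<Xi> \<Psi>')"
    by (rule reduces_alpha[OF alpha_fill[OF \<Psi>'(1)]])
  also have "reduces ar \<dots> (fill \<Xi> {#unit_garden \<rhd> {#{||} \<cdot> \<Psi>'#}#})"
    by (rule reduces_rule[OF *(2) fits\<Psi>' natural_rule.epis])
  also have "reduces ar \<dots> (fill \<Xi> {#({||} \<cdot> {#unit_garden \<rhd> \<Delta>1#}) \<rhd> {#{||} \<cdot> \<Psi>'#}#})"
  proof -
    define \<Xi>1 where "\<Xi>1 = fill_ctx \<Xi> (Ctx {#} (InPistil {||} (Ctx {#} Hole) {#{||} \<cdot> \<Psi>'#}))"
    have \<Xi>1: "fill \<Xi>1 \<Theta> = fill \<Xi> {#({||} \<cdot> \<Theta>) \<rhd> {#{||} \<cdot> \<Psi>'#}#}" for \<Theta>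
      by (simp add: \<Xi>1_def fill_fill_ctx)
    have good1: "good \<Xi>1"
      unfolding \<Xi>1_def using fv\<Psi>B fv\<Psi>' wf\<Psi>' by (intro good_fill_ctx[OF *(2)]) simp_all
    have avail1: "\<forall>\<phi>\<in>H. available (subst_flower \<theta> \<phi>) \<Xi>1"
      using *(3) by (simp add: \<Xi>1_def)
    have avail\<phi>: "available \<phi>\<theta> \<Xi>1"
      using avail1 \<phi> \<phi>\<theta> by metis
    have wf\<phi>: "wf_flower ar \<phi>\<theta>"
      using frag\<theta> by (simp add: fragment_def is_bouquet_iff)
    have "reduces ar (fill \<Xi>1 {#}) (fill \<Xi>1 {#\<phi>\<theta>#})"
      by (rule pollinate_up[OF good1 avail\<phi> wf\<phi>])
    also have "reduces ar \<dots> (fill \<Xi>1 {#?\<psi>, \<phi>\<theta>#})"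
    proof (rule reduces_rule[OF good1 fits_fragment[OF good1 frag\<theta>]])
      \<comment> \<open>The whole sprinkler is instantiated, so the instance has an empty one, as
        srep demands once its pistil is erased.\<close>
      have "natural_rule {#(({||} |\<union>| x) \<cdot> subst \<theta> \<Phi>) \<rhd> image_mset (subst_garden \<theta>) \<Delta>#}
        {#({||} \<cdot> subst \<sigma>' (subst \<theta> \<Phi>)) \<rhd> image_mset (subst_garden \<sigma>') (image_mset (subst_garden \<theta>) \<Delta>),
          (({||} |\<union>| x) \<cdot> subst \<theta> \<Phi>) \<rhd> image_mset (subst_garden \<theta>) \<Delta>#}"
      proof (rule natural_rule.ipis[OF opens_support[OF \<sigma>'(1) x] opens_capture_avoiding[OF \<sigma>'(1)]])
        show "bv {#({||} \<cdot> subst \<theta> \<Phi>) \<rhd> image_mset (subst_garden \<theta>) \<Delta>#} \<subseteq> B"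
          using bv\<Phi> bv\<Delta> by (simp add: UN_subset_iff)
      qed
      then show "natural_rule {#\<phi>\<theta>#} {#?\<psi>, \<phi>\<theta>#}"
        unfolding \<phi>\<theta>_def \<Phi>1_def \<Delta>1_def \<Delta>\<sigma>_def subst_opens_comm[OF *(1) \<sigma> \<sigma>' bv\<Phi>]
          subst_petals_opens_comm[OF *(1) \<sigma> \<sigma>' bv\<Delta>] by simp
    qed
    \<comment> \<open>Rule ipis keeps the uninstantiated flower; it is erased again, being still
      available from the context.\<close>
    also have "reduces ar \<dots> (fill \<Xi>1 {#?\<psi>#})"
    proof -
      let ?\<Theta> = "Ctx {#?\<psi>#} Hole"
      have "good (fill_ctx \<Xi>1 ?\<Theta>)"
        using frag\<psi> by (intro good_fill_ctx[OF good1]) (simp_all add: fragment_def is_bouquet_iff)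
      then have "reduces ar (fill (fill_ctx \<Xi>1 ?\<Theta>) {#\<phi>\<theta>#}) (fill (fill_ctx \<Xi>1 ?\<Theta>) {#})"
        by (rule pollinate_down[OF _ _ wf\<phi>]) (simp add: avail\<phi>)
      moreover have "{#?\<psi>#} + {#\<phi>\<theta>#} = {#?\<psi>, \<phi>\<theta>#}"
        by (rule multiset_eqI) simp
      ultimately show ?thesis
        unfolding fill_ctx_Hole by (simp only: add_0_right)
    qed
    also have "reduces ar \<dots> (fill \<Xi>1 {#unit_garden \<rhd> \<Delta>1#})"
    proof -
      let ?\<Theta> = "Ctx {#} (InPistil {||} (Ctx {#} Hole) \<Delta>1)"
      have "good (fill_ctx \<Xi>1 ?\<Theta>)"
        using frag\<psi> by (intro good_fill_ctx[OF good1]) (auto simp: fragment_def is_bouquet_iff)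
      from provableD[OF prov *(1) this] avail1 show ?thesis
        by (simp add: fill_fill_ctx \<Phi>1_def)
    qed
    finally show ?thesis unfolding \<Xi>1 .
  qed
  also have "reduces ar \<dots> (fill \<Xi> {#unit_garden \<rhd> {#{||} \<cdot> image_mset (\<lambda>\<gamma>. \<gamma> \<rhd> {#{||} \<cdot> \<Psi>'#}) \<Delta>1#}#})"
  proof (rule reduces_rule[OF *(2) _ natural_rule.srep])
    let ?L = "{#({||} \<cdot> {#unit_garden \<rhd> \<Delta>1#}) \<rhd> {#{||} \<cdot> \<Psi>'#}#}"
    have bv: "bv ?L = (\<Union>\<delta>\<in>set_mset \<Delta>1. bv_garden \<delta>) \<union> bv \<Psi>'"
      and fv: "fv ?L = (\<Union>\<delta>\<in>set_mset \<Delta>1. fv_garden \<delta>) \<union> fv \<Psi>'"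
      by simp_all
    have bv1: "(\<Union>\<delta>\<in>set_mset \<Delta>1. bv_garden \<delta>) \<subseteq> B"
      and fv1: "(\<Union>\<delta>\<in>set_mset \<Delta>1. fv_garden \<delta>) \<subseteq> A - B"
      using frag\<psi> unfolding fragment_def A_def by auto
    show "fits \<Xi> ?L"
      unfolding fits_def is_bouquet_iff
    proof (intro conjI)
      show "wf ar ?L"
        using wf\<Psi>' frag\<psi> by (simp add: fragment_def is_bouquet_iff)
      have "distinct_mset (sum_mset (image_mset binders_garden \<Delta>1) + binders \<Psi>')"
        unfolding distinct_mset_add set_sum_binders_garden set_binders
        using frag\<psi> \<Psi>'(2) bv1 bv\<Psi>' by (auto simp: fragment_def is_bouquet_iff)
      then show "distinct_mset (binders ?L)" by simp
      show "bv ?L \<inter> fv ?L = {}"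
        unfolding bv fv fv\<Psi>' using bv1 fv1 \<Psi>'(3) fv\<Psi>B unfolding A_def by blast
      show "bv ?L \<inter> (set_mset (path_binders \<Xi>) \<union> fv (fill \<Xi> {#})) = {}"
        unfolding bv using bv1 \<Psi>'(3) *(2) unfolding A_def good_def by blast
    qed
  qed
  also have "reduces ar \<dots> (fill \<Xi> {#unit_garden \<rhd> {#unit_garden#}#})"
  proof -
    define \<Xi>3 where "\<Xi>3 = fill_ctx \<Xi> (Ctx {#} (InPetal unit_garden {||} (Ctx {#} Hole) {#}))"
    have \<Xi>3: "fill \<Xi>3 \<Theta> = fill \<Xi> {#unit_garden \<rhd> {#{||} \<cdot> \<Theta>#}#}" for \<Theta>
      by (simp add: \<Xi>3_def fill_fill_ctx)
    have good3: "good \<Xi>3"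
      unfolding \<Xi>3_def by (intro good_fill_ctx[OF *(2)]) simp_all
    let ?f = "\<lambda>\<delta>. subst_garden \<theta> \<delta> \<rhd> {#{||} \<cdot> \<Psi>'#}"
    \<comment> \<open>Generalised to all multisets of petals from \<open>\<Delta>\<sigma>\<close>:
      the induction erases one case while the remaining ones stay beside the hole.\<close>
    have "reduces ar (fill \<Xi>3 (image_mset ?f \<Delta>')) (fill \<Xi>3 {#})" if "set_mset \<Delta>' \<subseteq> set_mset \<Delta>\<sigma>" for \<Delta>'
      using that
    proof (induction \<Delta>')
      case (add \<delta> \<Delta>')
      then have \<delta>: "\<delta> \<in># \<Delta>\<sigma>" and sub: "set_mset \<Delta>' \<subseteq> set_mset \<Delta>\<sigma>"
        by simp_all
      let ?\<Xi> = "fill_ctx \<Xi>3 (Ctx (image_mset ?f \<Delta>') Hole)"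
      have fragd: "fragment_garden \<delta>" if "\<delta> \<in># \<Delta>\<sigma>" for \<delta>
        by (rule fragment_petal[OF frag\<sigma> that]) simp
      have fvd: "fv_garden (subst_garden \<theta> \<delta>) \<inter> B = {}" if "\<delta> \<in># \<Delta>\<sigma>" for \<delta>
        using fv_subst_garden[of \<theta> \<delta>] fragd[OF that] *(1)
        unfolding fragment_garden_def param_map_def by blast
      have "good ?\<Xi>"
      proof (rule good_fill_ctx[OF good3])
        show "fv (fill (Ctx (image_mset ?f \<Delta>') Hole) {#}) \<inter> B = {}"
        proof -
          have "fv_flower (?f \<delta>') \<inter> B = {}" if "\<delta>' \<in># \<Delta>'" for \<delta>'
            using fvd[of \<delta>'] that sub fv\<Psi>B fv\<Psi>' by auto
          then show ?thesis
            unfolding fill.simps fill_f.simps add_0_right fv_def set_image_mset by blast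
        qed
        show "wf ar (fill (Ctx (image_mset ?f \<Delta>') Hole) {#})"
        proof -
          have "wf_flower ar (?f \<delta>')" if "\<delta>' \<in># \<Delta>'" for \<delta>'
            using fragd[of \<delta>'] that sub wf\<Psi>' by (auto simp: fragment_garden_def)
          then show ?thesis by simp
        qed
      qed simp_all
      moreover have "\<forall>\<phi>\<in>H. available (subst_flower \<theta> \<phi>) ?\<Xi>"
        using *(3) by (simp add: \<Xi>3_def)
      moreover from \<delta> petals[folded \<Delta>\<sigma>_def] obtain \<tau> where \<tau>: "fresh_params H \<delta> \<tau> \<and>
        \<tau> ` fset (sprinkler \<delta>) \<inter> fv \<Psi> = {} \<and> provable (H \<union> set_mset (subst \<tau> (body \<delta>))) \<Psi>"
        by fast
      moreover have "fv \<Psi> \<inter> B = {}"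
        using frag\<Psi> unfolding fragment_def by blast
      ultimately have "reduces ar (fill ?\<Xi> {#?f \<delta>#}) (fill ?\<Xi> {#})"
        using \<Psi>'(1) bv\<Psi>' fragd[OF \<delta>] *(1) by (elim conjE) (rule reduces_petal)
      also have "reduces ar (fill ?\<Xi> {#}) (fill \<Xi>3 {#})"
        using add.IH[OF sub] by (simp add: fill_ctx_Hole)
      finally show ?case by (simp add: fill_ctx_Hole)
    qed simp
    from this[of \<Delta>\<sigma>] show ?thesis
      by (simp add: \<Xi>3 \<Delta>1_def multiset.map_comp comp_def)
  qed
  also have "reduces ar \<dots> (fill \<Xi> {#})"
  proof (rule reduces_rule[OF *(2) _ natural_rule.epet])
    show "fits \<Xi> {#unit_garden \<rhd> {#unit_garden#}#}"
      by (simp add: fits_def is_bouquet_iff)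
  qed
  finally show "reduces ar (fill \<Xi> (subst \<theta> \<Psi>)) (fill \<Xi> {#})" .
qed


section \<open>Saturated theories\<close>

text \<open>A context holds finitely many flowers whereas a theory may be infinite, hence the finite
  \<open>H\<close>. It also makes derivability from the union of a chain reduce to derivability from
  one member.\<close>

definition derivable :: "('p, 'v) flower set \<Rightarrow> ('p, 'v) bouquet \<Rightarrow> bool" where
  "derivable T \<Phi> \<longleftrightarrow> (\<exists>H. finite H \<and> H \<subseteq> T \<and> provable H \<Phi>)"

definition theory_over :: "'v set \<Rightarrow> ('p, 'v) flower set \<Rightarrow> bool" where
  "theory_over V T \<longleftrightarrow> (\<forall>\<phi>\<in>T. fragment {#\<phi>#} \<and> fv_flower \<phi> \<subseteq> V)"

lemma derivable_mono: "derivable T \<Phi> \<Longrightarrow> T \<subseteq> T' \<Longrightarrow> derivable T' \<Phi>"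
  unfolding derivable_def by blast

lemma derivable_assm: "\<phi> \<in> T \<Longrightarrow> wf_flower ar \<phi> \<Longrightarrow> derivable T {#\<phi>#}"
  unfolding derivable_def by (intro exI[of _ "{\<phi>}"]) (simp add: provable_assm)

lemma derivable_bouquet:
  assumes "\<And>\<phi>. \<phi> \<in># \<Phi> \<Longrightarrow> derivable T {#\<phi>#}" "wf ar \<Phi>" "fv \<Phi> \<inter> B = {}"
  shows "derivable T \<Phi>"
  using assms
proof (induction \<Phi>)
  case empty
  show ?case unfolding derivable_def by (intro exI[of _ "{}"]) (simp add: provable_empty)
next
  case (add \<phi> \<Phi>)
  have "derivable T \<Phi>" using add by (intro add.IH) auto
  then obtain H where H: "finite H" "H \<subseteq> T" "provable H \<Phi>" unfolding derivable_def by blast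
  have "derivable T {#\<phi>#}" using add by simp
  then obtain H' where H': "finite H'" "H' \<subseteq> T" "provable H' {#\<phi>#}" unfolding derivable_def by blast
  have "provable (H \<union> H') ({#\<phi>#} + \<Phi>)"
  proof (rule provable_plus)
    show "provable (H \<union> H') {#\<phi>#}" "provable (H \<union> H') \<Phi>"
      using H(3) H'(3) by (auto intro: provable_mono)
    show "wf ar \<Phi>" "fv \<Phi> \<inter> B = {}" using add(3,4) by auto
  qed
  then show ?case
    using H H' unfolding derivable_def by (intro exI[of _ "H \<union> H'"]) simp
qed

lemma derivable_petal:
  assumes "fragment {#unit_garden \<rhd> \<Delta>#}" "\<delta> \<in># \<Delta>"
    "opens (sprinkler \<delta>) \<sigma>" "derivable T (subst \<sigma> (body \<delta>))"
  shows "derivable T {#unit_garden \<rhd> \<Delta>#}"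
proof -
  obtain \<Delta>' where \<Delta>: "\<Delta> = add_mset \<delta> \<Delta>'" using multi_member_split[OF assms(2)] by blast
  from assms(4) obtain H where "finite H" "H \<subseteq> T" "provable H (subst \<sigma> (body \<delta>))"
    unfolding derivable_def by blast
  moreover from this(3) have "provable H {#unit_garden \<rhd> \<Delta>#}"
    using provable_petal[of "sprinkler \<delta>" "body \<delta>" \<Delta>' \<sigma> H] assms(1,3) unfolding \<Delta> by simp
  ultimately show ?thesis unfolding derivable_def by blast
qed

text \<open>All variables of \<open>T\<close> and of the flower lie in \<open>V\<close>, so
  parameters outside \<open>V\<close> meet the eigenvariable condition for every finite part of
  \<open>T\<close>. The hypotheses outside \<open>T\<close> come from the opened pistil and are
  discharged.\<close>

lemma derivable_flower:
  assumes "fragment {#(x \<cdot> \<Phi>) \<rhd> \<Delta>#}" "theory_over V T" "fv_flower ((x \<cdot> \<Phi>) \<rhd> \<Delta>) \<subseteq> V"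
    and \<tau>: "opens x \<tau>" "inj_on \<tau> (fset x)" "\<tau> ` fset x \<inter> V = {}"
    and der: "derivable (T \<union> set_mset (subst \<tau> \<Phi>)) {#unit_garden \<rhd> image_mset (subst_garden \<tau>) \<Delta>#}"
  shows "derivable T {#(x \<cdot> \<Phi>) \<rhd> \<Delta>#}"
proof -
  from der obtain H where H: "finite H" "H \<subseteq> T \<union> set_mset (subst \<tau> \<Phi>)"
    "provable H {#unit_garden \<rhd> image_mset (subst_garden \<tau>) \<Delta>#}"
    unfolding derivable_def by blast
  have "provable (H \<inter> T) {#(x \<cdot> \<Phi>) \<rhd> \<Delta>#}"
  proof (rule provable_flower[OF assms(1)])
    have "fv_garden (x \<cdot> \<Phi>) \<subseteq> V" using assms(3) by auto
    moreover have "(\<Union>\<phi>\<in>H \<inter> T. fv_flower \<phi>) \<subseteq> V"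
      using assms(2) unfolding theory_over_def by blast
    ultimately show "fresh_params (H \<inter> T) (x \<cdot> \<Phi>) \<tau>"
      using \<tau> unfolding fresh_params_def garden.sel by blast
    show "\<tau> ` fset x \<inter> fv_flower ((x \<cdot> \<Phi>) \<rhd> \<Delta>) = {}"
      using \<tau>(3) assms(3) by blast
    show "provable (H \<inter> T \<union> set_mset (subst \<tau> \<Phi>)) {#unit_garden \<rhd> image_mset (subst_garden \<tau>) \<Delta>#}"
      by (rule provable_mono[OF H(3)]) (use H(2) in blast)
  qed
  with H(1) show ?thesis unfolding derivable_def by blast
qed

text \<open>Each petal comes with its own finite set of hypotheses. There are finitely many petals,
  so their parts in \<open>T\<close> can be united.\<close>

lemma derivable_cases:
  assumes \<phi>: "(x \<cdot> \<Phi>) \<rhd> \<Delta> \<in> T" and frag: "fragment {#(x \<cdot> \<Phi>) \<rhd> \<Delta>#}"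
    and \<sigma>: "opens x \<sigma>" and der: "derivable T (subst \<sigma> \<Phi>)" and frag\<Psi>: "fragment \<Psi>"
    and petals: "\<And>\<delta>. \<delta> \<in># image_mset (subst_garden \<sigma>) \<Delta> \<Longrightarrow> \<exists>\<tau>. fresh_params T \<delta> \<tau> \<and>
      \<tau> ` fset (sprinkler \<delta>) \<inter> fv \<Psi> = {} \<and> derivable (T \<union> set_mset (subst \<tau> (body \<delta>))) \<Psi>"
  shows "derivable T \<Psi>"
proof -
  let ?\<Delta> = "image_mset (subst_garden \<sigma>) \<Delta>"
  have "\<exists>\<tau> H. fresh_params T \<delta> \<tau> \<and> \<tau> ` fset (sprinkler \<delta>) \<inter> fv \<Psi> = {} \<and>
      finite H \<and> H \<subseteq> T \<union> set_mset (subst \<tau> (body \<delta>)) \<and> provable H \<Psi>" if "\<delta> \<in> set_mset ?\<Delta>" for \<delta>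
    using petals[OF that] unfolding derivable_def by blast
  then obtain \<tau> H where H: "\<forall>\<delta>\<in>set_mset ?\<Delta>. fresh_params T \<delta> (\<tau> \<delta>) \<and>
      \<tau> \<delta> ` fset (sprinkler \<delta>) \<inter> fv \<Psi> = {} \<and> finite (H \<delta>) \<and>
      H \<delta> \<subseteq> T \<union> set_mset (subst (\<tau> \<delta>) (body \<delta>)) \<and> provable (H \<delta>) \<Psi>"
    by metis
  from der obtain H' where H': "finite H'" "H' \<subseteq> T" "provable H' (subst \<sigma> \<Phi>)"
    unfolding derivable_def by blast
  define H'' where "H'' = {(x \<cdot> \<Phi>) \<rhd> \<Delta>} \<union> H' \<union> (\<Union>\<delta>\<in>set_mset ?\<Delta>. H \<delta> \<inter> T)"
  have sub: "H'' \<subseteq> T" using \<phi> H'(2) unfolding H''_def by blast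
  have "provable H'' \<Psi>"
  proof (rule provable_cases[OF _ frag \<sigma> _ frag\<Psi>])
    show "(x \<cdot> \<Phi>) \<rhd> \<Delta> \<in> H''" by (simp add: H''_def)
    show "provable H'' (subst \<sigma> \<Phi>)" by (rule provable_mono[OF H'(3)]) (auto simp: H''_def)
    fix \<delta> assume \<delta>: "\<delta> \<in># ?\<Delta>"
    with H have *: "fresh_params T \<delta> (\<tau> \<delta>)" "\<tau> \<delta> ` fset (sprinkler \<delta>) \<inter> fv \<Psi> = {}"
      "H \<delta> \<subseteq> T \<union> set_mset (subst (\<tau> \<delta>) (body \<delta>))" "provable (H \<delta>) \<Psi>" by blast+
    have "fresh_params H'' \<delta> (\<tau> \<delta>)"
      using *(1) sub unfolding fresh_params_def by blast
    moreover have "provable (H'' \<union> set_mset (subst (\<tau> \<delta>) (body \<delta>))) \<Psi>"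
      by (rule provable_mono[OF *(4)]) (use *(3) \<delta> in \<open>unfold H''_def, blast\<close>)
    ultimately show "\<exists>\<tau>. fresh_params H'' \<delta> \<tau> \<and> \<tau> ` fset (sprinkler \<delta>) \<inter> fv \<Psi> = {} \<and>
        provable (H'' \<union> set_mset (subst \<tau> (body \<delta>))) \<Psi>"
      using *(2) by blast
  qed
  moreover have "finite H''" using H'(1) H by (simp add: H''_def)
  ultimately show ?thesis using sub unfolding derivable_def by blast
qed

lemma fresh_opens:
  assumes "infinite U" "U \<inter> B = {}" "finite F"
  obtains \<tau> where "opens y \<tau>" "inj_on \<tau> (fset y)" "\<tau> ` fset y \<subseteq> U - F"
proof -
  have "infinite (U - F)" using assms by simp
  then obtain C where C: "finite C" "card C = card (fset y)" "C \<subseteq> U - F"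
    by (meson infinite_arbitrarily_large)
  then obtain f where f: "bij_betw f (fset y) C"
    by (metis finite_same_card_bij finite_fset)
  define \<tau> where "\<tau> v = (if v |\<in>| y then f v else v)" for v
  have fy: "f ` fset y = C" "inj_on f (fset y)"
    using f by (simp_all add: bij_betw_def)
  have img: "\<tau> ` fset y = C"
    using fy(1) by (simp add: \<tau>_def)
  have "opens y \<tau>"
    unfolding opens_def
  proof
    fix v show "if v |\<in>| y then \<tau> v \<notin> B else \<tau> v = v"
    proof (cases "v |\<in>| y")
      case True
      then have "\<tau> v \<in> C" using img by blast
      with True C(3) assms(2) show ?thesis by auto
    qed (simp add: \<tau>_def)
  qed
  moreover have "inj_on \<tau> (fset y)"
    using fy(2) by (simp add: inj_on_def \<tau>_def)
  ultimately show thesis using that img C(3) by blast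
qed

lemma opens_image:
  assumes "opens x \<sigma>" "\<sigma> ` fset x \<subseteq> V" "W - fset x \<subseteq> V"
  shows "\<sigma> ` W \<subseteq> V"
proof
  fix u assume "u \<in> \<sigma> ` W"
  then obtain v where v: "v \<in> W" "u = \<sigma> v" by blast
  show "u \<in> V"
  proof (cases "v |\<in>| x")
    case True
    with v(2) assms(2) show ?thesis by blast
  next
    case False
    with assms(1) have "\<sigma> v = v" unfolding opens_def by metis
    with v assms(3) False show ?thesis by auto
  qed
qed

lemma fragment_single: "fragment \<Phi> \<Longrightarrow> \<phi> \<in># \<Phi> \<Longrightarrow> fragment {#\<phi>#}"
proof -
  assume \<Phi>: "fragment \<Phi>" and \<phi>: "\<phi> \<in># \<Phi>"
  have "bv_flower \<phi> \<subseteq> B" "fv_flower \<phi> \<inter> B = {}"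
    using \<Phi> bv_mono[OF \<phi>] fv_mono[OF \<phi>] unfolding fragment_def by blast+
  moreover have "distinct_mset (binders_flower \<phi>)"
    using \<Phi> distinct_binders_submset[OF \<phi>] unfolding fragment_def is_bouquet_iff by blast
  ultimately show ?thesis
    using \<Phi> \<phi> unfolding fragment_def is_bouquet_iff by (simp, blast)
qed

lemma fragment_body:
  assumes "fragment_garden \<delta>" "opens (sprinkler \<delta>) \<tau>"
  shows "fragment (subst \<tau> (body \<delta>))"
proof -
  obtain y \<Psi> where \<delta>: "\<delta> = y \<cdot> \<Psi>" by (cases \<delta>)
  have "\<tau> ` fset y \<subseteq> - B"
    using assms(2) unfolding \<delta> opens_def by auto
  moreover have "fv \<Psi> - fset y \<subseteq> - B"
    using assms(1) unfolding \<delta> fragment_garden_def by auto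
  ultimately have "\<tau> ` fv \<Psi> \<subseteq> - B"
    by (rule opens_image[OF assms(2)[unfolded \<delta> garden.sel]])
  then have fv: "fv (subst \<tau> \<Psi>) \<inter> B = {}"
    using fv_subst[of \<tau> \<Psi>] by blast
  moreover have "bv \<Psi> \<subseteq> B" "distinct_mset (binders \<Psi>)" "wf ar \<Psi>"
    using assms(1) unfolding \<delta> fragment_garden_def by auto
  ultimately show ?thesis
    unfolding \<delta> fragment_def is_bouquet_iff garden.sel by (simp, blast)
qed

lemma fragment_unit:
  assumes "fragment {#({||} \<cdot> \<Phi>) \<rhd> \<Delta>#}"
  shows "fragment {#unit_garden \<rhd> \<Delta>#}"
  unfolding fragment_def is_bouquet_iff
proof (intro conjI)
  let ?\<phi> = "{#unit_garden \<rhd> \<Delta>#}" and ?\<psi> = "{#({||} \<cdot> \<Phi>) \<rhd> \<Delta>#}"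
  show "wf ar ?\<phi>" "distinct_mset (binders ?\<phi>)"
    using assms by (simp_all add: fragment_def is_bouquet_iff)
  have "bv ?\<phi> \<subseteq> bv ?\<psi>" "fv ?\<phi> \<subseteq> fv ?\<psi>" by auto
  then show "bv ?\<phi> \<subseteq> B" "fv ?\<phi> \<inter> B = {}" "bv ?\<phi> \<inter> fv ?\<phi> = {}"
    using assms unfolding fragment_def by blast+
qed

text \<open>The last clause is the disjunction and the existence property in one: a derivable pistil
  instance yields one petal, with witnesses in \<open>V\<close>, whose body belongs to
  \<open>T\<close>. The infinitely many parameters outside \<open>V\<close> are the supply for
  worlds above, and a nonempty \<open>V\<close> gives a nonempty domain.\<close>

definition saturated :: "'v set \<Rightarrow> ('p, 'v) flower set \<Rightarrow> bool" where
  "saturated V T \<longleftrightarrow> V \<inter> B = {} \<and> infinite (- B - V) \<and> V \<noteq> {} \<and> theory_over V T \<and>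
     (\<forall>x \<Phi> \<Delta> \<sigma>. (x \<cdot> \<Phi>) \<rhd> \<Delta> \<in> T \<and> opens x \<sigma> \<and> \<sigma> ` fset x \<subseteq> V \<and> derivable T (subst \<sigma> \<Phi>) \<longrightarrow>
       (\<exists>\<delta>\<in>#image_mset (subst_garden \<sigma>) \<Delta>. \<exists>\<tau>. opens (sprinkler \<delta>) \<tau> \<and>
          \<tau> ` fset (sprinkler \<delta>) \<subseteq> V \<and> set_mset (subst \<tau> (body \<delta>)) \<subseteq> T))"

text \<open>The contrapositive of \<open>derivable_cases\<close>: if adding any petal with fresh
  witnesses made \<open>\<Psi>\<close> derivable, then \<open>\<Psi>\<close> would be derivable
  already. So some petal can be added.\<close>

lemma saturation_step:
  assumes F: "finite F" "theory_over V F" "\<not> derivable (T \<union> F) \<Psi>"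
    and T: "theory_over V\<^sub>0 T" and V: "V\<^sub>0 \<union> U \<subseteq> V" "infinite U" "U \<inter> B = {}" "U \<inter> V\<^sub>0 = {}"
    and \<Psi>: "fragment \<Psi>"
    and \<phi>: "(x \<cdot> \<Phi>) \<rhd> \<Delta> \<in> T \<union> F" and \<sigma>: "opens x \<sigma>" "\<sigma> ` fset x \<subseteq> V"
    and der: "derivable (T \<union> F) (subst \<sigma> \<Phi>)"
  obtains F' \<delta> \<tau> where "finite F'" "theory_over V F'" "\<not> derivable (T \<union> F') \<Psi>" "F \<subseteq> F'"
    "\<delta> \<in># image_mset (subst_garden \<sigma>) \<Delta>" "opens (sprinkler \<delta>) \<tau>" "\<tau> ` fset (sprinkler \<delta>) \<subseteq> V"
    "set_mset (subst \<tau> (body \<delta>)) \<subseteq> F'"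
proof -
  let ?\<Delta> = "image_mset (subst_garden \<sigma>) \<Delta>"
  have TF: "theory_over V (T \<union> F)"
    using F(2) T V(1) unfolding theory_over_def by blast
  have frag: "fragment {#(x \<cdot> \<Phi>) \<rhd> \<Delta>#}" and fv\<phi>: "fv_flower ((x \<cdot> \<Phi>) \<rhd> \<Delta>) \<subseteq> V"
    using TF \<phi> unfolding theory_over_def by blast+
  have "\<exists>\<delta>\<in>#?\<Delta>. \<forall>\<tau>. fresh_params (T \<union> F) \<delta> \<tau> \<and> \<tau> ` fset (sprinkler \<delta>) \<inter> fv \<Psi> = {} \<longrightarrow>
      \<not> derivable (T \<union> F \<union> set_mset (subst \<tau> (body \<delta>))) \<Psi>"
    using derivable_cases[OF \<phi> frag \<sigma>(1) der \<Psi>] F(3) by blast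
  then obtain \<delta> where \<delta>: "\<delta> \<in># ?\<Delta>" and nd: "\<forall>\<tau>. fresh_params (T \<union> F) \<delta> \<tau> \<and>
      \<tau> ` fset (sprinkler \<delta>) \<inter> fv \<Psi> = {} \<longrightarrow> \<not> derivable (T \<union> F \<union> set_mset (subst \<tau> (body \<delta>))) \<Psi>" ..
  \<comment> \<open>\<open>U\<close> avoids the variables of \<open>T\<close> altogether; of the
    remaining variables to be avoided there are only finitely many, because the stage
    \<open>F\<close> is finite.\<close>
  have "finite ((\<Union>\<phi>\<in>F. fv_flower \<phi>) \<union> fv_garden \<delta> \<union> fv \<Psi>)" using F(1) by simp
  from fresh_opens[OF V(2,3) this, of "sprinkler \<delta>"] obtain \<tau> where \<tau>: "opens (sprinkler \<delta>) \<tau>"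
    "inj_on \<tau> (fset (sprinkler \<delta>))"
    "\<tau> ` fset (sprinkler \<delta>) \<subseteq> U - ((\<Union>\<phi>\<in>F. fv_flower \<phi>) \<union> fv_garden \<delta> \<union> fv \<Psi>)" .
  have fvT: "(\<Union>\<phi>\<in>T. fv_flower \<phi>) \<subseteq> V\<^sub>0"
    using T unfolding theory_over_def by blast
  have "fresh_params (T \<union> F) \<delta> \<tau>"
    unfolding fresh_params_def using \<tau> fvT V(4) by (simp, blast)
  with nd \<tau>(3) have nder: "\<not> derivable (T \<union> F \<union> set_mset (subst \<tau> (body \<delta>))) \<Psi>" by blast
  have frag\<sigma>: "fragment {#({||} \<cdot> subst \<sigma> \<Phi>) \<rhd> ?\<Delta>#}"
    by (rule fragment_instance[OF frag \<sigma>(1)])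
  have frag\<delta>: "fragment_garden \<delta>"
    by (rule fragment_petal[OF frag\<sigma> \<delta>]) simp
  have \<tau>V: "\<tau> ` fset (sprinkler \<delta>) \<subseteq> V" using \<tau>(3) V(1) by blast
  have fv\<delta>: "fv_garden \<delta> \<subseteq> V"
  proof -
    from \<delta> obtain \<delta>' where \<delta>': "\<delta>' \<in># \<Delta>" "\<delta> = subst_garden \<sigma> \<delta>'" by auto
    have "fv_garden \<delta>' - fset x \<subseteq> fv_flower ((x \<cdot> \<Phi>) \<rhd> \<Delta>)" using \<delta>'(1) by auto
    with fv\<phi> have "\<sigma> ` fv_garden \<delta>' \<subseteq> V" by (intro opens_image[OF \<sigma>]) blast
    with fv_subst_garden[of \<sigma> \<delta>'] show ?thesis unfolding \<delta>'(2) by blast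
  qed
  have "fv (subst \<tau> (body \<delta>)) \<subseteq> V"
  proof -
    have "fv (body \<delta>) - fset (sprinkler \<delta>) = fv_garden \<delta>" by (cases \<delta>) simp
    with fv\<delta> have "\<tau> ` fv (body \<delta>) \<subseteq> V" by (intro opens_image[OF \<tau>(1) \<tau>V]) simp
    with fv_subst[of \<tau> "body \<delta>"] show ?thesis by blast
  qed
  moreover have "fragment (subst \<tau> (body \<delta>))"
    by (rule fragment_body[OF frag\<delta> \<tau>(1)])
  ultimately have "theory_over V (set_mset (subst \<tau> (body \<delta>)))"
    unfolding theory_over_def using fragment_single fv_mono by blast
  with F(2) have over: "theory_over V (F \<union> set_mset (subst \<tau> (body \<delta>)))"
    unfolding theory_over_def by blast
  show thesis
  proof (rule that[OF _ over _ _ \<delta> \<tau>(1) \<tau>V])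
    show "\<not> derivable (T \<union> (F \<union> set_mset (subst \<tau> (body \<delta>)))) \<Psi>"
      using nder by (simp only: Un_assoc not_False_eq_True)
  qed (use F(1) in simp_all)
qed

end

section \<open>The Henkin construction\<close>

locale countable_sequent = sequent ar B
  for ar :: "'p::countable \<Rightarrow> nat" and B :: "'v::countable set"
begin

text \<open>A task is a flower together with an instance of it. The instance stands in for the substitution
  that yields it, since the substitutions are uncountably many.\<close>

definition task :: "nat \<Rightarrow> ('p, 'v) flower \<times> ('p, 'v) flower" where
  "task n = from_nat (fst (prod_decode n))"

text \<open>The second component of the decoded pair is a mere counter, so each task recurs
  arbitrarily late. This matters because the flower may enter the theory, or its pistil become
  derivable, only at a late stage.\<close>

lemma task_cofinal: "\<exists>n\<ge>m. task n = \<pi>"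
  by (intro exI[of _ "prod_encode (to_nat \<pi>, m)"]) (simp add: task_def le_prod_encode_2)

definition performs :: "'v set \<Rightarrow> ('p, 'v) flower set \<Rightarrow> nat \<Rightarrow> ('p, 'v) flower set \<Rightarrow> bool" where
  "performs V T n F \<longleftrightarrow> (\<forall>x \<Phi> \<Delta> \<sigma>.
     task n = ((x \<cdot> \<Phi>) \<rhd> \<Delta>, ({||} \<cdot> subst \<sigma> \<Phi>) \<rhd> image_mset (subst_garden \<sigma>) \<Delta>) \<and>
     (x \<cdot> \<Phi>) \<rhd> \<Delta> \<in> T \<and> opens x \<sigma> \<and> \<sigma> ` fset x \<subseteq> V \<and> derivable T (subst \<sigma> \<Phi>) \<longrightarrow>
     (\<exists>\<delta>\<in>#image_mset (subst_garden \<sigma>) \<Delta>. \<exists>\<tau>. opens (sprinkler \<delta>) \<tau> \<and>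
        \<tau> ` fset (sprinkler \<delta>) \<subseteq> V \<and> set_mset (subst \<tau> (body \<delta>)) \<subseteq> F))"

lemma perform_task:
  assumes F: "finite F" "theory_over V F" "\<not> derivable (T \<union> F) \<Psi>"
    and T: "theory_over V\<^sub>0 T" and V: "V\<^sub>0 \<union> U \<subseteq> V" "infinite U" "U \<inter> B = {}" "U \<inter> V\<^sub>0 = {}"
    and \<Psi>: "fragment \<Psi>"
  shows "\<exists>F'. (finite F' \<and> theory_over V F' \<and> \<not> derivable (T \<union> F') \<Psi>) \<and> F \<subseteq> F' \<and> performs V (T \<union> F) n F'"
proof (cases "\<exists>x \<Phi> \<Delta> \<sigma>. task n = ((x \<cdot> \<Phi>) \<rhd> \<Delta>, ({||} \<cdot> subst \<sigma> \<Phi>) \<rhd> image_mset (subst_garden \<sigma>) \<Delta>) \<and>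
     (x \<cdot> \<Phi>) \<rhd> \<Delta> \<in> T \<union> F \<and> opens x \<sigma> \<and> \<sigma> ` fset x \<subseteq> V \<and> derivable (T \<union> F) (subst \<sigma> \<Phi>)")
  case True
  then obtain x \<Phi> \<Delta> \<sigma> where
    n: "task n = ((x \<cdot> \<Phi>) \<rhd> \<Delta>, ({||} \<cdot> subst \<sigma> \<Phi>) \<rhd> image_mset (subst_garden \<sigma>) \<Delta>)"
    and \<phi>: "(x \<cdot> \<Phi>) \<rhd> \<Delta> \<in> T \<union> F" "opens x \<sigma>" "\<sigma> ` fset x \<subseteq> V" "derivable (T \<union> F) (subst \<sigma> \<Phi>)"
    by (elim exE conjE)
  from saturation_step[OF F T V \<Psi> \<phi>] obtain F' \<delta> \<tau> where
    F': "finite F'" "theory_over V F'" "\<not> derivable (T \<union> F') \<Psi>" "F \<subseteq> F'"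
    and \<delta>: "\<delta> \<in># image_mset (subst_garden \<sigma>) \<Delta>" "opens (sprinkler \<delta>) \<tau>" "\<tau> ` fset (sprinkler \<delta>) \<subseteq> V"
    "set_mset (subst \<tau> (body \<delta>)) \<subseteq> F'" .
  have "performs V (T \<union> F) n F'"
    unfolding performs_def
  proof (intro allI impI, elim conjE)
    fix x' \<Phi>' \<Delta>' \<sigma>'
    assume n': "task n = ((x' \<cdot> \<Phi>') \<rhd> \<Delta>', ({||} \<cdot> subst \<sigma>' \<Phi>') \<rhd> image_mset (subst_garden \<sigma>') \<Delta>')"
    \<comment> \<open>What \<open>performs\<close> promises depends on the substitution only through
      the instantiated petals. These are part of the task, so a petal added for
      \<open>\<sigma>\<close> serves every substitution with the same instance.\<close>
    have "image_mset (subst_garden \<sigma>') \<Delta>' = image_mset (subst_garden \<sigma>) \<Delta>"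
      using trans[OF n'[symmetric] n] unfolding prod.inject flower.inject by (elim conjE)
    with \<delta> show "\<exists>\<delta>\<in>#image_mset (subst_garden \<sigma>') \<Delta>'. \<exists>\<tau>. opens (sprinkler \<delta>) \<tau> \<and>
        \<tau> ` fset (sprinkler \<delta>) \<subseteq> V \<and> set_mset (subst \<tau> (body \<delta>)) \<subseteq> F'" by metis
  qed
  with F' show ?thesis by blast
next
  case False
  then have "performs V (T \<union> F) n F" unfolding performs_def by blast
  with F show ?thesis by blast
qed

lemma infinite_split:
  assumes "infinite (I :: 'v set)"
  obtains U where "U \<subseteq> I" "infinite U" "infinite (I - U)"
proof -
  obtain f :: "nat \<Rightarrow> 'v" where f: "inj f" "range f \<subseteq> I"
    using infinite_countable_subset[OF assms] by blast
  have inf: "infinite (f ` range g)" if "inj g" for g :: "nat \<Rightarrow> nat"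
    using that f(1) by (metis finite_imageD infinite_UNIV_nat inj_on_subset subset_UNIV)
  define U where "U = f ` range (\<lambda>n. 2 * n)"
  have "infinite U" unfolding U_def by (rule inf) (simp add: inj_def)
  moreover have "infinite (f ` range (\<lambda>n. 2 * n + 1))" by (rule inf) (simp add: inj_def)
  moreover have "f ` range (\<lambda>n. 2 * n + 1) \<subseteq> I - U"
  proof
    fix v assume "v \<in> f ` range (\<lambda>n. 2 * n + 1)"
    then obtain n where n: "v = f (2 * n + 1)" by blast
    have "v \<noteq> f (2 * m)" for m
    proof
      assume "v = f (2 * m)"
      then have "2 * n + 1 = 2 * m" unfolding n by (rule injD[OF f(1)])
      then show False by presburger
    qed
    with n f(2) show "v \<in> I - U" unfolding U_def by blast
  qed
  ultimately have "infinite (I - U)" using finite_subset by blast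
  moreover have "U \<subseteq> I" using f(2) unfolding U_def by blast
  ultimately show thesis using that \<open>infinite U\<close> by blast
qed

lemma saturated_extension:
  assumes V\<^sub>0: "V\<^sub>0 \<inter> B = {}" "infinite (- B - V\<^sub>0)" "V\<^sub>0 \<noteq> {}"
    and T: "theory_over V\<^sub>0 T" and \<Psi>: "fragment \<Psi>" and nd: "\<not> derivable T \<Psi>"
  obtains V T' where "V\<^sub>0 \<subseteq> V" "T \<subseteq> T'" "saturated V T'" "\<not> derivable T' \<Psi>"
proof -
  from infinite_split[OF V\<^sub>0(2)] obtain U where U: "U \<subseteq> - B - V\<^sub>0" "infinite U" "infinite (- B - V\<^sub>0 - U)" .
  define V where "V = V\<^sub>0 \<union> U"
  have V: "V\<^sub>0 \<union> U \<subseteq> V" "U \<inter> B = {}" "U \<inter> V\<^sub>0 = {}"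
    using U(1) unfolding V_def by blast+
  have "\<exists>F. \<forall>n. (finite (F n) \<and> theory_over V (F n) \<and> \<not> derivable (T \<union> F n) \<Psi>) \<and>
      (F n \<subseteq> F (Suc n) \<and> performs V (T \<union> F n) n (F (Suc n)))"
  proof (rule dependent_nat_choice)
    show "\<exists>F. finite F \<and> theory_over V F \<and> \<not> derivable (T \<union> F) \<Psi>"
      using nd by (intro exI[of _ "{}"]) (simp add: theory_over_def)
    fix F :: "('p, 'v) flower set" and n
    assume "finite F \<and> theory_over V F \<and> \<not> derivable (T \<union> F) \<Psi>"
    then show "\<exists>F'. (finite F' \<and> theory_over V F' \<and> \<not> derivable (T \<union> F') \<Psi>) \<and>
        (F \<subseteq> F' \<and> performs V (T \<union> F) n F')"
      using perform_task[OF _ _ _ T V(1) U(2) V(2,3) \<Psi>] by blast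
  qed
  then obtain F where F: "\<And>n. finite (F n)" "\<And>n. theory_over V (F n)" "\<And>n. \<not> derivable (T \<union> F n) \<Psi>"
    "\<And>n. F n \<subseteq> F (Suc n)" "\<And>n. performs V (T \<union> F n) n (F (Suc n))"
    by metis
  have mono: "F m \<subseteq> F n" if "m \<le> n" for m n
    using that F(4) by (rule lift_Suc_mono_le[rotated])
  define T' where "T' = T \<union> (\<Union>n. F n)"
  have sub: "\<exists>n. H \<subseteq> T \<union> F n" if "finite H" "H \<subseteq> T'" for H
    using that
  proof (induction H)
    case (insert \<phi> H)
    then obtain n where "H \<subseteq> T \<union> F n" by blast
    moreover from insert obtain m where "\<phi> \<in> T \<union> F m" unfolding T'_def by blast
    ultimately have "insert \<phi> H \<subseteq> T \<union> F (max m n)"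
      using mono[of m "max m n"] mono[of n "max m n"] by auto
    then show ?case ..
  qed simp
  have der: "\<exists>n. derivable (T \<union> F n) \<Theta>" if "derivable T' \<Theta>" for \<Theta>
    using that sub unfolding derivable_def by metis
  have "saturated V T'"
    unfolding saturated_def
  proof (intro conjI allI impI)
    show "V \<inter> B = {}" using V\<^sub>0(1) U(1) unfolding V_def by blast
    show "infinite (- B - V)" using U(3) unfolding V_def by (simp add: Diff_eq Int_assoc)
    show "V \<noteq> {}" using V\<^sub>0(3) unfolding V_def by blast
    show "theory_over V T'" using T F(2) V(1) unfolding T'_def theory_over_def by blast
    fix x \<Phi> \<Delta> \<sigma>
    assume *: "(x \<cdot> \<Phi>) \<rhd> \<Delta> \<in> T' \<and> opens x \<sigma> \<and> \<sigma> ` fset x \<subseteq> V \<and> derivable T' (subst \<sigma> \<Phi>)"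
    then obtain k where k: "derivable (T \<union> F k) (subst \<sigma> \<Phi>)" using der by blast
    from * obtain l where l: "(x \<cdot> \<Phi>) \<rhd> \<Delta> \<in> T \<union> F l" unfolding T'_def by blast
    \<comment> \<open>A stage that performs this very task after the pistil has become derivable and
      the flower has entered the theory.\<close>
    obtain n where n: "n \<ge> max k l"
      "task n = ((x \<cdot> \<Phi>) \<rhd> \<Delta>, ({||} \<cdot> subst \<sigma> \<Phi>) \<rhd> image_mset (subst_garden \<sigma>) \<Delta>)"
      using task_cofinal by blast
    have sub: "T \<union> F k \<subseteq> T \<union> F n" "T \<union> F l \<subseteq> T \<union> F n"
      using mono[of k n] mono[of l n] n(1) by auto
    have "derivable (T \<union> F n) (subst \<sigma> \<Phi>)" "(x \<cdot> \<Phi>) \<rhd> \<Delta> \<in> T \<union> F n"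
      using derivable_mono[OF k sub(1)] l sub(2) by blast+
    with n(2) * have "task n = ((x \<cdot> \<Phi>) \<rhd> \<Delta>, ({||} \<cdot> subst \<sigma> \<Phi>) \<rhd> image_mset (subst_garden \<sigma>) \<Delta>) \<and>
        (x \<cdot> \<Phi>) \<rhd> \<Delta> \<in> T \<union> F n \<and> opens x \<sigma> \<and> \<sigma> ` fset x \<subseteq> V \<and> derivable (T \<union> F n) (subst \<sigma> \<Phi>)"
      by (intro conjI) (elim conjE, assumption)+
    from F(5)[of n, unfolded performs_def, rule_format, OF this]
    obtain \<delta> \<tau> where \<delta>: "\<delta> \<in># image_mset (subst_garden \<sigma>) \<Delta>" "opens (sprinkler \<delta>) \<tau>"
      "\<tau> ` fset (sprinkler \<delta>) \<subseteq> V" "set_mset (subst \<tau> (body \<delta>)) \<subseteq> F (Suc n)"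
      by (elim bexE exE conjE)
    have "F (Suc n) \<subseteq> T'" unfolding T'_def by blast
    with \<delta>(4) have "set_mset (subst \<tau> (body \<delta>)) \<subseteq> T'" by (rule subset_trans)
    with \<delta>(2,3) show "\<exists>\<delta>\<in>#image_mset (subst_garden \<sigma>) \<Delta>. \<exists>\<tau>. opens (sprinkler \<delta>) \<tau> \<and>
        \<tau> ` fset (sprinkler \<delta>) \<subseteq> V \<and> set_mset (subst \<tau> (body \<delta>)) \<subseteq> T'"
      by (intro bexI[OF _ \<delta>(1)] exI[of _ \<tau>]) simp
  qed
  moreover have "\<not> derivable T' \<Psi>" using der F(3) by blast
  ultimately show thesis using that V(1) unfolding T'_def by blast
qed

end


section \<open>Forcing, variables and renamings\<close>

lemma forces_flower_cong:
    "(\<And>v. v \<in> fv_flower \<phi> \<Longrightarrow> e v = e' v) \<Longrightarrow> forces_flower K w e \<phi> \<longleftrightarrow> forces_flower K w e' \<phi>"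
  and forces_body_cong:
    "(\<And>v. v \<in> fv (body \<gamma>) \<Longrightarrow> e v = e' v) \<Longrightarrow> forces_body K w e \<gamma> \<longleftrightarrow> forces_body K w e' \<gamma>"
  for \<phi> :: "('p, 'v) flower" and \<gamma> :: "('p, 'v) garden"
proof (induction \<phi> and \<gamma> arbitrary: w e e' and w e e')
  case (Atom p xs)
  then have "map e xs = map e' xs" by simp
  then show ?case by (simp only: forces_flower.simps)
next
  case (Flower \<gamma> \<Delta>)
  let ?X = "fset (sprinkler \<gamma>)"
  have fv\<gamma>: "v \<in> fv_flower (\<gamma> \<rhd> \<Delta>)" if "v \<in> fv (body \<gamma>)" "v \<notin> ?X" for v
    using that by (cases \<gamma>) simp
  have fv\<delta>: "v \<in> fv_flower (\<gamma> \<rhd> \<Delta>)" if "\<delta> \<in># \<Delta>" "v \<in> fv (body \<delta>)" "v \<notin> ?X" "v \<notin> fset (sprinkler \<delta>)" for v \<delta>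
  proof -
    have "v \<in> fv_garden \<delta>" using that(2,4) by (cases \<delta>) simp
    then show ?thesis by (rule fv_petal[OF that(1) _ that(3)])
  qed
  have "forces_body K w' (override_on e e0 ?X) \<gamma> \<longleftrightarrow> forces_body K w' (override_on e' e0 ?X) \<gamma>" for w' e0
    using Flower(3) fv\<gamma> by (intro Flower(1)) (simp add: override_on_def)
  moreover have "forces_body K w' (override_on (override_on e e0 ?X) e1 (fset (sprinkler \<delta>))) \<delta>
      \<longleftrightarrow> forces_body K w' (override_on (override_on e' e0 ?X) e1 (fset (sprinkler \<delta>))) \<delta>"
    if "\<delta> \<in># \<Delta>" for w' e0 e1 \<delta>
    using Flower(3) fv\<delta>[OF that] by (intro Flower(2)[OF that]) (simp add: override_on_def)
  ultimately show ?case
    by (simp only: forces_flower.simps cong: bex_cong)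
next
  case (Garden x \<Phi>)
  have "forces_flower K w e \<phi> \<longleftrightarrow> forces_flower K w e' \<phi>" if "\<phi> \<in># \<Phi>" for \<phi>
    using Garden(2) fv_mono[OF that] by (intro Garden(1)[OF that]) auto
  then show ?case by simp
qed

lemma bex_image: "(\<exists>y\<in>f ` A. R y) \<longleftrightarrow> (\<exists>x\<in>A. R (f x))"
  by blast

lemma override_on_image_comp:
  "inj \<rho> \<Longrightarrow> override_on e e' (\<rho> ` X) \<circ> \<rho> = override_on (e \<circ> \<rho>) (e' \<circ> \<rho>) X"
  by (auto simp: override_on_def fun_eq_iff inj_image_mem_iff)

text \<open>Renaming a flower amounts to composing the evaluation with \<open>\<rho>\<close>. The
  quantifiers over evaluations agree because \<open>e0 \<circ> \<rho>\<close> runs through all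
  evaluations at a world when \<open>e0\<close> does; the facts \<open>ex\<close> and
  \<open>all\<close> express this.\<close>

lemma forces_map_flower:
    "bij \<rho> \<Longrightarrow> forces_flower K w e (map_flower id \<rho> \<phi>) \<longleftrightarrow> forces_flower K w (e \<circ> \<rho>) \<phi>"
  and forces_map_garden:
    "bij \<rho> \<Longrightarrow> forces_body K w e (map_garden id \<rho> \<gamma>) \<longleftrightarrow> forces_body K w (e \<circ> \<rho>) \<gamma>"
  for \<phi> :: "('p, 'v) flower" and \<gamma> :: "('p, 'v) garden"
proof (induction \<phi> and \<gamma> arbitrary: w e and w e)
  case (Flower \<gamma> \<Delta>)
  let ?X = "fset (sprinkler \<gamma>)"
  have inj: "inj \<rho>" using Flower(3) by (rule bij_is_inj)
  have spr: "fset (sprinkler (map_garden id \<rho> \<delta>)) = \<rho> ` fset (sprinkler \<delta>)" for \<delta> :: "('p, 'v) garden"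
    by (cases \<delta>) simp
  have ev: "evaluation K w' (e0 \<circ> \<rho>) \<longleftrightarrow> evaluation K w' e0" for w' e0
    using bij_is_surj[OF Flower(3)] by (metis evaluation_def image_comp)
  have ex: "(\<exists>e0. evaluation K w' e0 \<and> P (e0 \<circ> \<rho>)) \<longleftrightarrow> (\<exists>e0. evaluation K w' e0 \<and> P e0)" for w' P
  proof
    assume "\<exists>e0. evaluation K w' e0 \<and> P e0"
    then obtain e0 where e0: "evaluation K w' e0" "P e0" by blast
    have "e0 \<circ> inv \<rho> \<circ> \<rho> = e0"
      using inj by (simp add: fun_eq_iff)
    with e0 ev[of w' "e0 \<circ> inv \<rho>"] show "\<exists>e0. evaluation K w' e0 \<and> P (e0 \<circ> \<rho>)"
      by (intro exI[of _ "e0 \<circ> inv \<rho>"]) simp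
  qed (use ev in blast)
  have all: "(\<forall>e0. R w' \<and> evaluation K w' e0 \<and> P (e0 \<circ> \<rho>) \<longrightarrow> Q (e0 \<circ> \<rho>))
      \<longleftrightarrow> (\<forall>e0. R w' \<and> evaluation K w' e0 \<and> P e0 \<longrightarrow> Q e0)" for w' R P Q
    using ex[of w' "\<lambda>e. P e \<and> \<not> Q e"] by blast
  define P where "P w' e0 \<longleftrightarrow> forces_body K w' (override_on (e \<circ> \<rho>) e0 ?X) \<gamma>" for w' e0
  define Q where "Q w' e0 \<longleftrightarrow> (\<exists>\<delta>\<in>set_mset \<Delta>. \<exists>e1. evaluation K w' e1 \<and>
      forces_body K w' (override_on (override_on (e \<circ> \<rho>) e0 ?X) e1 (fset (sprinkler \<delta>))) \<delta>)" for w' e0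
  have 1: "forces_body K w' (override_on e e0 (\<rho> ` ?X)) (map_garden id \<rho> \<gamma>) \<longleftrightarrow> P w' (e0 \<circ> \<rho>)" for w' e0
    unfolding Flower(1)[OF Flower(3)] override_on_image_comp[OF inj] P_def ..
  have 2: "(\<exists>\<delta>\<in>set_mset (image_mset (map_garden id \<rho>) \<Delta>). \<exists>e1. evaluation K w' e1 \<and>
      forces_body K w' (override_on (override_on e e0 (\<rho> ` ?X)) e1 (fset (sprinkler \<delta>))) \<delta>) \<longleftrightarrow> Q w' (e0 \<circ> \<rho>)"
    for w' e0
  proof -
    have "(\<exists>e1. evaluation K w' e1 \<and> forces_body K w'
        (override_on (override_on e e0 (\<rho> ` ?X)) e1 (fset (sprinkler (map_garden id \<rho> \<delta>)))) (map_garden id \<rho> \<delta>))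
      \<longleftrightarrow> (\<exists>e1. evaluation K w' e1 \<and> forces_body K w'
        (override_on (override_on (e \<circ> \<rho>) (e0 \<circ> \<rho>) ?X) e1 (fset (sprinkler \<delta>))) \<delta>)" if "\<delta> \<in># \<Delta>" for \<delta>
      unfolding spr Flower(2)[OF that Flower(3)] override_on_image_comp[OF inj]
      by (rule ex)
    note eq = this
    show ?thesis unfolding Q_def set_image_mset bex_image by (rule bex_cong[OF refl eq])
  qed
  have "forces_flower K w e (map_flower id \<rho> (\<gamma> \<rhd> \<Delta>)) \<longleftrightarrow>
      (\<forall>w' e0. (w, w') \<in> accessible K \<and> evaluation K w' e0 \<and> P w' (e0 \<circ> \<rho>) \<longrightarrow> Q w' (e0 \<circ> \<rho>))"
    unfolding flower.map forces_flower.simps spr 1 2 ..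
  also have "\<dots> \<longleftrightarrow> (\<forall>w' e0. (w, w') \<in> accessible K \<and> evaluation K w' e0 \<and> P w' e0 \<longrightarrow> Q w' e0)"
    using all[of "\<lambda>w'. (w, w') \<in> accessible K"] by blast
  also have "\<dots> \<longleftrightarrow> forces_flower K w (e \<circ> \<rho>) (\<gamma> \<rhd> \<Delta>)"
    unfolding forces_flower.simps P_def Q_def ..
  finally show ?case .
qed auto

lemma forces_rename:
  assumes "bij \<rho>" "\<And>v. v \<in> fv \<Phi> \<Longrightarrow> \<rho> v = v"
  shows "forces K w e (map_bouquet \<rho> \<Phi>) \<longleftrightarrow> forces K w e \<Phi>"
proof -
  have "forces_flower K w e (map_flower id \<rho> \<phi>) \<longleftrightarrow> forces_flower K w e \<phi>" if "\<phi> \<in># \<Phi>" for \<phi>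
    unfolding forces_map_flower[OF assms(1)]
    using assms(2) fv_mono[OF that] by (intro forces_flower_cong) auto
  then show ?thesis by (simp add: forces_def)
qed


section \<open>The canonical model\<close>

context countable_sequent
begin

text \<open>A world records its parameters besides its theory, since a theory does not determine
  them. Both are packed into one set of numbers through a disjoint sum, to obtain worlds of type
  \<open>nat set\<close>.\<close>

definition encode :: "'v set \<Rightarrow> ('p, 'v) flower set \<Rightarrow> nat set" where
  "encode V T = to_nat ` (Inl ` V \<union> Inr ` T :: ('v + ('p, 'v) flower) set)"

definition params :: "nat set \<Rightarrow> 'v set" where
  "params w = {v. to_nat (Inl v :: 'v + ('p, 'v) flower) \<in> w}"

definition facts :: "nat set \<Rightarrow> ('p, 'v) flower set" where
  "facts w = {\<phi>. to_nat (Inr \<phi> :: 'v + ('p, 'v) flower) \<in> w}"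

lemma params_encode [simp]: "params (encode V T) = V"
  and facts_encode [simp]: "facts (encode V T) = T"
  by (auto simp: params_def facts_def encode_def)

text \<open>Atoms are interpreted by derivability rather than membership, as a saturated theory need
  not contain what it derives.\<close>

definition canonical :: "(nat set, nat, 'p) kripke" where
  "canonical = \<lparr>
     worlds = {w. saturated (params w) (facts w)},
     accessible = {(w, w'). saturated (params w) (facts w) \<and> saturated (params w') (facts w') \<and>
       params w \<subseteq> params w' \<and> facts w \<subseteq> facts w'},
     domain = (\<lambda>w. to_nat ` params w),
     interp = (\<lambda>w p. {map to_nat xs | xs. length xs = ar p \<and> set xs \<subseteq> params w \<and>
       derivable (facts w) {#Atom p xs#}})\<rparr>"

lemma canonical_simps:
  "w \<in> worlds canonical \<longleftrightarrow> saturated (params w) (facts w)"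
  "(w, w') \<in> accessible canonical \<longleftrightarrow> saturated (params w) (facts w) \<and> saturated (params w') (facts w') \<and>
     params w \<subseteq> params w' \<and> facts w \<subseteq> facts w'"
  "domain canonical w = to_nat ` params w"
  "interp canonical w p = {map to_nat xs | xs. length xs = ar p \<and> set xs \<subseteq> params w \<and>
       derivable (facts w) {#Atom p xs#}}"
  by (simp_all add: canonical_def)

lemma kripke_canonical: "kripke_structure ar canonical"
  unfolding kripke_structure_def
proof (intro conjI ballI)
  show "preorder_on (worlds canonical) (accessible canonical)"
    unfolding preorder_on_def refl_on_def trans_def by (auto simp: canonical_simps)
  show "domain canonical w \<noteq> {}" if "w \<in> worlds canonical" for w
    using that by (simp add: canonical_simps saturated_def)
  show "\<forall>p. interp canonical w p \<subseteq> {ds. length ds = ar p \<and> set ds \<subseteq> domain canonical w}" for w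
  proof (intro allI subsetI)
    fix p ds assume "ds \<in> interp canonical w p"
    then obtain xs where xs: "ds = map to_nat xs" "length xs = ar p" "set xs \<subseteq> params w"
      unfolding canonical_simps by blast
    from image_mono[OF xs(3)] show "ds \<in> {ds. length ds = ar p \<and> set ds \<subseteq> domain canonical w}"
      unfolding canonical_simps by (simp add: xs)
  qed
  fix z assume "z \<in> accessible canonical"
  then obtain w w' where z: "z = (w, w')" "params w \<subseteq> params w'" "facts w \<subseteq> facts w'"
    by (cases z) (auto simp: canonical_simps)
  have "interp canonical w p \<subseteq> interp canonical w' p" for p
    using z(2,3) derivable_mono unfolding canonical_simps by blast
  with z(2) show "case z of (w, w') \<Rightarrow> domain canonical w \<subseteq> domain canonical w' \<and>
      (\<forall>p. interp canonical w p \<subseteq> interp canonical w' p)"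
    unfolding z(1) by (auto simp: canonical_simps(3))
qed

section \<open>Evaluations as substitutions, and the truth lemma\<close>

abbreviation subst_of :: "('v \<Rightarrow> nat) \<Rightarrow> 'v \<Rightarrow> 'v" where
  "subst_of e \<equiv> from_nat \<circ> e"

lemma evaluationD:
  assumes "evaluation canonical w e"
  shows "subst_of e v \<in> params w" "to_nat (subst_of e v) = e v"
proof -
  have "e v \<in> to_nat ` params w"
    using assms by (auto simp: evaluation_def canonical_simps)
  then show "subst_of e v \<in> params w" "to_nat (subst_of e v) = e v" by auto
qed

lemma evaluation_to_nat: "(\<And>v. s v \<in> params w) \<Longrightarrow> evaluation canonical w (\<lambda>v. to_nat (s v))"
  by (auto simp: evaluation_def canonical_simps)

lemma evaluation_override:
  "evaluation canonical w e \<Longrightarrow> evaluation canonical w e' \<Longrightarrow> evaluation canonical w (override_on e e' X)"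
  by (auto simp: evaluation_def override_on_def split: if_splits)

lemma evaluation_mono:
  "evaluation canonical w e \<Longrightarrow> (w, w') \<in> accessible canonical \<Longrightarrow> evaluation canonical w' e"
  unfolding evaluation_def canonical_simps by blast

lemma subst_of_override: "subst_of (override_on e e' X) = override_on (subst_of e) (subst_of e') X"
  by (auto simp: override_on_def fun_eq_iff)

lemma saturated_params: "saturated (params w) (facts w) \<Longrightarrow> params w \<inter> B = {}"
  by (simp add: saturated_def)

lemma opens_override:
  assumes "\<And>v. v |\<in>| x \<Longrightarrow> s v \<notin> B"
  shows "opens x (override_on id s (fset x))"
  using assms by (auto simp: opens_def override_on_def)

lemma override_comp_without:
  assumes "fset x \<subseteq> B" "\<And>v. s v \<notin> B"
  shows "override_on id s' (fset x) \<circ> without s (fset x) = override_on s s' (fset x)"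
proof
  fix v
  have "s v |\<notin>| x" using assms by blast
  then show "(override_on id s' (fset x) \<circ> without s (fset x)) v = override_on s s' (fset x) v"
    by (cases "v |\<in>| x") simp_all
qed

lemma without_B:
  assumes "\<And>v. s v \<notin> B"
  shows "without s X v = v \<or> without s X v \<notin> B"
  using assms by (cases "v \<in> X") simp_all

text \<open>Substituting below a sprinkler and then opening it is one simultaneous substitution.
  This mirrors the updated evaluation \<open>override_on e e' (fset x)\<close> in the forcing
  clause.\<close>

lemma subst_open:
  assumes "fset x \<subseteq> B" "\<And>v. s v \<notin> B" "bv \<Phi> \<subseteq> B"
  shows "subst (override_on id s' (fset x)) (subst (without s (fset x)) \<Phi>)
    = subst (override_on s s' (fset x)) \<Phi>"
proof -
  have "without s (fset x) v = v \<or> without s (fset x) v \<notin> B" for v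
    by (rule without_B[OF assms(2)])
  from subst_subst[OF assms(3) this, of "override_on id s' (fset x)"] show ?thesis
    unfolding override_comp_without[OF assms(1,2)] .
qed

lemma subst_open_garden:
  assumes "fset x \<subseteq> B" "\<And>v. s v \<notin> B" "bv_garden \<delta> \<subseteq> B"
  shows "subst_garden (override_on id s' (fset x)) (subst_garden (without s (fset x)) \<delta>)
    = subst_garden (override_on s s' (fset x)) \<delta>"
proof -
  have "without s (fset x) v = v \<or> without s (fset x) v \<notin> B" for v
    by (rule without_B[OF assms(2)])
  from subst_subst_garden[OF assms(3) this, of "override_on id s' (fset x)"] show ?thesis
    unfolding override_comp_without[OF assms(1,2)] .
qed

lemma fragment_subst_params:
  assumes "wf_flower ar \<phi>" "distinct_mset (binders_flower \<phi>)" "bv_flower \<phi> \<subseteq> B" "\<And>v. s v \<notin> B"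
  shows "fragment {#subst_flower s \<phi>#}"
proof -
  have fv: "fv_flower (subst_flower s \<phi>) \<inter> B = {}"
    using fv_subst_flower[of s \<phi>] assms(4) by blast
  have "bv_flower \<phi> \<inter> fv_flower (subst_flower s \<phi>) = {}"
    using fv assms(3) by blast
  with fv show ?thesis
    using assms(1-3) by (simp add: fragment_def is_bouquet_iff)
qed

text \<open>Two implications instead of an equivalence, since membership in a saturated theory is
  stronger than derivability. They support each other in the induction: each direction for a flower
  uses one of them for its pistil and the other for its petals.\<close>

definition truth :: "('p, 'v) flower \<Rightarrow> bool" where
  "truth \<phi> \<longleftrightarrow> wf_flower ar \<phi> \<and> distinct_mset (binders_flower \<phi>) \<and> bv_flower \<phi> \<subseteq> B \<longrightarrow>
     (\<forall>w e. saturated (params w) (facts w) \<and> evaluation canonical w e \<longrightarrow>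
        (subst_flower (subst_of e) \<phi> \<in> facts w \<longrightarrow> forces_flower canonical w e \<phi>) \<and>
        (forces_flower canonical w e \<phi> \<longrightarrow> derivable (facts w) {#subst_flower (subst_of e) \<phi>#}))"

lemma truthD:
  assumes "truth \<phi>" "wf_flower ar \<phi>" "distinct_mset (binders_flower \<phi>)" "bv_flower \<phi> \<subseteq> B"
    "saturated (params w) (facts w)" "evaluation canonical w e"
  shows "subst_flower (subst_of e) \<phi> \<in> facts w \<Longrightarrow> forces_flower canonical w e \<phi>"
    and "forces_flower canonical w e \<phi> \<Longrightarrow> derivable (facts w) {#subst_flower (subst_of e) \<phi>#}"
  using assms unfolding truth_def by blast+

lemma truth_body:
  assumes "\<And>\<phi>. \<phi> \<in># \<Phi> \<Longrightarrow> truth \<phi>" "wf ar \<Phi>" "distinct_mset (binders \<Phi>)" "bv \<Phi> \<subseteq> B"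
    "saturated (params w) (facts w)" "evaluation canonical w e"
  shows "set_mset (subst (subst_of e) \<Phi>) \<subseteq> facts w \<Longrightarrow> forces_body canonical w e (x \<cdot> \<Phi>)"
    and "forces_body canonical w e (x \<cdot> \<Phi>) \<Longrightarrow> derivable (facts w) (subst (subst_of e) \<Phi>)"
proof -
  have *: "wf_flower ar \<phi>" "distinct_mset (binders_flower \<phi>)" "bv_flower \<phi> \<subseteq> B" if "\<phi> \<in># \<Phi>" for \<phi>
    using assms(2-4) that distinct_binders_submset[OF that] bv_mono[OF that] by blast+
  show "forces_body canonical w e (x \<cdot> \<Phi>)" if "set_mset (subst (subst_of e) \<Phi>) \<subseteq> facts w"
    unfolding forces_body.simps
  proof
    fix \<phi> assume \<phi>: "\<phi> \<in># \<Phi>"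
    then have "subst_flower (subst_of e) \<phi> \<in> facts w" using that by auto
    then show "forces_flower canonical w e \<phi>"
      by (rule truthD(1)[OF assms(1)[OF \<phi>] *[OF \<phi>] assms(5,6)])
  qed
  show "derivable (facts w) (subst (subst_of e) \<Phi>)" if "forces_body canonical w e (x \<cdot> \<Phi>)"
  proof (rule derivable_bouquet)
    fix \<psi> assume "\<psi> \<in># subst (subst_of e) \<Phi>"
    then obtain \<phi> where \<phi>: "\<phi> \<in># \<Phi>" "\<psi> = subst_flower (subst_of e) \<phi>" by auto
    have "forces_flower canonical w e \<phi>" using that \<phi>(1) by simp
    then show "derivable (facts w) {#\<psi>#}"
      unfolding \<phi>(2) by (rule truthD(2)[OF assms(1)[OF \<phi>(1)] *[OF \<phi>(1)] assms(5,6)])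
  next
    show "wf ar (subst (subst_of e) \<Phi>)" using assms(2) by simp
    have "subst_of e v \<notin> B" for v
      using evaluationD(1)[OF assms(6)] saturated_params[OF assms(5)] by blast
    with fv_subst[of "subst_of e" \<Phi>] show "fv (subst (subst_of e) \<Phi>) \<inter> B = {}" by blast
  qed
qed

lemma truth_atom: "truth (Atom p xs)"
  unfolding truth_def
proof (intro impI allI, elim conjE)
  fix w and e :: "'v \<Rightarrow> nat"
  assume wf: "wf_flower ar (Atom p xs :: ('p, 'v) flower)" and e: "evaluation canonical w e"
  have map: "map to_nat (map (subst_of e) xs) = map e xs"
    using evaluationD(2)[OF e] by simp
  have set: "set (map (subst_of e) xs) \<subseteq> params w"
    using evaluationD(1)[OF e] by auto
  show "(subst_flower (subst_of e) (Atom p xs) \<in> facts w \<longrightarrow> forces_flower canonical w e (Atom p xs)) \<and>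
    (forces_flower canonical w e (Atom p xs) \<longrightarrow> derivable (facts w) {#subst_flower (subst_of e) (Atom p xs)#})"
    unfolding subst_flower.simps
  proof (intro conjI impI)
    assume "Atom p (map (subst_of e) xs) \<in> facts w"
    then have "derivable (facts w) {#Atom p (map (subst_of e) xs)#}"
      using wf by (intro derivable_assm) simp_all
    with wf set show "forces_flower canonical w e (Atom p xs)"
      unfolding forces_flower.simps canonical_simps map[symmetric]
      by (intro CollectI exI[of _ "map (subst_of e) xs"] conjI) simp_all
  next
    assume "forces_flower canonical w e (Atom p xs)"
    then obtain ys where ys: "map e xs = map to_nat ys" "derivable (facts w) {#Atom p ys#}"
      unfolding forces_flower.simps canonical_simps by blast
    have "map to_nat (map (subst_of e) xs) = map to_nat ys" unfolding map ys(1) ..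
    then have "map (subst_of e) xs = ys"
      by (rule map_injective) (rule inj_to_nat)
    with ys(2) show "derivable (facts w) {#Atom p (map (subst_of e) xs)#}" by simp
  qed
qed

lemma truth_flower:
  assumes IH\<Phi>: "\<And>\<phi>. \<phi> \<in># \<Phi> \<Longrightarrow> truth \<phi>"
    and IH\<Delta>: "\<And>\<delta> \<phi>. \<delta> \<in># \<Delta> \<Longrightarrow> \<phi> \<in># body \<delta> \<Longrightarrow> truth \<phi>"
  shows "truth ((x \<cdot> \<Phi>) \<rhd> \<Delta>)"
  unfolding truth_def
proof (intro impI allI, elim conjE)
  fix w and e :: "'v \<Rightarrow> nat"
  let ?\<phi> = "(x \<cdot> \<Phi>) \<rhd> \<Delta>"
  assume wf: "wf_flower ar ?\<phi>" and dist: "distinct_mset (binders_flower ?\<phi>)" and bv: "bv_flower ?\<phi> \<subseteq> B"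
    and sat: "saturated (params w) (facts w)" and e: "evaluation canonical w e"
  define s where "s = subst_of e"
  have s: "s v \<in> params w" "s v \<notin> B" for v
    using evaluationD(1)[OF e] saturated_params[OF sat] unfolding s_def by blast+
  have x: "fset x \<subseteq> B" using bv by simp
  have \<Phi>: "wf ar \<Phi>" "distinct_mset (binders \<Phi>)" "bv \<Phi> \<subseteq> B"
    using wf dist bv by simp_all
  have \<Delta>: "wf ar (body \<delta>)" "distinct_mset (binders (body \<delta>))" "bv_garden \<delta> \<subseteq> B"
    "bv (body \<delta>) \<subseteq> B" "fset (sprinkler \<delta>) \<subseteq> B" if "\<delta> \<in># \<Delta>" for \<delta>
  proof -
    obtain y \<Psi> where \<delta>: "\<delta> = y \<cdot> \<Psi>" by (cases \<delta>)
    have "distinct_mset (binders_garden \<delta>)"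
      using dist that unfolding binders_flower.simps distinct_mset_add by (blast intro: distinct_binders_petal)
    then show "distinct_mset (binders (body \<delta>))" unfolding \<delta> by simp
    have "wf_garden ar \<delta>" using wf that by simp
    then show "wf ar (body \<delta>)" unfolding \<delta> by simp
    show "bv_garden \<delta> \<subseteq> B" using bv that by auto
    then show "bv (body \<delta>) \<subseteq> B" "fset (sprinkler \<delta>) \<subseteq> B" unfolding \<delta> by simp_all
  qed
  let ?sx = "without s (fset x)"
  have s\<phi>: "subst_flower s ?\<phi> = (x \<cdot> subst ?sx \<Phi>) \<rhd> image_mset (subst_garden ?sx) \<Delta>" by simp
  have frag: "fragment {#(x \<cdot> subst ?sx \<Phi>) \<rhd> image_mset (subst_garden ?sx) \<Delta>#}"
    unfolding s\<phi>[symmetric] by (rule fragment_subst_params[OF wf dist bv s(2)])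
  have petal: "subst_garden (override_on id s' (fset x)) (subst_garden ?sx \<delta>)
      = sprinkler \<delta> \<cdot> subst (without (override_on s s' (fset x)) (fset (sprinkler \<delta>))) (body \<delta>)"
    if "\<delta> \<in># \<Delta>" for s' \<delta>
    using subst_open_garden[OF x s(2) \<Delta>(3)[OF that]] by (cases \<delta>) simp
  show "(subst_flower (subst_of e) ?\<phi> \<in> facts w \<longrightarrow> forces_flower canonical w e ?\<phi>) \<and>
      (forces_flower canonical w e ?\<phi> \<longrightarrow> derivable (facts w) {#subst_flower (subst_of e) ?\<phi>#})"
    unfolding s_def[symmetric] s\<phi>
  proof (intro conjI impI)
    assume \<phi>: "(x \<cdot> subst ?sx \<Phi>) \<rhd> image_mset (subst_garden ?sx) \<Delta> \<in> facts w"
    show "forces_flower canonical w e ?\<phi>"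
      unfolding forces_flower.simps garden.sel
    proof (intro allI impI, elim conjE)
      fix w' e'
      let ?e1 = "override_on e e' (fset x)"
      assume acc: "(w, w') \<in> accessible canonical" and e': "evaluation canonical w' e'"
        and forces: "forces_body canonical w' ?e1 (x \<cdot> \<Phi>)"
      have sat': "saturated (params w') (facts w')" and sub: "facts w \<subseteq> facts w'"
        using acc by (simp_all add: canonical_simps)
      have e1: "evaluation canonical w' ?e1"
        by (rule evaluation_override[OF evaluation_mono[OF e acc] e'])
      define s' where "s' = subst_of e'"
      have s': "s' v \<in> params w'" "s' v \<notin> B" for v
        using evaluationD(1)[OF e'] saturated_params[OF sat'] unfolding s'_def by blast+
      define s1 where "s1 = override_on s s' (fset x)"
      have s1: "subst_of ?e1 = s1" unfolding subst_of_override s_def s'_def s1_def ..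
      have s1B: "s1 v \<notin> B" for v using s s' by (simp add: s1_def override_on_def)
      let ?\<sigma> = "override_on id s' (fset x)"
      have opens: "opens x ?\<sigma>" using s'(2) by (intro opens_override)
      have "?\<sigma> ` fset x \<subseteq> params w'" using s'(1) by auto
      \<comment> \<open>A forced pistil is derivable, so saturation of \<open>w'\<close> supplies a
        petal with witnesses \<open>\<tau>\<close> whose body belongs to \<open>facts w'\<close> and
        is therefore forced.\<close>
      moreover have "derivable (facts w') (subst ?\<sigma> (subst ?sx \<Phi>))"
        using truth_body(2)[OF IH\<Phi> \<Phi> sat' e1 forces]
        unfolding s1 s1_def subst_open[OF x s(2) \<Phi>(3)] .
      ultimately obtain \<delta>1 \<tau> where \<delta>1: "\<delta>1 \<in># image_mset (subst_garden ?\<sigma>) (image_mset (subst_garden ?sx) \<Delta>)"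
        and \<tau>: "opens (sprinkler \<delta>1) \<tau>" "\<tau> ` fset (sprinkler \<delta>1) \<subseteq> params w'"
        "set_mset (subst \<tau> (body \<delta>1)) \<subseteq> facts w'"
        using sat' \<phi> sub opens unfolding saturated_def by blast
      from \<delta>1 obtain \<delta> where \<delta>: "\<delta> \<in># \<Delta>" "\<delta>1 = subst_garden ?\<sigma> (subst_garden ?sx \<delta>)" by auto
      let ?Y = "fset (sprinkler \<delta>)"
      have \<delta>1': "sprinkler \<delta>1 = sprinkler \<delta>" "body \<delta>1 = subst (without s1 ?Y) (body \<delta>)"
        unfolding \<delta>(2) petal[OF \<delta>(1)] s1_def by simp_all
      \<comment> \<open>The witnesses as an evaluation. Its values off the petal's sprinkler are
        never read and only have to lie in the domain.\<close>
      define e'' where "e'' = (\<lambda>v. to_nat (if v \<in> ?Y then \<tau> v else s' v))"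
      have e'': "evaluation canonical w' e''"
        unfolding e''_def using \<tau>(2) s'(1) \<delta>1'(1) by (intro evaluation_to_nat) auto
      have \<tau>e: "\<tau> = override_on id (subst_of e'') ?Y"
        using \<tau>(1) \<delta>1'(1) by (auto simp: opens_def fun_eq_iff override_on_def e''_def)
      have "subst \<tau> (body \<delta>1) = subst (override_on s1 (subst_of e'') ?Y) (body \<delta>)"
        unfolding \<delta>1'(2) \<tau>e by (rule subst_open[OF \<Delta>(5)[OF \<delta>(1)] s1B \<Delta>(4)[OF \<delta>(1)]])
      also have "override_on s1 (subst_of e'') ?Y = subst_of (override_on ?e1 e'' ?Y)"
        unfolding subst_of_override[of ?e1] s1 ..
      finally have eq: "subst \<tau> (body \<delta>1) = subst (subst_of (override_on ?e1 e'' ?Y)) (body \<delta>)" .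
      have "set_mset (subst (subst_of (override_on ?e1 e'' ?Y)) (body \<delta>)) \<subseteq> facts w'"
        unfolding eq[symmetric] by (rule \<tau>(3))
      from truth_body(1)[OF IH\<Delta>[OF \<delta>(1)] \<Delta>(1,2,4)[OF \<delta>(1)] sat' evaluation_override[OF e1 e''] this,
          of "sprinkler \<delta>"]
      have "forces_body canonical w' (override_on ?e1 e'' ?Y) \<delta>" by simp
      with \<delta>(1) e'' show "\<exists>\<delta>\<in>#\<Delta>. \<exists>e''. evaluation canonical w' e'' \<and>
          forces_body canonical w' (override_on ?e1 e'' (fset (sprinkler \<delta>))) \<delta>"
        by blast
    qed
  next
    assume forces: "forces_flower canonical w e ?\<phi>"
    show "derivable (facts w) {#(x \<cdot> subst ?sx \<Phi>) \<rhd> image_mset (subst_garden ?sx) \<Delta>#}"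
    \<comment> \<open>A flower that is not derivable is refuted above \<open>w\<close>, at a world
      that contains the opened pistil and does not derive
      \<open>unit_garden \<rhd> ?\<Delta>1\<close>. A petal forced there would be derivable and
      would yield that flower.\<close>
    proof (rule ccontr)
      assume nd: "\<not> derivable (facts w) {#(x \<cdot> subst ?sx \<Phi>) \<rhd> image_mset (subst_garden ?sx) \<Delta>#}"
      have V: "params w \<inter> B = {}" "infinite (- B - params w)" "theory_over (params w) (facts w)"
        using sat by (simp_all add: saturated_def)
      have fv\<phi>: "fv_flower ((x \<cdot> subst ?sx \<Phi>) \<rhd> image_mset (subst_garden ?sx) \<Delta>) \<subseteq> params w"
      proof -
        have "s ` fv_flower ?\<phi> \<subseteq> params w" using s(1) by (rule image_subsetI)
        with fv_subst_flower[of s ?\<phi>] show ?thesis unfolding s\<phi> by (rule subset_trans)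
      qed
      have "(- B - params w) \<inter> B = {}" by blast
      \<comment> \<open>Saturation has left infinitely many parameters outside
        \<open>params w\<close>; the eigenvariables come from them.\<close>
      from fresh_opens[OF V(2) this finite.emptyI, of x] obtain \<tau> where
        \<tau>: "opens x \<tau>" "inj_on \<tau> (fset x)" "\<tau> ` fset x \<subseteq> - B - params w - {}" .
      define V1 where "V1 = params w \<union> \<tau> ` fset x"
      define T1 where "T1 = facts w \<union> set_mset (subst \<tau> (subst ?sx \<Phi>))"
      let ?\<Delta>1 = "image_mset (subst_garden \<tau>) (image_mset (subst_garden ?sx) \<Delta>)"
      have nd1: "\<not> derivable T1 {#unit_garden \<rhd> ?\<Delta>1#}"
      proof
        assume "derivable T1 {#unit_garden \<rhd> ?\<Delta>1#}"
        then have "derivable (facts w) {#(x \<cdot> subst ?sx \<Phi>) \<rhd> image_mset (subst_garden ?sx) \<Delta>#}"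
          unfolding T1_def using \<tau>(3) by (intro derivable_flower[OF frag V(3) fv\<phi> \<tau>(1,2)]) blast
        with nd show False ..
      qed
      have fraginst: "fragment {#({||} \<cdot> subst \<tau> (subst ?sx \<Phi>)) \<rhd> ?\<Delta>1#}"
        by (rule fragment_instance[OF frag \<tau>(1)])
      note frag1 = fragment_unit[OF fraginst]
      have "fv (subst ?sx \<Phi>) - fset x \<subseteq> fv_flower ((x \<cdot> subst ?sx \<Phi>) \<rhd> image_mset (subst_garden ?sx) \<Delta>)"
        by (simp only: fv_flower.simps fv_garden_eq Un_upper1)
      then have fvV1: "fv (subst ?sx \<Phi>) - fset x \<subseteq> V1"
        using fv\<phi> unfolding V1_def by blast
      have "\<tau> ` fset x \<subseteq> V1" unfolding V1_def by blast
      with \<tau>(1) have "\<tau> ` fv (subst ?sx \<Phi>) \<subseteq> V1" using fvV1 by (rule opens_image)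
      with fv_subst[of \<tau> "subst ?sx \<Phi>"] have fv1: "fv (subst \<tau> (subst ?sx \<Phi>)) \<subseteq> V1"
        by (rule subset_trans)
      have "fragment_garden (x \<cdot> subst ?sx \<Phi>)"
        using frag by (auto simp: fragment_def fragment_garden_def is_bouquet_iff)
      from fragment_body[OF this] \<tau>(1) have fragb: "fragment (subst \<tau> (subst ?sx \<Phi>))"
        by (simp only: garden.sel)
      have "theory_over V1 (set_mset (subst \<tau> (subst ?sx \<Phi>)))"
        unfolding theory_over_def
      proof
        fix \<psi> assume \<psi>: "\<psi> \<in># subst \<tau> (subst ?sx \<Phi>)"
        from fragment_single[OF fragb \<psi>] subset_trans[OF fv_mono[OF \<psi>] fv1]
        show "fragment {#\<psi>#} \<and> fv_flower \<psi> \<subseteq> V1" ..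
      qed
      then have T1: "theory_over V1 T1"
        using V(3) unfolding theory_over_def T1_def V1_def by blast
      have V1: "V1 \<inter> B = {}" "V1 \<noteq> {}" "infinite (- B - V1)"
      proof -
        show "V1 \<inter> B = {}" using V(1) \<tau>(3) unfolding V1_def by blast
        show "V1 \<noteq> {}" using s(1) unfolding V1_def by blast
        have "- B - V1 = (- B - params w) - \<tau> ` fset x" unfolding V1_def by blast
        then show "infinite (- B - V1)" using V(2) by (simp add: Diff_infinite_finite)
      qed
      from saturated_extension[OF V1(1,3,2) T1 frag1 nd1] obtain V' T' where
        VT': "V1 \<subseteq> V'" "T1 \<subseteq> T'" "saturated V' T'" "\<not> derivable T' {#unit_garden \<rhd> ?\<Delta>1#}" .
      define w' where "w' = encode V' T'"
      have w': "params w' = V'" "facts w' = T'" by (simp_all add: w'_def)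
      have sat': "saturated (params w') (facts w')" using VT'(3) w' by simp
      have acc: "(w, w') \<in> accessible canonical"
        using VT'(1,2) sat sat' unfolding canonical_simps w' V1_def T1_def by blast
      \<comment> \<open>The eigenvariables as an evaluation of the sprinkler; off \<open>x\<close>
        the value \<open>s v\<close> merely keeps it inside the domain of \<open>w'\<close>.\<close>
      define e' where "e' = (\<lambda>v. to_nat (if v |\<in>| x then \<tau> v else s v))"
      have e': "evaluation canonical w' e'"
        unfolding e'_def using VT'(1) s(1) unfolding V1_def w'(1)[symmetric] by (intro evaluation_to_nat) auto
      let ?e1 = "override_on e e' (fset x)"
      have e1: "evaluation canonical w' ?e1"
        by (rule evaluation_override[OF evaluation_mono[OF e acc] e'])
      define s' where "s' = subst_of e'"
      have \<tau>s: "\<tau> = override_on id s' (fset x)"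
        using \<tau>(1) by (auto simp: opens_def fun_eq_iff override_on_def s'_def e'_def)
      define s1 where "s1 = override_on s s' (fset x)"
      have s1: "subst_of ?e1 = s1" unfolding subst_of_override s_def s'_def s1_def ..
      have s1B: "s1 v \<notin> B" for v
        using evaluationD(1)[OF e1] saturated_params[OF sat'] unfolding s1 by blast
      have eq: "subst (subst_of ?e1) \<Phi> = subst \<tau> (subst ?sx \<Phi>)"
        unfolding s1 s1_def \<tau>s subst_open[OF x s(2) \<Phi>(3)] ..
      have "set_mset (subst (subst_of ?e1) \<Phi>) \<subseteq> facts w'"
        using VT'(2) unfolding eq T1_def w' by (simp only: Un_subset_iff)
      from truth_body(1)[OF IH\<Phi> \<Phi> sat' e1 this]
      have "forces_body canonical w' ?e1 (x \<cdot> \<Phi>)" .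
      with forces acc e' obtain \<delta> e'' where \<delta>: "\<delta> \<in># \<Delta>" and e'': "evaluation canonical w' e''"
        and fd: "forces_body canonical w' (override_on ?e1 e'' (fset (sprinkler \<delta>))) \<delta>"
        unfolding forces_flower.simps garden.sel by blast
      let ?Y = "fset (sprinkler \<delta>)"
      have "forces_body canonical w' (override_on ?e1 e'' ?Y) (sprinkler \<delta> \<cdot> body \<delta>)" using fd by simp
      from truth_body(2)[OF IH\<Delta>[OF \<delta>] \<Delta>(1,2,4)[OF \<delta>] sat' evaluation_override[OF e1 e''] this]
      have der: "derivable T' (subst (subst_of (override_on ?e1 e'' ?Y)) (body \<delta>))" unfolding w' .
      let ?\<delta>1 = "subst_garden \<tau> (subst_garden ?sx \<delta>)"
      \<comment> \<open>The evaluation at which the petal is forced, read as an instance for petal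
        introduction.\<close>
      let ?\<sigma> = "override_on id (subst_of e'') ?Y"
      have \<delta>1: "sprinkler ?\<delta>1 = sprinkler \<delta>" "body ?\<delta>1 = subst (without s1 ?Y) (body \<delta>)"
        unfolding \<tau>s petal[OF \<delta>] s1_def by simp_all
      have "subst ?\<sigma> (body ?\<delta>1) = subst (override_on s1 (subst_of e'') ?Y) (body \<delta>)"
        unfolding \<delta>1(2) by (rule subst_open[OF \<Delta>(5)[OF \<delta>] s1B \<Delta>(4)[OF \<delta>]])
      also have "override_on s1 (subst_of e'') ?Y = subst_of (override_on ?e1 e'' ?Y)"
        unfolding subst_of_override[of ?e1] s1 ..
      finally have eq: "subst ?\<sigma> (body ?\<delta>1) = subst (subst_of (override_on ?e1 e'' ?Y)) (body \<delta>)" .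
      have "derivable T' (subst ?\<sigma> (body ?\<delta>1))" unfolding eq by (rule der)
      moreover have "opens (sprinkler ?\<delta>1) ?\<sigma>"
        unfolding \<delta>1(1)
      proof (rule opens_override)
        show "subst_of e'' v \<notin> B" for v
          using evaluationD(1)[OF e''] saturated_params[OF sat'] by blast
      qed
      moreover have "?\<delta>1 \<in># ?\<Delta>1" using \<delta> by auto
      ultimately have "derivable T' {#unit_garden \<rhd> ?\<Delta>1#}"
        by (intro derivable_petal[OF frag1])
      with VT'(4) show False ..
    qed
  qed
qed

lemma truth: "truth \<phi>"
  and "\<forall>\<phi>\<in>#body \<gamma>. truth \<phi>"
proof (induction \<phi> and \<gamma>)
  case (Atom p xs)
  show ?case by (rule truth_atom)
next
  case (Flower \<gamma> \<Delta>)
  obtain x \<Phi> where \<gamma>: "\<gamma> = x \<cdot> \<Phi>" by (cases \<gamma>)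
  show ?case unfolding \<gamma>
    by (rule truth_flower) (use Flower in \<open>auto simp: \<gamma>\<close>)
qed simp


lemma completeness:
  assumes \<Phi>: "fragment \<Phi>" and \<Psi>: "fragment \<Psi>" and ent: "entails TYPE(nat set) TYPE(nat) ar \<Phi> \<Psi>"
  shows "derivable (set_mset \<Phi>) \<Psi>"
proof (rule ccontr)
  assume nd: "\<not> derivable (set_mset \<Phi>) \<Psi>"
  have "infinite (- B)"
    using infinite_vars finite_B by (simp add: Compl_eq_Diff_UNIV)
  \<comment> \<open>\<open>v\<^sub>0\<close> keeps the set of parameters nonempty when neither
    bouquet has free variables, and is the default value of \<open>e\<close> outside
    \<open>V\<close>.\<close>
  then obtain v\<^sub>0 where v\<^sub>0: "v\<^sub>0 \<notin> B" using infinite_imp_nonempty by blast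
  define V\<^sub>0 where "V\<^sub>0 = {v\<^sub>0} \<union> fv \<Phi> \<union> fv \<Psi>"
  have "finite V\<^sub>0" by (simp add: V\<^sub>0_def)
  with \<open>infinite (- B)\<close> have inf: "infinite (- B - V\<^sub>0)" by (simp add: Diff_infinite_finite)
  have V\<^sub>0: "V\<^sub>0 \<inter> B = {}" "V\<^sub>0 \<noteq> {}"
    using v\<^sub>0 \<Phi> \<Psi> unfolding V\<^sub>0_def fragment_def by blast+
  have over: "theory_over V\<^sub>0 (set_mset \<Phi>)"
    unfolding theory_over_def
  proof
    fix \<phi> assume \<phi>: "\<phi> \<in># \<Phi>"
    from fv_mono[OF \<phi>] fragment_single[OF \<Phi> \<phi>]
    show "fragment {#\<phi>#} \<and> fv_flower \<phi> \<subseteq> V\<^sub>0" unfolding V\<^sub>0_def by blast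
  qed
  from saturated_extension[OF V\<^sub>0(1) inf V\<^sub>0(2) over \<Psi> nd] obtain V T where
    T: "V\<^sub>0 \<subseteq> V" "set_mset \<Phi> \<subseteq> T" "saturated V T" "\<not> derivable T \<Psi>" .
  define w where "w = encode V T"
  have w: "params w = V" "facts w = T" by (simp_all add: w_def)
  have sat: "saturated (params w) (facts w)" using T(3) w by simp
  have v\<^sub>0V: "v\<^sub>0 \<in> V" using T(1) unfolding V\<^sub>0_def by blast
  \<comment> \<open>Each parameter denotes its own code, so \<open>subst_of e\<close> leaves both
    bouquets unchanged.\<close>
  define e where "e = (\<lambda>v. to_nat (if v \<in> V then v else v\<^sub>0))"
  have e: "evaluation canonical w e"
    unfolding e_def using v\<^sub>0V by (intro evaluation_to_nat) (simp add: w)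
  have id: "subst (subst_of e) \<Theta> = \<Theta>" if "fv \<Theta> \<subseteq> V" for \<Theta> :: "('p, 'v) bouquet"
    using that by (intro subst_id) (auto simp: e_def)
  have fv: "fv \<Phi> \<subseteq> V" "fv \<Psi> \<subseteq> V" using T(1) unfolding V\<^sub>0_def by blast+
  have frag: "wf ar \<Theta>" "distinct_mset (binders \<Theta>)" "bv \<Theta> \<subseteq> B" if "fragment \<Theta>" for \<Theta>
    using that unfolding fragment_def is_bouquet_iff by blast+
  have "forces_body canonical w e ({||} \<cdot> \<Phi>)"
    by (rule truth_body(1)[OF truth(1) frag[OF \<Phi>] sat e]) (simp only: id[OF fv(1)] w T(2))
  then have "forces canonical w e \<Phi>" by (simp add: forces_def)
  moreover have "w \<in> worlds canonical" using sat by (simp add: canonical_simps)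
  ultimately have "forces canonical w e \<Psi>"
    using ent kripke_canonical e unfolding entails_def by blast
  then have "forces_body canonical w e ({||} \<cdot> \<Psi>)" by (simp add: forces_def)
  from truth_body(2)[OF truth(1) frag[OF \<Psi>] sat e this]
  have "derivable T \<Psi>" by (simp only: id[OF fv(2)] w)
  with T(4) show False ..
qed

end

section \<open>From fragments to arbitrary bouquets\<close>

lemma fresh_rename:
  fixes \<Phi> :: "('p, 'v) bouquet"
  assumes "infinite (UNIV :: 'v set)" "finite A" "fv \<Phi> \<subseteq> A" "is_bouquet ar \<Phi>"
  obtains \<rho> where "bij \<rho>" "\<forall>v\<in>fv \<Phi>. \<rho> v = v" "is_bouquet ar (map_bouquet \<rho> \<Phi>)"
    "bv (map_bouquet \<rho> \<Phi>) \<inter> A = {}" "fv (map_bouquet \<rho> \<Phi>) = fv \<Phi>"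
proof -
  obtain \<rho> where \<rho>: "bij \<rho>" "\<And>v. v \<in> bv \<Phi> \<Longrightarrow> \<rho> v \<notin> A" "\<And>v. v \<in> A \<Longrightarrow> v \<notin> bv \<Phi> \<Longrightarrow> \<rho> v = v"
    using fresh_swap[OF assms(1) finite_bv assms(2)] by metis
  have inj: "inj \<rho>" by (rule bij_is_inj[OF \<rho>(1)])
  have fixed: "\<forall>v\<in>fv \<Phi>. \<rho> v = v"
    using assms(3,4) \<rho>(3) unfolding is_bouquet_def by blast
  then have fv: "fv (map_bouquet \<rho> \<Phi>) = fv \<Phi>"
    by (intro fv_map_fixed(1)[OF \<rho>(1)]) blast
  have bv: "bv (map_bouquet \<rho> \<Phi>) \<inter> A = {}"
    unfolding bv_map_bouquet using \<rho>(2) by blast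
  have "wf ar (map_bouquet \<rho> \<Phi>)" "distinct_mset (binders (map_bouquet \<rho> \<Phi>))"
    using assms(4) by (simp_all add: is_bouquet_iff binders_map_bouquet[OF inj] distinct_mset_image[OF inj])
  moreover have "bv (map_bouquet \<rho> \<Phi>) \<inter> fv (map_bouquet \<rho> \<Phi>) = {}"
    unfolding fv using bv assms(3) by blast
  ultimately have "is_bouquet ar (map_bouquet \<rho> \<Phi>)" by (simp add: is_bouquet_iff)
  with \<rho>(1) fixed show thesis using bv fv by (rule that)
qed

text \<open>A renaming alone is not a derivation, but it can be attached to a detour through an empty
  flower.\<close>

lemma reduces_imp_steps:
  fixes \<Xi> :: "('p, 'v) ctx"
  assumes bq: "is_bouquet ar (fill \<Xi> {#})" and red: "reduces ar \<Phi> (fill \<Xi> {#})"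
  shows "(natural_step ar)\<^sup>*\<^sup>* \<Phi> (fill \<Xi> {#})"
  using reduces_cases[OF red]
proof
  let ?u = "{#unit_garden \<rhd> {#unit_garden#}#} :: ('p, 'v) bouquet"
  assume "\<Phi> \<approx>\<^sub>\<alpha> fill \<Xi> {#}"
  then have "natural_step ar \<Phi> (fill \<Xi> ?u)"
    unfolding natural_step_def using bq natural_rule.epis[of "{#}"] alpha_refl by blast
  moreover have "natural_step ar (fill \<Xi> ?u) (fill \<Xi> {#})"
  proof -
    have "is_bouquet ar (fill \<Xi> ?u)"
      using bq binders_fill[of \<Xi> ?u] bv_fill[of \<Xi> ?u] fv_fill(1)[of \<Xi> ?u]
        wf_fill(1)[where ar = ar and \<Xi> = \<Xi> and \<Phi> = ?u]
      unfolding is_bouquet_iff by simp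
    then show ?thesis
      unfolding natural_step_def using natural_rule.epet[of unit_garden "{#}"] alpha_refl by blast
  qed
  ultimately show ?thesis by (rule converse_rtranclp_into_rtranclp[OF _ r_into_rtranclp])
qed (rule tranclp_into_rtranclp)

theorem mainTheorem4:
  fixes ar :: "'p::countable \<Rightarrow> nat"
    and \<Phi> \<Psi> :: "('p, 'v::countable) bouquet"
  assumes "infinite (UNIV :: 'v set)"
    and "is_bouquet ar \<Phi>"
    and "is_bouquet ar \<Psi>"
    and "entails TYPE(nat set) TYPE(nat) ar \<Phi> \<Psi>"
  shows "natural_deriv ar \<Phi> \<Psi>"
  unfolding natural_deriv_def
proof (intro allI impI, elim conjE)
  fix \<Xi> :: "('p, 'v) ctx"
  assume \<Xi>: "is_bouquet ar (fill \<Xi> {#})" and poll: "can_pollinate \<Phi> \<Xi>"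
  \<comment> \<open>The binders of the given bouquets may occur in the context or free in the other
    bouquet, so they could not serve as \<open>B\<close>. Each bouquet is renamed by a single
    bijection, rather than by \<open>freshen\<close>, so that \<open>forces_rename\<close> transfers
    the entailment.\<close>
  define A where "A = bv (fill \<Xi> {#}) \<union> fv (fill \<Xi> {#}) \<union> fv \<Phi> \<union> fv \<Psi>"
  have A: "finite A" "fv \<Phi> \<subseteq> A" "fv \<Psi> \<subseteq> A" unfolding A_def by auto
  from fresh_rename[OF assms(1) A(1,2) assms(2)] obtain \<rho> where
    \<rho>: "bij \<rho>" "\<forall>v\<in>fv \<Phi>. \<rho> v = v" "is_bouquet ar (map_bouquet \<rho> \<Phi>)"
    "bv (map_bouquet \<rho> \<Phi>) \<inter> A = {}" "fv (map_bouquet \<rho> \<Phi>) = fv \<Phi>" .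
  from fresh_rename[OF assms(1) A(1,3) assms(3)] obtain \<rho>' where
    \<rho>': "bij \<rho>'" "\<forall>v\<in>fv \<Psi>. \<rho>' v = v" "is_bouquet ar (map_bouquet \<rho>' \<Psi>)"
    "bv (map_bouquet \<rho>' \<Psi>) \<inter> A = {}" "fv (map_bouquet \<rho>' \<Psi>) = fv \<Psi>" .
  define \<Phi>' \<Psi>' where "\<Phi>' = map_bouquet \<rho> \<Phi>" and "\<Psi>' = map_bouquet \<rho>' \<Psi>"
  define B where "B = bv \<Phi>' \<union> bv \<Psi>'"
  interpret countable_sequent ar B
    using assms(1) by unfold_locales (simp_all add: B_def)
  have BA: "B \<inter> A = {}" using \<rho>(4) \<rho>'(4) unfolding B_def \<Phi>'_def \<Psi>'_def by blast
  have "fv \<Phi>' \<inter> B = {}" "fv \<Psi>' \<inter> B = {}"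
    unfolding \<Phi>'_def \<Psi>'_def \<rho>(5) \<rho>'(5) using A(2,3) BA by blast+
  then have frag: "fragment \<Phi>'" "fragment \<Psi>'"
    using \<rho>(3) \<rho>'(3) unfolding fragment_def \<Phi>'_def[symmetric] \<Psi>'_def[symmetric]
    by (simp_all add: B_def)
  have forces: "forces K w e \<Phi>' \<longleftrightarrow> forces K w e \<Phi>" "forces K w e \<Psi>' \<longleftrightarrow> forces K w e \<Psi>"
    for K :: "(nat set, nat, 'p) kripke" and w e
    unfolding \<Phi>'_def \<Psi>'_def using \<rho>(2) \<rho>'(2) by (simp_all add: forces_rename \<rho>(1) \<rho>'(1))
  have "entails TYPE(nat set) TYPE(nat) ar \<Phi>' \<Psi>'"
    using assms(4) unfolding entails_def forces .
  from completeness[OF frag this] obtain H where H: "H \<subseteq> set_mset \<Phi>'" "provable H \<Psi>'"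
    unfolding derivable_def by blast
  obtain S where S: "binders (fill \<Xi> {#}) = path_binders \<Xi> + S"
    using binders_fill_path(1) by blast
  then have "set_mset (path_binders \<Xi>) \<subseteq> bv (fill \<Xi> {#})"
    by (metis set_binders set_mset_union Un_upper1)
  then have good: "good \<Xi>"
    using \<Xi> S BA unfolding good_def is_bouquet_iff A_def by (auto simp: disjoint_iff)
  \<comment> \<open>Availability is up to renaming, so the renamed hypotheses are as available as
    the flowers of \<open>\<Phi>\<close>. Provability is used at the identity as parameter
    map.\<close>
  have avail: "\<forall>\<phi>\<in>H. available (subst_flower id \<phi>) \<Xi>"
  proof
    fix \<phi>' assume "\<phi>' \<in> H"
    with H(1) have "\<phi>' \<in> map_flower id \<rho> ` set_mset \<Phi>"
      unfolding \<Phi>'_def set_image_mset by (rule subsetD)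
    then obtain \<phi> where \<phi>: "\<phi> \<in># \<Phi>" "\<phi>' = map_flower id \<rho> \<phi>" by blast
    have "\<rho> v = v" if "v \<in> fv {#\<phi>#}" for v
      using \<rho>(2) fv_mono[OF \<phi>(1)] that unfolding fv_add_mset fv_empty by blast
    then have "{#\<phi>#} \<approx>\<^sub>\<alpha> map_bouquet \<rho> {#\<phi>#}"
      by (rule alpha_rename[OF \<rho>(1)])
    then have "{#\<phi>'#} \<approx>\<^sub>\<alpha> {#\<phi>#}"
      unfolding \<phi>(2) image_mset_single by (rule alpha_sym)
    moreover have "available \<phi> \<Xi>"
      using poll \<phi>(1) by (simp add: can_pollinate_def can_pollinate_flower_iff)
    ultimately show "available (subst_flower id \<phi>') \<Xi>"
      unfolding subst_flower_ident by (rule available_alpha(1))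
  qed
  have "\<Psi> \<approx>\<^sub>\<alpha> \<Psi>'"
    unfolding \<Psi>'_def using \<rho>'(2) by (intro alpha_rename[OF \<rho>'(1)]) blast
  then have "reduces ar (fill \<Xi> \<Psi>) (fill \<Xi> \<Psi>')"
    by (rule reduces_alpha[OF alpha_fill])
  also have "reduces ar (fill \<Xi> \<Psi>') (fill \<Xi> {#})"
    using provableD[OF H(2) param_map_id good avail] subst_id[of \<Psi>' id] by simp
  finally show "(natural_step ar)\<^sup>*\<^sup>* (fill \<Xi> \<Psi>) (fill \<Xi> {#})"
    by (rule reduces_imp_steps[OF \<Xi>])
qed

end
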